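(* Let $\mathcal W$ be a weak fundamental localizer. The class of $\mathcal W$-exact squares is the smallest class $\mathcal Q$ of squares (closed under isomorphism of squares) that is stable under passage to opposite categories, stable under horizontal composition, satisfies the local descent condition, contains all comma squares, and contains all commutative squares of the form $$\begin{array}{ccc} A&\to& e\\ \downarrow&&\downarrow\\ e&\to& e\end{array}$$ where $A$ is a $\mathcal W$-aspherical small category. (That is: the class of $\mathcal W$-exact squares has all these properties, and is contained in every class of squares having all these properties.)
   Context: $\mathrm{Cat}$ is the (2-)category of small categories; $e$ is the terminal (one-object, one-arrow) category. For a functor $u:A\to B$ and an object $b$ of $B$: $A/b$ is the category of pairs $(a,g:u(a)\to b)$, a morphism $(a_1,g_1)\to(a_2,g_2)$ being an arrow $f:a_1\to a_2$ of $A$ with $g_2u(f)=g_1$. An object $b$ of $B$ is identified with the functor $b:e\to B$. A class $\mathcal W$ of arrows of $\mathrm{Cat}$ is weakly saturated if: identities are in $\mathcal W$; if two of the three arrows of a commutative triangle are in $\mathcal W$, so is the third; if $i:A'\to A$, $r:A\to A'$ satisfy $ri=1_{A'}$ and $ir\in\mathcal W$, then $r\in\mathcal W$. A weak fundamental localizer is a class $\mathcal W$ of arrows of $\mathrm{Cat}$ such that: $\mathcal W$ is weakly saturated; if $A$ has a terminal object, then $A\to e$ is in $\mathcal W$; if $u:A\to B$ is such that for every object $b$ of $B$ the induced functor $A/b\to B/b$ is in $\mathcal W$, then $u\in\mathcal W$. A small category $A$ is $\mathcal W$-aspherical if $A\to e$ is in $\mathcal W$. A square $\mathcal D$ consists of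 small categories $A,B,A',B'$, functors $v:A'\to A$ (top), $w:B'\to B$ (bottom), $u':A'\to B'$ (left), $u:A\to B$ (right), and a natural transformation $\alpha:uv\to wu'$. It is commutative if $\alpha$ is an identity. It is a comma square if the canonical functor $a'\mapsto (v(a'),u'(a'),\alpha_{a'})$ from $A'$ to the comma category $u\downarrow w$ (objects: triples $(a,b',g:u(a)\to w(b'))$; morphisms: pairs $(f,g')$ with $g_2u(f)=w(g')g_1$) is an isomorphism. An isomorphism of squares consists of isomorphisms of the four categories compatible with the four functors and the natural transformation. $\mathcal D$ is $\mathcal W$-exact if for all objects $a$ of $A$, $b'$ of $B'$ and every arrow $g:u(a)\to w(b')$ of $B$, the following category $A'_{(a,b',g)}$ is $\mathcal W$-aspherical: objects are triples $(a',f,g')$ with $a'\in\mathrm{Ob}\,A'$, $f:a\to v(a')$ in $A$, $g':u'(a')\to b'$ in $B'$ such that $w(g')\alpha_{a'}u(f)=g$; morphisms $(a'_1,f_1,g'_1)\to(a'_2,f_2,g'_2)$ are arrows $f':a'_1\to a'_2$ of $A'$ with $v(f')f_1=f_2$ and $g'_2u'(f')=g'_1$. Opposite square: the opposite of $\mathcal D$ has top $u'^{op}:A'^{op}\to B'^{op}$, left $v^{op}:A'^{op}\to A^{op}$, bottom $u^{op}:A^{op}\to B^{op}$, right $w^{op}:B'^{op}\to B^{op}$, and 2-cell $\alpha^{op}$. $\mathcal Q$ is stable under passage to opposite categories if the opposite of every square of $\mathcal Q$ is in $\mathcal Q$. Horizontal composition: given $\mathcal D$ and a square $\mathcal D'$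 with top $v':A''\to A'$, bottom $w':B''\to B'$, left $u'':A''\to B''$, right $u'$, and 2-cell $\alpha':u'v'\to w'u''$, the composite $\mathcal D\circ_h\mathcal D'$ has top $vv'$, bottom $ww'$, left $u''$, right $u$ and 2-cell $(w\star\alpha')(\alpha\star v')$. Local descent condition for $\mathcal Q$: for every square $\mathcal D$ with top $v:A'\to A$, bottom $w:B'\to B$, left $u':A'\to B'$, right $u:A\to B$ and 2-cell $\alpha:uv\to wu'$, if for every object $b'$ of $B'$ the composite $\mathcal D\circ_h\mathcal D^{g}_{u',b'}$ is in $\mathcal Q$, then $\mathcal D$ is in $\mathcal Q$. Here $\mathcal D^{g}_{u',b'}$ is the comma square with top the forgetful functor $A'/b'\to A'$, left $A'/b'\to e$, bottom $b':e\to B'$, right $u'$, and 2-cell with component $g'$ at $(a',g')$. *)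

theory Defs
  imports "HOL-Library.FuncSet" "HOL-Library.Nat_Bijection"
begin

section \<open>Universes\<close>

(* A universe is presented as a type, whose elements are the sets of the universe, with a predicate
   telling which collections of elements are small, i.e. form again an element of the universe.
   For a Grothendieck universe U one takes for small_set X the statement that X is an element of U,
   for upair the Kuratowski pair and for pt the empty set.  Only the closure properties of a
   Grothendieck universe which bear on the constructions below are required; in particular
   power sets are not. *)
class universe =
  fixes small_set :: "'a set \<Rightarrow> bool"
    and upair :: "'a \<Rightarrow> 'a \<Rightarrow> 'a"
    and pt :: 'a
  assumes small_doubleton: "small_set {x, y}"
    and small_subset: "small_set X \<Longrightarrow> Y \<subseteq> X \<Longrightarrow> small_set Y"
    and small_Union: "small_set I \<Longrightarrow> (\<And>i. i \<in> I \<Longrightarrow> small_set (F i)) \<Longrightarrow> small_set (\<Union>i\<in>I. F i)"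
    and upair_inject: "upair x y = upair x' y' \<longleftrightarrow> x = x' \<and> y = y'"
    and nontrivial: "\<exists>x. x \<noteq> pt"

instantiation nat :: universe
begin
definition small_set_nat :: "nat set \<Rightarrow> bool" where "small_set_nat X \<longleftrightarrow> True"
definition upair_nat :: "nat \<Rightarrow> nat \<Rightarrow> nat" where "upair_nat x y = prod_encode (x, y)"
definition pt_nat :: nat where "pt_nat = 0"
instance
  by standard (auto simp: small_set_nat_def upair_nat_def pt_nat_def)
end

definition ufst :: "'u::universe \<Rightarrow> 'u" where
  "ufst z = (THE x. \<exists>y. z = upair x y)"

definition usnd :: "'u::universe \<Rightarrow> 'u" where
  "usnd z = (THE y. \<exists>x. z = upair x y)"

definition utriple :: "'u::universe \<Rightarrow> 'u \<Rightarrow> 'u \<Rightarrow> 'u" where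
  "utriple x y z = upair x (upair y z)"

definition p1 :: "'u::universe \<Rightarrow> 'u" where "p1 t = ufst t"
definition p2 :: "'u::universe \<Rightarrow> 'u" where "p2 t = ufst (usnd t)"
definition p3 :: "'u::universe \<Rightarrow> 'u" where "p3 t = usnd (usnd t)"

lemma ufst_upair [simp]: "ufst (upair x y) = x"
  and usnd_upair [simp]: "usnd (upair x y) = y"
  by (auto simp: ufst_def usnd_def upair_inject)

lemma p_utriple [simp]: "p1 (utriple x y z) = x" "p2 (utriple x y z) = y" "p3 (utriple x y z) = z"
  by (simp_all add: p1_def p2_def p3_def utriple_def)

lemma utriple_inject [simp]: "utriple x y z = utriple x' y' z' \<longleftrightarrow> x = x' \<and> y = y' \<and> z = z'"
  by (simp add: utriple_def upair_inject)


section \<open>The 2-category of small categories\<close>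

(* Throughout, structure maps take the value undefined outside their domain, so that equality of
   categories, functors and natural transformations is equality of the representing terms.
   Cmp C g f is the composite of f followed by g. *)
record 'u cat =
  Ob :: "'u set"
  Ar :: "'u set"
  Dom :: "'u \<Rightarrow> 'u"
  Cod :: "'u \<Rightarrow> 'u"
  Idn :: "'u \<Rightarrow> 'u"
  Cmp :: "'u \<Rightarrow> 'u \<Rightarrow> 'u"

definition hom :: "'u cat \<Rightarrow> 'u \<Rightarrow> 'u \<Rightarrow> 'u set" where
  "hom C x y = {f \<in> Ar C. Dom C f = x \<and> Cod C f = y}"

definition small_cat :: "'u::universe cat \<Rightarrow> bool" where
  "small_cat C \<longleftrightarrow>
     small_set (Ob C) \<and> small_set (Ar C) \<and>
     Dom C \<in> Ar C \<rightarrow>\<^sub>E Ob C \<and> Cod C \<in> Ar C \<rightarrow>\<^sub>E Ob C \<and> Idn C \<in> Ob C \<rightarrow>\<^sub>E Ar C \<and>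
     (\<forall>x\<in>Ob C. Idn C x \<in> hom C x x) \<and>
     (\<forall>f\<in>Ar C. \<forall>g\<in>Ar C. Cod C f = Dom C g \<longrightarrow> Cmp C g f \<in> hom C (Dom C f) (Cod C g)) \<and>
     (\<forall>f\<in>Ar C. Cmp C f (Idn C (Dom C f)) = f \<and> Cmp C (Idn C (Cod C f)) f = f) \<and>
     (\<forall>f\<in>Ar C. \<forall>g\<in>Ar C. \<forall>h\<in>Ar C. Cod C f = Dom C g \<and> Cod C g = Dom C h \<longrightarrow>
        Cmp C h (Cmp C g f) = Cmp C (Cmp C h g) f) \<and>
     (\<forall>f g. \<not> (f \<in> Ar C \<and> g \<in> Ar C \<and> Cod C f = Dom C g) \<longrightarrow> Cmp C g f = undefined)"

record 'u func =
  Src :: "'u cat"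
  Trg :: "'u cat"
  FO :: "'u \<Rightarrow> 'u"
  FA :: "'u \<Rightarrow> 'u"

definition is_functor :: "'u::universe func \<Rightarrow> bool" where
  "is_functor F \<longleftrightarrow>
     small_cat (Src F) \<and> small_cat (Trg F) \<and>
     FO F \<in> Ob (Src F) \<rightarrow>\<^sub>E Ob (Trg F) \<and> FA F \<in> Ar (Src F) \<rightarrow>\<^sub>E Ar (Trg F) \<and>
     (\<forall>f\<in>Ar (Src F). FA F f \<in> hom (Trg F) (FO F (Dom (Src F) f)) (FO F (Cod (Src F) f))) \<and>
     (\<forall>x\<in>Ob (Src F). FA F (Idn (Src F) x) = Idn (Trg F) (FO F x)) \<and>
     (\<forall>f\<in>Ar (Src F). \<forall>g\<in>Ar (Src F). Cod (Src F) f = Dom (Src F) g \<longrightarrow>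
        FA F (Cmp (Src F) g f) = Cmp (Trg F) (FA F g) (FA F f))"

definition id_func :: "'u cat \<Rightarrow> 'u func" where
  "id_func C = \<lparr> Src = C, Trg = C, FO = (\<lambda>x\<in>Ob C. x), FA = (\<lambda>f\<in>Ar C. f) \<rparr>"

definition cmp_func :: "'u func \<Rightarrow> 'u func \<Rightarrow> 'u func" where
  "cmp_func G F = \<lparr> Src = Src F, Trg = Trg G,
     FO = compose (Ob (Src F)) (FO G) (FO F), FA = compose (Ar (Src F)) (FA G) (FA F) \<rparr>"

definition is_iso_func :: "'u::universe func \<Rightarrow> bool" where
  "is_iso_func F \<longleftrightarrow> is_functor F \<and>
     (\<exists>G. is_functor G \<and> Src G = Trg F \<and> Trg G = Src F \<and>
        cmp_func G F = id_func (Src F) \<and> cmp_func F G = id_func (Trg F))"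

(* A natural transformation from F to G is given by its components, indexed by Ob (Src F). *)
definition is_nat :: "'u func \<Rightarrow> 'u func \<Rightarrow> ('u \<Rightarrow> 'u) \<Rightarrow> bool" where
  "is_nat F G \<alpha> \<longleftrightarrow>
     Src F = Src G \<and> Trg F = Trg G \<and> \<alpha> \<in> extensional (Ob (Src F)) \<and>
     (\<forall>x\<in>Ob (Src F). \<alpha> x \<in> hom (Trg F) (FO F x) (FO G x)) \<and>
     (\<forall>f\<in>Ar (Src F). Cmp (Trg F) (\<alpha> (Cod (Src F) f)) (FA F f) =
        Cmp (Trg F) (FA G f) (\<alpha> (Dom (Src F) f)))"

definition id_nat :: "'u func \<Rightarrow> 'u \<Rightarrow> 'u" where
  "id_nat F = (\<lambda>x\<in>Ob (Src F). Idn (Trg F) (FO F x))"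

definition op_cat :: "'u cat \<Rightarrow> 'u cat" where
  "op_cat C = \<lparr> Ob = Ob C, Ar = Ar C, Dom = Cod C, Cod = Dom C, Idn = Idn C,
     Cmp = (\<lambda>g f. Cmp C f g) \<rparr>"

definition op_func :: "'u func \<Rightarrow> 'u func" where
  "op_func F = \<lparr> Src = op_cat (Src F), Trg = op_cat (Trg F), FO = FO F, FA = FA F \<rparr>"

definition has_terminal :: "'u cat \<Rightarrow> bool" where
  "has_terminal C \<longleftrightarrow> (\<exists>t\<in>Ob C. \<forall>x\<in>Ob C. \<exists>!f. f \<in> hom C x t)"

definition one_cat :: "'u::universe cat" where
  "one_cat = \<lparr> Ob = {pt}, Ar = {pt}, Dom = (\<lambda>_\<in>{pt}. pt), Cod = (\<lambda>_\<in>{pt}. pt),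
     Idn = (\<lambda>_\<in>{pt}. pt), Cmp = (\<lambda>g f. if g = pt \<and> f = pt then pt else undefined) \<rparr>"

definition to_one :: "'u::universe cat \<Rightarrow> 'u func" where
  "to_one C = \<lparr> Src = C, Trg = one_cat, FO = (\<lambda>_\<in>Ob C. pt), FA = (\<lambda>_\<in>Ar C. pt) \<rparr>"

definition ob_func :: "'u::universe cat \<Rightarrow> 'u \<Rightarrow> 'u func" where
  "ob_func C b = \<lparr> Src = one_cat, Trg = C, FO = (\<lambda>_\<in>{pt}. b), FA = (\<lambda>_\<in>{pt}. Idn C b) \<rparr>"


section \<open>Slices and comma categories\<close>

(* The category with set of objects X whose arrows from x to y are the elements f of H x y, encoded
   as triples (x, f, y) so that source and target are determined; i and m give the identities and
   the composition. *)
definition mk_cat ::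
  "'u::universe set \<Rightarrow> ('u \<Rightarrow> 'u \<Rightarrow> 'u set) \<Rightarrow> ('u \<Rightarrow> 'u) \<Rightarrow> ('u \<Rightarrow> 'u \<Rightarrow> 'u) \<Rightarrow> 'u cat" where
  "mk_cat X H i m =
     (let T = {utriple x f y | x f y. x \<in> X \<and> y \<in> X \<and> f \<in> H x y} in
      \<lparr> Ob = X, Ar = T, Dom = (\<lambda>t\<in>T. p1 t), Cod = (\<lambda>t\<in>T. p3 t), Idn = (\<lambda>x\<in>X. utriple x (i x) x),
        Cmp = (\<lambda>s t. if t \<in> T \<and> s \<in> T \<and> p3 t = p1 s
                 then utriple (p1 t) (m (p2 s) (p2 t)) (p3 s) else undefined) \<rparr>)"

(* For u from A to B, this is the category A/b of pairs (a, g) with g from u(a) to b. *)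
definition slice :: "'u::universe func \<Rightarrow> 'u \<Rightarrow> 'u cat" where
  "slice u b = (let A = Src u; B = Trg u in
     mk_cat {upair a g | a g. a \<in> Ob A \<and> g \<in> hom B (FO u a) b}
       (\<lambda>x y. {f \<in> hom A (ufst x) (ufst y). Cmp B (usnd y) (FA u f) = usnd x})
       (\<lambda>x. Idn A (ufst x)) (Cmp A))"

definition slice_forget :: "'u::universe func \<Rightarrow> 'u \<Rightarrow> 'u func" where
  "slice_forget u b = \<lparr> Src = slice u b, Trg = Src u,
     FO = (\<lambda>x\<in>Ob (slice u b). ufst x), FA = (\<lambda>t\<in>Ar (slice u b). p2 t) \<rparr>"

(* The functor from A/b to B/b induced by u. *)
definition slice_map :: "'u::universe func \<Rightarrow> 'u \<Rightarrow> 'u func" where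
  "slice_map u b = (let \<phi> = (\<lambda>x. upair (FO u (ufst x)) (usnd x)) in
     \<lparr> Src = slice u b, Trg = slice (id_func (Trg u)) b,
       FO = (\<lambda>x\<in>Ob (slice u b). \<phi> x),
       FA = (\<lambda>t\<in>Ar (slice u b). utriple (\<phi> (p1 t)) (FA u (p2 t)) (\<phi> (p3 t))) \<rparr>)"

definition comma :: "'u::universe func \<Rightarrow> 'u func \<Rightarrow> 'u cat" where
  "comma u w = (let A = Src u; B' = Src w; B = Trg u in
     mk_cat {utriple a b' g | a b' g. a \<in> Ob A \<and> b' \<in> Ob B' \<and> g \<in> hom B (FO u a) (FO w b')}
       (\<lambda>x y. {upair f g' | f g'. f \<in> hom A (p1 x) (p1 y) \<and> g' \<in> hom B' (p2 x) (p2 y) \<and>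
                 Cmp B (p3 y) (FA u f) = Cmp B (FA w g') (p3 x)})
       (\<lambda>x. upair (Idn A (p1 x)) (Idn B' (p2 x)))
       (\<lambda>s t. upair (Cmp A (ufst s) (ufst t)) (Cmp B' (usnd s) (usnd t))))"


section \<open>Weak fundamental localizers\<close>

definition weakly_saturated :: "'u::universe func set \<Rightarrow> bool" where
  "weakly_saturated W \<longleftrightarrow>
     (\<forall>C. small_cat C \<longrightarrow> id_func C \<in> W) \<and>
     (\<forall>F G. is_functor F \<and> is_functor G \<and> Trg F = Src G \<longrightarrow>
        (F \<in> W \<and> G \<in> W \<longrightarrow> cmp_func G F \<in> W) \<and>
        (F \<in> W \<and> cmp_func G F \<in> W \<longrightarrow> G \<in> W) \<and>
        (G \<in> W \<and> cmp_func G F \<in> W \<longrightarrow> F \<in> W)) \<and>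
     (\<forall>i r. is_functor i \<and> is_functor r \<and> Src r = Trg i \<and> Trg r = Src i \<and>
        cmp_func r i = id_func (Src i) \<and> cmp_func i r \<in> W \<longrightarrow> r \<in> W)"

definition aspherical :: "'u::universe func set \<Rightarrow> 'u cat \<Rightarrow> bool" where
  "aspherical W C \<longleftrightarrow> small_cat C \<and> to_one C \<in> W"

definition weak_fundamental_localizer :: "'u::universe func set \<Rightarrow> bool" where
  "weak_fundamental_localizer W \<longleftrightarrow>
     (\<forall>F\<in>W. is_functor F) \<and>
     weakly_saturated W \<and>
     (\<forall>C. small_cat C \<and> has_terminal C \<longrightarrow> to_one C \<in> W) \<and>
     (\<forall>u. is_functor u \<and> (\<forall>b\<in>Ob (Trg u). slice_map u b \<in> W) \<longrightarrow> u \<in> W)"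


section \<open>Squares\<close>

(* Top is v, Bot is w, Lft is u' and Rgt is u; Cell is the 2-cell from u v to w u'. *)
record 'u square =
  Top :: "'u func"
  Bot :: "'u func"
  Lft :: "'u func"
  Rgt :: "'u func"
  Cell :: "'u \<Rightarrow> 'u"

definition is_square :: "'u::universe square \<Rightarrow> bool" where
  "is_square D \<longleftrightarrow>
     is_functor (Top D) \<and> is_functor (Bot D) \<and> is_functor (Lft D) \<and> is_functor (Rgt D) \<and>
     Src (Top D) = Src (Lft D) \<and> Trg (Top D) = Src (Rgt D) \<and>
     Trg (Lft D) = Src (Bot D) \<and> Trg (Rgt D) = Trg (Bot D) \<and>
     is_nat (cmp_func (Rgt D) (Top D)) (cmp_func (Bot D) (Lft D)) (Cell D)"

definition commutative_square :: "'u::universe square \<Rightarrow> bool" where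
  "commutative_square D \<longleftrightarrow> is_square D \<and>
     cmp_func (Rgt D) (Top D) = cmp_func (Bot D) (Lft D) \<and> Cell D = id_nat (cmp_func (Rgt D) (Top D))"

definition comma_canonical :: "'u::universe square \<Rightarrow> 'u func" where
  "comma_canonical D =
     (let A' = Src (Top D); \<phi> = (\<lambda>x. utriple (FO (Top D) x) (FO (Lft D) x) (Cell D x)) in
      \<lparr> Src = A', Trg = comma (Rgt D) (Bot D),
        FO = (\<lambda>x\<in>Ob A'. \<phi> x),
        FA = (\<lambda>f\<in>Ar A'. utriple (\<phi> (Dom A' f)) (upair (FA (Top D) f) (FA (Lft D) f)) (\<phi> (Cod A' f))) \<rparr>)"

definition comma_square :: "'u::universe square \<Rightarrow> bool" where
  "comma_square D \<longleftrightarrow> is_square D \<and> is_iso_func (comma_canonical D)"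

(* The isomorphisms p, q, p', q' are those of A, B, A', B'. *)
definition square_iso :: "'u::universe square \<Rightarrow> 'u square \<Rightarrow> bool" where
  "square_iso D E \<longleftrightarrow> (\<exists>p q p' q'.
     is_iso_func p \<and> is_iso_func q \<and> is_iso_func p' \<and> is_iso_func q' \<and>
     Src p = Src (Rgt D) \<and> Trg p = Src (Rgt E) \<and> Src q = Trg (Rgt D) \<and> Trg q = Trg (Rgt E) \<and>
     Src p' = Src (Lft D) \<and> Trg p' = Src (Lft E) \<and> Src q' = Trg (Lft D) \<and> Trg q' = Trg (Lft E) \<and>
     cmp_func p (Top D) = cmp_func (Top E) p' \<and> cmp_func q (Bot D) = cmp_func (Bot E) q' \<and>
     cmp_func q' (Lft D) = cmp_func (Lft E) p' \<and> cmp_func q (Rgt D) = cmp_func (Rgt E) p \<and>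
     (\<forall>x\<in>Ob (Src (Lft D)). FA q (Cell D x) = Cell E (FO p' x)))"

definition op_square :: "'u square \<Rightarrow> 'u square" where
  "op_square D = \<lparr> Top = op_func (Lft D), Bot = op_func (Rgt D),
     Lft = op_func (Top D), Rgt = op_func (Bot D), Cell = Cell D \<rparr>"

(* The composite of D and D', where D' is pasted to the left of D, along Rgt D' = Lft D. *)
definition hcomp :: "'u square \<Rightarrow> 'u square \<Rightarrow> 'u square" where
  "hcomp D D' = \<lparr> Top = cmp_func (Top D) (Top D'), Bot = cmp_func (Bot D) (Bot D'),
     Lft = Lft D', Rgt = Rgt D,
     Cell = (\<lambda>x\<in>Ob (Src (Lft D')).
       Cmp (Trg (Rgt D)) (FA (Bot D) (Cell D' x)) (Cell D (FO (Top D') x))) \<rparr>"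

definition slice_square :: "'u::universe func \<Rightarrow> 'u \<Rightarrow> 'u square" where
  "slice_square u b = \<lparr> Top = slice_forget u b, Bot = ob_func (Trg u) b,
     Lft = to_one (slice u b), Rgt = u, Cell = (\<lambda>x\<in>Ob (slice u b). usnd x) \<rparr>"


section \<open>Exact squares\<close>

(* The category of triples (a', f, g') attached to a, b' and g from u(a) to w(b'). *)
definition factorization_cat :: "'u::universe square \<Rightarrow> 'u \<Rightarrow> 'u \<Rightarrow> 'u \<Rightarrow> 'u cat" where
  "factorization_cat D a b' g =
     (let v = Top D; w = Bot D; u' = Lft D; u = Rgt D;
          A = Src u; B = Trg u; A' = Src u'; B' = Trg u' in
      mk_cat {utriple a' f g' | a' f g'. a' \<in> Ob A' \<and> f \<in> hom A a (FO v a') \<and>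
                g' \<in> hom B' (FO u' a') b' \<and> Cmp B (FA w g') (Cmp B (Cell D a') (FA u f)) = g}
        (\<lambda>x y. {h \<in> hom A' (p1 x) (p1 y). Cmp A (FA v h) (p2 x) = p2 y \<and>
                  Cmp B' (p3 y) (FA u' h) = p3 x})
        (\<lambda>x. Idn A' (p1 x)) (Cmp A'))"

definition exact_square :: "'u::universe func set \<Rightarrow> 'u square \<Rightarrow> bool" where
  "exact_square W D \<longleftrightarrow> is_square D \<and>
     (\<forall>a\<in>Ob (Src (Rgt D)). \<forall>b'\<in>Ob (Src (Bot D)). \<forall>g\<in>hom (Trg (Rgt D)) (FO (Rgt D) a) (FO (Bot D) b').
        aspherical W (factorization_cat D a b' g))"


section \<open>Closure properties of classes of squares\<close>

definition iso_closed :: "'u::universe square set \<Rightarrow> bool" where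
  "iso_closed Q \<longleftrightarrow> (\<forall>D\<in>Q. \<forall>E. is_square E \<and> square_iso D E \<longrightarrow> E \<in> Q)"

definition op_stable :: "'u square set \<Rightarrow> bool" where
  "op_stable Q \<longleftrightarrow> (\<forall>D\<in>Q. op_square D \<in> Q)"

definition hcomp_stable :: "'u square set \<Rightarrow> bool" where
  "hcomp_stable Q \<longleftrightarrow> (\<forall>D\<in>Q. \<forall>D'\<in>Q. Rgt D' = Lft D \<longrightarrow> hcomp D D' \<in> Q)"

definition local_descent :: "'u::universe square set \<Rightarrow> bool" where
  "local_descent Q \<longleftrightarrow> (\<forall>D. is_square D \<and>
     (\<forall>b'\<in>Ob (Trg (Lft D)). hcomp D (slice_square (Lft D) b') \<in> Q) \<longrightarrow> D \<in> Q)"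

definition exactness_class :: "'u::universe func set \<Rightarrow> 'u square set \<Rightarrow> bool" where
  "exactness_class W Q \<longleftrightarrow>
     (\<forall>D\<in>Q. is_square D) \<and> iso_closed Q \<and>
     op_stable Q \<and> hcomp_stable Q \<and> local_descent Q \<and>
     (\<forall>D. comma_square D \<longrightarrow> D \<in> Q) \<and>
     (\<forall>D C. commutative_square D \<and> aspherical W C \<and> Top D = to_one C \<and> Lft D = to_one C \<and>
        Rgt D = id_func one_cat \<and> Bot D = id_func one_cat \<longrightarrow> D \<in> Q)"

end

(* A weak fundamental localizer satisfies Quillen's Theorem A both for slices and, since the twisted
   arrow category shows that asphericity is invariant under passage to the opposite category, for
   coslices.  Exactness of a square concerns only its factorization categories: duality passes to
   the opposite of these, and local descent merely rewrites them; composites and comma squares are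
   handled by Theorem A for coslices.  Conversely, local descent, applied first to an
   exact square and then to the opposites of the resulting squares, reduces the generation statement
   to exact squares e <- A -> e over two objects of B.  Such a square is a comma square composed with a
   square which, by descent over the discrete category of arrows between the two objects, comes from
   the squares of aspherical categories. *)
theory Submission
  imports Defs
begin

section \<open>Small sets, categories and functors\<close>

text \<open>The slice axiom concerns arbitrary functors, but it is used only through its effect on
  asphericity: a functor all of whose slices are aspherical has an aspherical source exactly when
  its target is aspherical. In particular, a fully faithful functor that is surjective on objects
  has slices with terminal objects. Such functors absorb all changes of encoding, so no inverse
  functor has to be built when two presentations of a category are compared.

  Descent cuts a square only along its left side, which is why opposites must be interleaved with
  it: transposition brings the top to the left. After the two cuts \<open>A\<close> and
  \<open>B'\<close> are both \<open>e\<close>. An arrow of the comma category of two objects of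
  \<open>B\<close> is then a pair of identities, and commutation forces its source and target to
  agree. Over a discrete category slices are fibres, and the fibre over an arrow \<open>g\<close>
  is, up to direction, the factorization category at \<open>g\<close>. Exactness of such a square
  therefore says precisely that the fibres of the comparison functor are aspherical.\<close>

declare upair_inject [simp]

lemma small_singleton: "small_set {x}"
  using small_doubleton[of x x] by simp

lemma small_image: "small_set X \<Longrightarrow> small_set (f ` X)" for f :: "'u::universe \<Rightarrow> 'u"
  using small_Union[of X "\<lambda>x. {f x}", OF _ small_singleton] by (simp add: UNION_singleton_eq_range)

text \<open>The universe axioms contain no products; the bound is the union over \<open>X\<close> of
  the images of \<open>Y\<close> under \<open>upair x\<close>.\<close>

lemma small_upairs:
  assumes "small_set X" "small_set Y" "\<And>z. z \<in> Z \<Longrightarrow> \<exists>x\<in>X. \<exists>y\<in>Y. z = upair x y"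
  shows "small_set Z"
proof (rule small_subset)
  show "small_set (\<Union>x\<in>X. upair x ` Y)"
    by (intro small_Union small_image assms)
  show "Z \<subseteq> (\<Union>x\<in>X. upair x ` Y)"
    using assms(3) by blast
qed

lemma small_utriples:
  assumes "small_set X" "small_set Y" "small_set Z"
    and "\<And>t. t \<in> T \<Longrightarrow> \<exists>x\<in>X. \<exists>y\<in>Y. \<exists>z\<in>Z. t = utriple x y z"
  shows "small_set T"
proof (rule small_upairs[OF assms(1)])
  show "small_set (\<Union>y\<in>Y. upair y ` Z)"
    by (intro small_Union small_image assms)
  fix t assume "t \<in> T"
  from assms(4)[OF this] show "\<exists>x\<in>X. \<exists>y\<in>\<Union>y\<in>Y. upair y ` Z. t = upair x y"
    unfolding utriple_def by blast
qed

text \<open>The facts are phrased with \<open>Ar\<close>, \<open>Dom\<close> and \<open>Cod\<close>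
  instead of \<open>hom\<close>, and composites are bracketed to the right, so that simplification
  settles equations between composites together with their side conditions.\<close>

locale scat =
  fixes C :: "'u::universe cat"
  assumes small_cat: "small_cat C"
begin

lemma small_Ob: "small_set (Ob C)" and small_Ar: "small_set (Ar C)"
  using small_cat by (simp_all add: small_cat_def)

lemma small_hom: "small_set (hom C x y)"
  by (rule small_subset[OF small_Ar]) (auto simp: hom_def)

lemma dom_in [simp]: "f \<in> Ar C \<Longrightarrow> Dom C f \<in> Ob C"
  and cod_in [simp]: "f \<in> Ar C \<Longrightarrow> Cod C f \<in> Ob C"
  and idn_in [simp]: "x \<in> Ob C \<Longrightarrow> Idn C x \<in> Ar C"
  and dom_idn [simp]: "x \<in> Ob C \<Longrightarrow> Dom C (Idn C x) = x"
  and cod_idn [simp]: "x \<in> Ob C \<Longrightarrow> Cod C (Idn C x) = x"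
  using small_cat by (auto simp: small_cat_def hom_def)

lemma
  assumes "f \<in> Ar C" "g \<in> Ar C" "Cod C f = Dom C g"
  shows cmp_in [simp]: "Cmp C g f \<in> Ar C"
    and dom_cmp [simp]: "Dom C (Cmp C g f) = Dom C f"
    and cod_cmp [simp]: "Cod C (Cmp C g f) = Cod C g"
  using small_cat assms by (auto simp: small_cat_def hom_def)

lemma cmp_idn [simp]: "f \<in> Ar C \<Longrightarrow> Dom C f = x \<Longrightarrow> Cmp C f (Idn C x) = f"
  and idn_cmp [simp]: "f \<in> Ar C \<Longrightarrow> Cod C f = y \<Longrightarrow> Cmp C (Idn C y) f = f"
  using small_cat by (auto simp: small_cat_def)

lemma cmp_assoc [simp]:
  "f \<in> Ar C \<Longrightarrow> g \<in> Ar C \<Longrightarrow> h \<in> Ar C \<Longrightarrow> Cod C f = Dom C g \<Longrightarrow> Cod C g = Dom C h \<Longrightarrow>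
    Cmp C (Cmp C h g) f = Cmp C h (Cmp C g f)"
  using small_cat by (simp add: small_cat_def)

lemma cmp_undefined:
  "\<not> (f \<in> Ar C \<and> g \<in> Ar C \<and> Cod C f = Dom C g) \<Longrightarrow> Cmp C g f = undefined"
  using small_cat unfolding small_cat_def by blast

lemma ext_maps:
  "Dom C \<in> extensional (Ar C)" "Cod C \<in> extensional (Ar C)" "Idn C \<in> extensional (Ob C)"
  using small_cat by (auto simp: small_cat_def PiE_iff)

lemma small_cat_op: "small_cat (op_cat C)"
  using small_cat ext_maps unfolding small_cat_def op_cat_def hom_def
  by (simp add: PiE_iff) (metis cmp_undefined)

end

section \<open>Opposites, functors and the terminal category\<close>

lemma op_cat_simps [simp]:
  "Ob (op_cat C) = Ob C" "Ar (op_cat C) = Ar C" "Dom (op_cat C) = Cod C" "Cod (op_cat C) = Dom C"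
  "Idn (op_cat C) = Idn C" "Cmp (op_cat C) g f = Cmp C f g" "op_cat (op_cat C) = C"
  "hom (op_cat C) x y = hom C y x"
  by (auto simp: op_cat_def hom_def)

text \<open>Source and target are parameters tied to \<open>F\<close> by equations, so that adjacent
  functors share their common category syntactically.\<close>

locale ftor = A: scat A + B: scat B for A B :: "'u::universe cat" +
  fixes F :: "'u func"
  assumes is_functor: "is_functor F" and Src [simp]: "Src F = A" and Trg [simp]: "Trg F = B"
begin

lemma FO_in [simp]: "x \<in> Ob A \<Longrightarrow> FO F x \<in> Ob B"
  and FA_in [simp]: "f \<in> Ar A \<Longrightarrow> FA F f \<in> Ar B"
  and dom_FA [simp]: "f \<in> Ar A \<Longrightarrow> Dom B (FA F f) = FO F (Dom A f)"
  and cod_FA [simp]: "f \<in> Ar A \<Longrightarrow> Cod B (FA F f) = FO F (Cod A f)"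
  and FA_idn [simp]: "x \<in> Ob A \<Longrightarrow> FA F (Idn A x) = Idn B (FO F x)"
  and FA_cmp [simp]: "f \<in> Ar A \<Longrightarrow> g \<in> Ar A \<Longrightarrow> Cod A f = Dom A g \<Longrightarrow>
    FA F (Cmp A g f) = Cmp B (FA F g) (FA F f)"
  and ext_FO: "FO F \<in> extensional (Ob A)" and ext_FA: "FA F \<in> extensional (Ar A)"
  using is_functor by (auto simp: is_functor_def hom_def PiE_iff)

end

lemma ftorI:
  assumes "small_cat A" "small_cat B" "Src F = A" "Trg F = B"
    and "FO F \<in> extensional (Ob A)" "FA F \<in> extensional (Ar A)"
    and "\<And>x. x \<in> Ob A \<Longrightarrow> FO F x \<in> Ob B"
    and "\<And>f. f \<in> Ar A \<Longrightarrow> FA F f \<in> Ar B"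
    and "\<And>f. f \<in> Ar A \<Longrightarrow> Dom B (FA F f) = FO F (Dom A f)"
    and "\<And>f. f \<in> Ar A \<Longrightarrow> Cod B (FA F f) = FO F (Cod A f)"
    and "\<And>x. x \<in> Ob A \<Longrightarrow> FA F (Idn A x) = Idn B (FO F x)"
    and "\<And>f g. f \<in> Ar A \<Longrightarrow> g \<in> Ar A \<Longrightarrow> Cod A f = Dom A g \<Longrightarrow>
      FA F (Cmp A g f) = Cmp B (FA F g) (FA F f)"
  shows "ftor A B F"
  using assms by unfold_locales (auto simp: is_functor_def hom_def PiE_iff)

lemma ftor_iff: "ftor A B F \<longleftrightarrow> is_functor F \<and> Src F = A \<and> Trg F = B"
  by (auto simp: ftor_def ftor_axioms_def scat_def is_functor_def)

text \<open>Pointwise agreement suffices because both maps of a functor are \<open>undefined\<close>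
  off their domains.\<close>

lemma func_eqI:
  assumes "ftor A B F" "ftor A B G" "\<And>x. x \<in> Ob A \<Longrightarrow> FO F x = FO G x"
    "\<And>f. f \<in> Ar A \<Longrightarrow> FA F f = FA G f"
  shows "F = G"
proof (rule func.equality)
  interpret F: ftor A B F by fact
  interpret G: ftor A B G by fact
  show "Src F = Src G" "Trg F = Trg G" by simp_all
  show "FO F = FO G" by (rule extensionalityI[OF F.ext_FO G.ext_FO assms(3)])
  show "FA F = FA G" by (rule extensionalityI[OF F.ext_FA G.ext_FA assms(4)])
qed simp

lemma id_func_simps [simp]:
  "Src (id_func C) = C" "Trg (id_func C) = C"
  "x \<in> Ob C \<Longrightarrow> FO (id_func C) x = x" "f \<in> Ar C \<Longrightarrow> FA (id_func C) f = f"
  by (simp_all add: id_func_def)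

lemma (in scat) ftor_id: "ftor C C (id_func C)"
  by (rule ftorI[OF small_cat small_cat]) (auto simp: id_func_def)

lemma cmp_func_simps [simp]:
  "Src (cmp_func G F) = Src F" "Trg (cmp_func G F) = Trg G"
  "x \<in> Ob (Src F) \<Longrightarrow> FO (cmp_func G F) x = FO G (FO F x)"
  "f \<in> Ar (Src F) \<Longrightarrow> FA (cmp_func G F) f = FA G (FA F f)"
  by (simp_all add: cmp_func_def compose_def)

lemma ftor_cmp:
  assumes "ftor A B F" "ftor B C G"
  shows "ftor A C (cmp_func G F)"
proof -
  interpret F: ftor A B F by fact
  interpret G: ftor B C G by fact
  show ?thesis
    by (rule ftorI[OF F.A.small_cat G.B.small_cat]) (simp_all, simp_all add: cmp_func_def compose_def)
qed

lemma op_func_simps [simp]: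
  "Src (op_func F) = op_cat (Src F)" "Trg (op_func F) = op_cat (Trg F)"
  "FO (op_func F) = FO F" "FA (op_func F) = FA F" "op_func (op_func F) = F"
  by (simp_all add: op_func_def)

lemma ftor_op:
  assumes "ftor A B F"
  shows "ftor (op_cat A) (op_cat B) (op_func F)"
proof -
  interpret ftor A B F by fact
  show ?thesis
    by (rule ftorI) (simp_all add: A.small_cat_op B.small_cat_op ext_FO ext_FA)
qed

lemma one_cat_simps [simp]:
  "Ob one_cat = {pt}" "Ar one_cat = {pt}" "Dom one_cat pt = pt" "Cod one_cat pt = pt"
  "Idn one_cat pt = pt" "Cmp one_cat pt pt = pt" "hom one_cat pt pt = {pt}"
  by (auto simp: one_cat_def hom_def)

lemma small_cat_one: "small_cat one_cat"
  by (auto simp: small_cat_def one_cat_def hom_def small_singleton PiE_iff)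

interpretation one_cat: scat one_cat
  by unfold_locales (rule small_cat_one)

lemma op_one_cat [simp]: "op_cat one_cat = one_cat"
  by (auto simp: op_cat_def one_cat_def intro!: ext)

lemma to_one_simps [simp]:
  "Src (to_one C) = C" "Trg (to_one C) = one_cat"
  "x \<in> Ob C \<Longrightarrow> FO (to_one C) x = pt" "f \<in> Ar C \<Longrightarrow> FA (to_one C) f = pt"
  by (simp_all add: to_one_def)

lemma (in scat) ftor_to_one: "ftor C one_cat (to_one C)"
  by (rule ftorI[OF small_cat small_cat_one]) (simp_all, simp_all add: to_one_def)

lemma to_one_unique:
  assumes "ftor A one_cat F"
  shows "F = to_one A"
proof -
  interpret ftor A one_cat F by fact
  show ?thesis
    by (rule func_eqI[OF assms A.ftor_to_one]) (use FO_in FA_in in simp_all)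
qed

lemma (in scat) ftor_ob: "b \<in> Ob C \<Longrightarrow> ftor one_cat C (ob_func C b)"
  by (rule ftorI[OF small_cat_one small_cat]) (auto simp: ob_func_def)

lemma ob_func_simps [simp]:
  "Src (ob_func C b) = one_cat" "Trg (ob_func C b) = C"
  "FO (ob_func C b) pt = b" "FA (ob_func C b) pt = Idn C b"
  by (simp_all add: ob_func_def)

section \<open>Categories presented by their hom-sets\<close>

text \<open>\<^term>\<open>m g f\<close> is the composite of \<^term>\<open>f\<close> followed by \<^term>\<open>g\<close>. Unlike the arrows of
  \<^term>\<open>mk_cat X H i m\<close>, which carry their source and target, the elements of different \<^term>\<open>H x y\<close> may
  coincide; so a functor can be the identity on arrows although it changes the objects.\<close>

locale catdata =
  fixes X :: "'u::universe set" and H :: "'u \<Rightarrow> 'u \<Rightarrow> 'u set" and i :: "'u \<Rightarrow> 'u"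
    and m :: "'u \<Rightarrow> 'u \<Rightarrow> 'u"
  assumes small_X: "small_set X"
    and small_H: "x \<in> X \<Longrightarrow> y \<in> X \<Longrightarrow> small_set (H x y)"
    and i_in: "x \<in> X \<Longrightarrow> i x \<in> H x x"
    and m_in: "x \<in> X \<Longrightarrow> y \<in> X \<Longrightarrow> z \<in> X \<Longrightarrow> f \<in> H x y \<Longrightarrow> g \<in> H y z \<Longrightarrow> m g f \<in> H x z"
    and m_i: "x \<in> X \<Longrightarrow> y \<in> X \<Longrightarrow> f \<in> H x y \<Longrightarrow> m f (i x) = f"
    and i_m: "x \<in> X \<Longrightarrow> y \<in> X \<Longrightarrow> f \<in> H x y \<Longrightarrow> m (i y) f = f"
    and m_assoc: "x \<in> X \<Longrightarrow> y \<in> X \<Longrightarrow> z \<in> X \<Longrightarrow> t \<in> X \<Longrightarrow> f \<in> H x y \<Longrightarrow> g \<in> H y z \<Longrightarrow> h \<in> H z t \<Longrightarrow>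
      m (m h g) f = m h (m g f)"

lemma mk_cat_simps [simp]:
  "Ob (mk_cat X H i m) = X"
  "utriple x f y \<in> Ar (mk_cat X H i m) \<longleftrightarrow> x \<in> X \<and> y \<in> X \<and> f \<in> H x y"
  "x \<in> X \<Longrightarrow> y \<in> X \<Longrightarrow> f \<in> H x y \<Longrightarrow> Dom (mk_cat X H i m) (utriple x f y) = x"
  "x \<in> X \<Longrightarrow> y \<in> X \<Longrightarrow> f \<in> H x y \<Longrightarrow> Cod (mk_cat X H i m) (utriple x f y) = y"
  "x \<in> X \<Longrightarrow> Idn (mk_cat X H i m) x = utriple x (i x) x"
  "x \<in> X \<Longrightarrow> y \<in> X \<Longrightarrow> z \<in> X \<Longrightarrow> f \<in> H x y \<Longrightarrow> g \<in> H y z \<Longrightarrow>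
     Cmp (mk_cat X H i m) (utriple y g z) (utriple x f y) = utriple x (m g f) z"
  by (auto simp: mk_cat_def Let_def restrict_def)

lemma Ar_mk_catE:
  assumes "t \<in> Ar (mk_cat X H i m)"
  obtains x f y where "t = utriple x f y" "x \<in> X" "y \<in> X" "f \<in> H x y"
  using assms by (auto simp: mk_cat_def Let_def)

lemma in_hom_mk_cat:
  "t \<in> hom (mk_cat X H i m) x y \<longleftrightarrow> x \<in> X \<and> y \<in> X \<and> (\<exists>f\<in>H x y. t = utriple x f y)"
  by (auto simp: hom_def elim: Ar_mk_catE)

context catdata
begin

lemma small_cat_mk_cat: "small_cat (mk_cat X H i m)"
proof -
  let ?T = "{utriple x f y | x f y. x \<in> X \<and> y \<in> X \<and> f \<in> H x y}"
  have "small_set ?T"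
  proof (rule small_utriples[OF small_X _ small_X])
    show "small_set (\<Union>x\<in>X. \<Union>y\<in>X. H x y)"
      by (intro small_Union small_X small_H)
  qed blast
  then show ?thesis
    using small_X i_in m_in
    by (auto simp: small_cat_def mk_cat_def Let_def hom_def PiE_iff m_i i_m m_assoc)
qed

sublocale mk: scat "mk_cat X H i m"
  by unfold_locales (rule small_cat_mk_cat)

lemma opposite: "catdata X (\<lambda>x y. H y x) i (\<lambda>g f. m f g)"
  by unfold_locales (use small_X small_H i_in m_in m_i i_m in \<open>auto simp: m_assoc\<close>)

end

lemma (in scat) catdata: "catdata (Ob C) (hom C) (Idn C) (Cmp C)"
  by unfold_locales (use small_Ob small_hom in \<open>auto simp: hom_def\<close>)

section \<open>Functors in presented form, and the categories over and under an object\<close>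

locale functordata = X: catdata X H i m + Y: catdata Y K j n
  for X :: "'u::universe set" and H i m Y K j n +
  fixes \<phi> \<kappa> :: "'u \<Rightarrow> 'u"
  assumes \<phi>_in: "x \<in> X \<Longrightarrow> \<phi> x \<in> Y"
    and \<kappa>_in: "x \<in> X \<Longrightarrow> x' \<in> X \<Longrightarrow> f \<in> H x x' \<Longrightarrow> \<kappa> f \<in> K (\<phi> x) (\<phi> x')"
    and \<kappa>_i: "x \<in> X \<Longrightarrow> \<kappa> (i x) = j (\<phi> x)"
    and \<kappa>_m: "x \<in> X \<Longrightarrow> x' \<in> X \<Longrightarrow> x'' \<in> X \<Longrightarrow> f \<in> H x x' \<Longrightarrow> g \<in> H x' x'' \<Longrightarrow>
      \<kappa> (m g f) = n (\<kappa> g) (\<kappa> f)"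

text \<open>\<open>K\<close> is kept abstract so that its flip \<open>\<lambda>x y. K y x\<close>
  yields the objects under \<open>y\<close>; \<open>under_cat\<close> is built that way.\<close>

definition over_obj :: "'u::universe set \<Rightarrow> ('u \<Rightarrow> 'u \<Rightarrow> 'u set) \<Rightarrow> ('u \<Rightarrow> 'u) \<Rightarrow> 'u \<Rightarrow> 'u set" where
  "over_obj X K \<phi> y = {upair x g | x g. x \<in> X \<and> g \<in> K (\<phi> x) y}"

definition over_hom :: "('u::universe \<Rightarrow> 'u \<Rightarrow> 'u set) \<Rightarrow> ('u \<Rightarrow> 'u \<Rightarrow> 'u) \<Rightarrow> ('u \<Rightarrow> 'u) \<Rightarrow> 'u \<Rightarrow> 'u \<Rightarrow> 'u set" where
  "over_hom H n \<kappa> s t = {f \<in> H (ufst s) (ufst t). n (usnd t) (\<kappa> f) = usnd s}"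

definition under_hom :: "('u::universe \<Rightarrow> 'u \<Rightarrow> 'u set) \<Rightarrow> ('u \<Rightarrow> 'u \<Rightarrow> 'u) \<Rightarrow> ('u \<Rightarrow> 'u) \<Rightarrow> 'u \<Rightarrow> 'u \<Rightarrow> 'u set" where
  "under_hom H n \<kappa> s t = {f \<in> H (ufst s) (ufst t). n (\<kappa> f) (usnd s) = usnd t}"

abbreviation over_cat where
  "over_cat X H i m K n \<phi> \<kappa> y \<equiv> mk_cat (over_obj X K \<phi> y) (over_hom H n \<kappa>) (\<lambda>s. i (ufst s)) m"

abbreviation under_cat where
  "under_cat X H i m K n \<phi> \<kappa> y \<equiv>
    mk_cat (over_obj X (\<lambda>x y. K y x) \<phi> y) (under_hom H n \<kappa>) (\<lambda>s. i (ufst s)) m"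

text \<open>This lets slices of functors and categories over an object of presented data be treated
  by one construction.\<close>

lemma slice_eq_over_cat:
  "slice u b = over_cat (Ob (Src u)) (hom (Src u)) (Idn (Src u)) (Cmp (Src u))
     (hom (Trg u)) (Cmp (Trg u)) (FO u) (FA u) b"
  by (simp add: slice_def Let_def over_obj_def over_hom_def[abs_def])

context functordata
begin

lemma opposite: "functordata X (\<lambda>x y. H y x) i (\<lambda>g f. m f g) Y (\<lambda>x y. K y x) j (\<lambda>g f. n f g) \<phi> \<kappa>"
proof -
  interpret X': catdata X "\<lambda>x y. H y x" i "\<lambda>g f. m f g" by (rule X.opposite)
  interpret Y': catdata Y "\<lambda>x y. K y x" j "\<lambda>g f. n f g" by (rule Y.opposite)
  show ?thesis
    by unfold_locales (auto simp: \<phi>_in \<kappa>_in \<kappa>_i \<kappa>_m)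
qed

lemma catdata_over:
  assumes y: "y \<in> Y"
  shows "catdata (over_obj X K \<phi> y) (over_hom H n \<kappa>) (\<lambda>s. i (ufst s)) m"
proof
  show "small_set (over_obj X K \<phi> y)"
    by (rule small_upairs[of X "\<Union>x\<in>X. K (\<phi> x) y"])
      (auto simp: over_obj_def X.small_X Y.small_H \<phi>_in y intro!: small_Union)
  fix s t r q f g h
  assume s: "s \<in> over_obj X K \<phi> y"
  then show "i (ufst s) \<in> over_hom H n \<kappa> s s"
    using y by (auto simp: over_obj_def over_hom_def X.i_in \<kappa>_i \<phi>_in Y.m_i)
  assume t: "t \<in> over_obj X K \<phi> y"
  show "small_set (over_hom H n \<kappa> s t)"
    by (rule small_subset[of "H (ufst s) (ufst t)"])
      (use s t in \<open>auto simp: over_hom_def over_obj_def X.small_H\<close>)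
  assume f: "f \<in> over_hom H n \<kappa> s t"
  show "m f (i (ufst s)) = f" "m (i (ufst t)) f = f"
    using s t f by (auto simp: over_obj_def over_hom_def X.m_i X.i_m)
  assume r: "r \<in> over_obj X K \<phi> y" and g: "g \<in> over_hom H n \<kappa> t r"
  obtain x a x' a' x'' a'' where *: "s = upair x a" "t = upair x' a'" "r = upair x'' a''"
      "x \<in> X" "x' \<in> X" "x'' \<in> X" "a \<in> K (\<phi> x) y" "a' \<in> K (\<phi> x') y" "a'' \<in> K (\<phi> x'') y"
    using s t r by (auto simp: over_obj_def)
  have **: "f \<in> H x x'" "g \<in> H x' x''" "n a' (\<kappa> f) = a" "n a'' (\<kappa> g) = a'"
    using f g * by (auto simp: over_hom_def)
  have "n a'' (n (\<kappa> g) (\<kappa> f)) = a"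
    using Y.m_assoc[of "\<phi> x" "\<phi> x'" "\<phi> x''" y "\<kappa> f" "\<kappa> g" a''] y * ** by (auto simp: \<phi>_in \<kappa>_in)
  then show "m g f \<in> over_hom H n \<kappa> s r"
    using * ** by (auto simp: over_hom_def \<kappa>_m[of x x' x''] intro!: X.m_in[of x x' x''])
  assume q: "q \<in> over_obj X K \<phi> y" "h \<in> over_hom H n \<kappa> r q"
  then show "m (m h g) f = m h (m g f)"
    using * ** by (auto simp: over_obj_def over_hom_def X.m_assoc[of x x' x''])
qed

text \<open>Objects under \<open>y\<close> are objects over \<open>y\<close> for the reversed data;
  reversing the result restores the direction of the arrows.\<close>

lemma catdata_under:
  assumes "y \<in> Y"
  shows "catdata (over_obj X (\<lambda>x y. K y x) \<phi> y) (under_hom H n \<kappa>) (\<lambda>s. i (ufst s)) m"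
proof -
  interpret O: functordata X "\<lambda>x y. H y x" i "\<lambda>g f. m f g" Y "\<lambda>x y. K y x" j "\<lambda>g f. n f g" \<phi> \<kappa>
    by (rule opposite)
  show ?thesis
    using catdata.opposite[OF O.catdata_over[OF assms]]
    by (simp add: over_hom_def under_hom_def[abs_def])
qed

end

lemma functordata_id:
  assumes "catdata X H i m"
  shows "functordata X H i m X H i m (\<lambda>x. x) (\<lambda>f. f)"
proof -
  interpret catdata X H i m by fact
  show ?thesis by unfold_locales simp_all
qed

context ftor
begin

sublocale fd: functordata "Ob A" "hom A" "Idn A" "Cmp A" "Ob B" "hom B" "Idn B" "Cmp B" "FO F" "FA F"
proof -
  interpret A: catdata "Ob A" "hom A" "Idn A" "Cmp A" by (rule A.catdata)
  interpret B: catdata "Ob B" "hom B" "Idn B" "Cmp B" by (rule B.catdata)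
  show "functordata (Ob A) (hom A) (Idn A) (Cmp A) (Ob B) (hom B) (Idn B) (Cmp B) (FO F) (FA F)"
    by unfold_locales (auto simp: hom_def)
qed

lemma slice_eq: "slice F b = over_cat (Ob A) (hom A) (Idn A) (Cmp A) (hom B) (Cmp B) (FO F) (FA F) b"
  by (simp add: slice_eq_over_cat)

lemma scat_slice: "b \<in> Ob B \<Longrightarrow> scat (slice F b)"
  unfolding slice_eq using catdata.small_cat_mk_cat[OF fd.catdata_over] by unfold_locales simp

lemma Ob_slice: "x \<in> Ob (slice F b) \<longleftrightarrow> (\<exists>a g. x = upair a g \<and> a \<in> Ob A \<and> g \<in> hom B (FO F a) b)"
  by (simp add: slice_eq over_obj_def)

lemma slice_arrowE:
  assumes "t \<in> Ar (slice F b)"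
  obtains a g f a' g' where "t = utriple (upair a g) f (upair a' g')"
    "a \<in> Ob A" "a' \<in> Ob A" "f \<in> Ar A" "Dom A f = a" "Cod A f = a'"
    "g' \<in> Ar B" "Dom B g' = FO F a'" "Cod B g' = b" "g = Cmp B g' (FA F f)"
  using assms unfolding slice_eq
  by (elim Ar_mk_catE) (auto simp: over_obj_def over_hom_def hom_def)

end

text \<open>\<open>\<psi>\<close> receives the whole triple, because the image of an arrow may have
  to record the images of its endpoints, as it does for \<open>slice_map\<close>.\<close>

lemma (in catdata) ftor_mk_cat:
  assumes "small_cat B" "Src F = mk_cat X H i m" "Trg F = B" "FO F = restrict \<phi> X"
    "FA F = restrict \<psi> (Ar (mk_cat X H i m))"
    and "\<And>x. x \<in> X \<Longrightarrow> \<phi> x \<in> Ob B"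
    and "\<And>x y f. x \<in> X \<Longrightarrow> y \<in> X \<Longrightarrow> f \<in> H x y \<Longrightarrow> \<psi> (utriple x f y) \<in> hom B (\<phi> x) (\<phi> y)"
    and "\<And>x. x \<in> X \<Longrightarrow> \<psi> (utriple x (i x) x) = Idn B (\<phi> x)"
    and "\<And>x y z f g. x \<in> X \<Longrightarrow> y \<in> X \<Longrightarrow> z \<in> X \<Longrightarrow> f \<in> H x y \<Longrightarrow> g \<in> H y z \<Longrightarrow>
      \<psi> (utriple x (m g f) z) = Cmp B (\<psi> (utriple y g z)) (\<psi> (utriple x f y))"
  shows "ftor (mk_cat X H i m) B F"
proof (rule ftorI[OF small_cat_mk_cat assms(1-3)])
  fix f assume "f \<in> Ar (mk_cat X H i m)"
  then show "FA F f \<in> Ar B" "Dom B (FA F f) = FO F (Dom (mk_cat X H i m) f)"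
      "Cod B (FA F f) = FO F (Cod (mk_cat X H i m) f)"
    using assms(4,5,7) by (auto elim!: Ar_mk_catE simp: hom_def)
next
  fix x assume "x \<in> Ob (mk_cat X H i m)"
  then show "FA F (Idn (mk_cat X H i m) x) = Idn B (FO F x)"
    using assms(4,5,8) i_in by simp
next
  fix f g assume *: "f \<in> Ar (mk_cat X H i m)" "g \<in> Ar (mk_cat X H i m)"
    "Cod (mk_cat X H i m) f = Dom (mk_cat X H i m) g"
  obtain x f' y where f: "f = utriple x f' y" "x \<in> X" "y \<in> X" "f' \<in> H x y"
    using *(1) by (rule Ar_mk_catE)
  obtain y' g' z where g: "g = utriple y' g' z" "y' \<in> X" "z \<in> X" "g' \<in> H y' z"
    using *(2) by (rule Ar_mk_catE)
  have "y' = y" using * f g by simp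
  then show "FA F (Cmp (mk_cat X H i m) g f) = Cmp B (FA F g) (FA F f)"
    using assms(5) assms(9)[of x y z f' g'] f g m_in by simp
qed (use assms(4-6) in simp_all)

lemma (in ftor) catdata_slice:
  "b \<in> Ob B \<Longrightarrow> catdata (over_obj (Ob A) (hom B) (FO F) b) (over_hom (hom A) (Cmp B) (FA F))
     (\<lambda>s. Idn A (ufst s)) (Cmp A)"
  by (rule fd.catdata_over)

lemma (in ftor) ftor_slice_forget:
  assumes b: "b \<in> Ob B"
  shows "ftor (slice F b) A (slice_forget F b)"
  unfolding slice_eq
proof (rule catdata.ftor_mk_cat[OF catdata_slice[OF b] A.small_cat, where \<phi> = ufst and \<psi> = p2])
qed (simp_all add: slice_forget_def slice_eq, auto simp: over_obj_def over_hom_def)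

lemma (in ftor) ftor_slice_map:
  assumes b: "b \<in> Ob B"
  shows "ftor (slice F b) (slice (id_func B) b) (slice_map F b)"
proof -
  interpret I: ftor B B "id_func B" by (rule B.ftor_id)
  interpret T: scat "slice (id_func B) b" using b by (rule I.scat_slice)
  show ?thesis
    unfolding slice_eq
  proof (rule catdata.ftor_mk_cat[OF catdata_slice[OF b] T.small_cat,
          where \<phi> = "\<lambda>x. upair (FO F (ufst x)) (usnd x)" and \<psi> = "\<lambda>t. utriple
            (upair (FO F (ufst (p1 t))) (usnd (p1 t))) (FA F (p2 t)) (upair (FO F (ufst (p3 t))) (usnd (p3 t)))"])
    let ?X = "over_obj (Ob A) (hom B) (FO F) b" and ?H = "over_hom (hom A) (Cmp B) (FA F)"
      and ?Y = "over_obj (Ob B) (hom B) (FO (id_func B)) b" and ?K = "over_hom (hom B) (Cmp B) (FA (id_func B))"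
    let ?\<phi> = "\<lambda>x. upair (FO F (ufst x)) (usnd x)"
    have \<phi>: "?\<phi> x \<in> ?Y" if "x \<in> ?X" for x
      using that by (auto simp: over_obj_def hom_def)
    have \<kappa>: "FA F f \<in> ?K (?\<phi> x) (?\<phi> y)" if "f \<in> ?H x y" for x y f
      using that by (auto simp: over_hom_def hom_def)
    show "Src (slice_map F b) = over_cat (Ob A) (hom A) (Idn A) (Cmp A) (hom B) (Cmp B) (FO F) (FA F) b"
      "Trg (slice_map F b) = slice (id_func B) b" "FO (slice_map F b) = restrict ?\<phi> ?X"
      "FA (slice_map F b) = (\<lambda>t\<in>Ar (over_cat (Ob A) (hom A) (Idn A) (Cmp A) (hom B) (Cmp B) (FO F) (FA F) b).
         utriple (?\<phi> (p1 t)) (FA F (p2 t)) (?\<phi> (p3 t)))"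
      by (simp_all add: slice_map_def Let_def slice_eq)
    show "?\<phi> x \<in> Ob (slice (id_func B) b)" if "x \<in> ?X" for x
      using \<phi>[OF that] by (simp add: I.slice_eq)
    show "utriple (?\<phi> (p1 (utriple x f y))) (FA F (p2 (utriple x f y))) (?\<phi> (p3 (utriple x f y)))
        \<in> hom (slice (id_func B) b) (?\<phi> x) (?\<phi> y)" if "x \<in> ?X" "y \<in> ?X" "f \<in> ?H x y" for x y f
      using that(1,2)[THEN \<phi>] that(3)[THEN \<kappa>] by (simp add: I.slice_eq in_hom_mk_cat)
    fix x assume x: "x \<in> ?X"
    then show "utriple (?\<phi> (p1 (utriple x (Idn A (ufst x)) x))) (FA F (p2 (utriple x (Idn A (ufst x)) x)))
       (?\<phi> (p3 (utriple x (Idn A (ufst x)) x))) = Idn (slice (id_func B) b) (?\<phi> x)"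
      using \<phi>[OF x] by (auto simp: I.slice_eq over_obj_def)
    fix y z f g assume *: "y \<in> ?X" "z \<in> ?X" "f \<in> ?H x y" "g \<in> ?H y z"
    have "FA F (Cmp A g f) = Cmp B (FA F g) (FA F f)"
      using *(3,4) by (simp add: over_hom_def hom_def)
    then show "utriple (?\<phi> (p1 (utriple x (Cmp A g f) z))) (FA F (p2 (utriple x (Cmp A g f) z)))
        (?\<phi> (p3 (utriple x (Cmp A g f) z))) = Cmp (slice (id_func B) b)
         (utriple (?\<phi> (p1 (utriple y g z))) (FA F (p2 (utriple y g z))) (?\<phi> (p3 (utriple y g z))))
         (utriple (?\<phi> (p1 (utriple x f y))) (FA F (p2 (utriple x f y))) (?\<phi> (p3 (utriple x f y))))"
      using \<phi>[OF x] *(1,2)[THEN \<phi>] *(3,4)[THEN \<kappa>] by (simp add: I.slice_eq)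
  qed
qed

section \<open>Aspherical categories\<close>

lemma comp_to_one:
  assumes "ftor A B F"
  shows "cmp_func (to_one B) F = to_one A"
proof -
  interpret ftor A B F by fact
  show ?thesis
    using to_one_unique[OF ftor_cmp[OF assms B.ftor_to_one]] by simp
qed

lemma (in catdata) has_terminal_mk_cat:
  assumes "t \<in> X" "\<And>x. x \<in> X \<Longrightarrow> \<exists>!f. f \<in> H x t"
  shows "has_terminal (mk_cat X H i m)"
  unfolding has_terminal_def
proof (intro bexI[of _ t] ballI)
  fix x assume "x \<in> Ob (mk_cat X H i m)"
  then have x: "x \<in> X" by simp
  then obtain f where f: "f \<in> H x t" "\<And>f'. f' \<in> H x t \<Longrightarrow> f' = f" using assms(2)[OF x] by blast
  show "\<exists>!f. f \<in> hom (mk_cat X H i m) x t"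
    by (rule ex1I[of _ "utriple x f t"]) (use f(1) x assms(1) in \<open>auto simp: in_hom_mk_cat intro: f(2)\<close>)
qed (use assms(1) in simp)

section \<open>Theorem A for slices\<close>

locale localizer =
  fixes W :: "'u::universe func set"
  assumes wfl: "weak_fundamental_localizer W"
begin

lemma two_of_three:
  assumes "ftor A B F" "ftor B C G"
  shows "F \<in> W \<Longrightarrow> G \<in> W \<Longrightarrow> cmp_func G F \<in> W"
    and "F \<in> W \<Longrightarrow> cmp_func G F \<in> W \<Longrightarrow> G \<in> W"
    and "G \<in> W \<Longrightarrow> cmp_func G F \<in> W \<Longrightarrow> F \<in> W"
proof -
  have "(F \<in> W \<and> G \<in> W \<longrightarrow> cmp_func G F \<in> W) \<and> (F \<in> W \<and> cmp_func G F \<in> W \<longrightarrow> G \<in> W) \<and>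
      (G \<in> W \<and> cmp_func G F \<in> W \<longrightarrow> F \<in> W)"
  proof -
    have "\<forall>F G. is_functor F \<and> is_functor G \<and> Trg F = Src G \<longrightarrow>
        (F \<in> W \<and> G \<in> W \<longrightarrow> cmp_func G F \<in> W) \<and>
        (F \<in> W \<and> cmp_func G F \<in> W \<longrightarrow> G \<in> W) \<and>
        (G \<in> W \<and> cmp_func G F \<in> W \<longrightarrow> F \<in> W)"
      using wfl unfolding weak_fundamental_localizer_def weakly_saturated_def by (elim conjE) assumption
    moreover have "is_functor F \<and> is_functor G \<and> Trg F = Src G"
      using assms by (simp add: ftor_iff)
    ultimately show ?thesis
      by (rule mp[OF spec[of _ G, OF spec[of _ F]]])
  qed
  then show "F \<in> W \<Longrightarrow> G \<in> W \<Longrightarrow> cmp_func G F \<in> W"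
    "F \<in> W \<Longrightarrow> cmp_func G F \<in> W \<Longrightarrow> G \<in> W" "G \<in> W \<Longrightarrow> cmp_func G F \<in> W \<Longrightarrow> F \<in> W"
    by blast+
qed

lemma aspherical_terminal: "small_cat C \<Longrightarrow> has_terminal C \<Longrightarrow> aspherical W C"
  using wfl[unfolded weak_fundamental_localizer_def, THEN conjunct2, THEN conjunct2, THEN conjunct1]
  by (simp add: aspherical_def)

lemma in_W_of_slices: "is_functor u \<Longrightarrow> (\<And>b. b \<in> Ob (Trg u) \<Longrightarrow> slice_map u b \<in> W) \<Longrightarrow> u \<in> W"
  using wfl[unfolded weak_fundamental_localizer_def, THEN conjunct2, THEN conjunct2, THEN conjunct2]
  by blast

lemma aspherical_mk_terminal:
  assumes "catdata X H i m" "t \<in> X" "\<And>x. x \<in> X \<Longrightarrow> \<exists>!f. f \<in> H x t"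
  shows "aspherical W (mk_cat X H i m)"
  using assms by (intro aspherical_terminal catdata.has_terminal_mk_cat catdata.small_cat_mk_cat)

text \<open>The slice of \<open>B\<close> over \<open>b\<close> has the terminal object
  \<open>(b, 1)\<close>. Two out of three over \<open>e\<close> then turns asphericity of the slice
  of \<open>F\<close> into membership of \<open>slice_map F b\<close> in \<open>W\<close>. The slice
  axiom gives \<open>F\<close> in \<open>W\<close>, and two out of three over \<open>e\<close> once
  more compares \<open>A\<close> with \<open>B\<close>.\<close>

lemma aspherical_iff_of_slices:
  assumes F: "ftor A B F" and asph: "\<And>b. b \<in> Ob B \<Longrightarrow> aspherical W (slice F b)"
  shows "aspherical W A \<longleftrightarrow> aspherical W B"
proof -
  interpret ftor A B F by fact
  interpret I: ftor B B "id_func B" by (rule B.ftor_id)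
  have "slice_map F b \<in> W" if b: "b \<in> Ob B" for b
  proof -
    interpret T: scat "slice (id_func B) b" using b by (rule I.scat_slice)
    have "aspherical W (slice (id_func B) b)"
      unfolding I.slice_eq
    proof (rule aspherical_mk_terminal[OF I.catdata_slice[OF b]])
      show "upair b (Idn B b) \<in> over_obj (Ob B) (hom B) (FO (id_func B)) b"
        using b by (auto simp: over_obj_def hom_def)
    qed (auto simp: over_obj_def over_hom_def hom_def)
    moreover have "to_one (slice F b) \<in> W"
      using asph[OF b] unfolding aspherical_def by (rule conjunct2)
    ultimately show ?thesis
      using two_of_three(3)[OF ftor_slice_map[OF b] T.ftor_to_one] comp_to_one[OF ftor_slice_map[OF b]]
      by (simp add: aspherical_def)
  qed
  then have "F \<in> W"
    using in_W_of_slices is_functor Trg by blast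
  from two_of_three(1,2)[OF F B.ftor_to_one this] have "to_one A \<in> W \<longleftrightarrow> to_one B \<in> W"
    unfolding comp_to_one[OF F] by blast
  then show ?thesis
    by (simp add: aspherical_def A.small_cat B.small_cat)
qed

text \<open>If \<open>a\<close> is sent to \<open>b\<close>, then \<open>(a, 1)\<close> is terminal
  in the slice over \<open>b\<close>: an arrow to it from \<open>(a', g)\<close> is a lift of
  \<open>g\<close> along \<open>F\<close>, which exists uniquely.\<close>

lemma aspherical_iff_of_surj_ff:
  assumes F: "ftor A B F"
    and surj: "\<And>b. b \<in> Ob B \<Longrightarrow> \<exists>a\<in>Ob A. FO F a = b"
    and ff: "\<And>a a' g. a \<in> Ob A \<Longrightarrow> a' \<in> Ob A \<Longrightarrow> g \<in> hom B (FO F a) (FO F a') \<Longrightarrow>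
      \<exists>!f. f \<in> hom A a a' \<and> FA F f = g"
  shows "aspherical W A \<longleftrightarrow> aspherical W B"
proof (rule aspherical_iff_of_slices[OF F])
  interpret ftor A B F by fact
  fix b assume b: "b \<in> Ob B"
  then obtain a where a: "a \<in> Ob A" "FO F a = b" using surj by blast
  show "aspherical W (slice F b)"
    unfolding slice_eq
  proof (rule aspherical_mk_terminal[OF catdata_slice[OF b]])
    show "upair a (Idn B b) \<in> over_obj (Ob A) (hom B) (FO F) b"
      using a b by (auto simp: over_obj_def hom_def)
    fix x assume "x \<in> over_obj (Ob A) (hom B) (FO F) b"
    then obtain a' g where x: "x = upair a' g" "a' \<in> Ob A" "g \<in> hom B (FO F a') b"
      by (auto simp: over_obj_def)
    have "f \<in> over_hom (hom A) (Cmp B) (FA F) x (upair a (Idn B b)) \<longleftrightarrow> f \<in> hom A a' a \<and> FA F f = g" for f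
      using a b x by (auto simp: over_hom_def hom_def)
    then show "\<exists>!f. f \<in> over_hom (hom A) (Cmp B) (FA F) x (upair a (Idn B b))"
      by simp (rule ff, use x a in simp_all)
  qed
qed

end

section \<open>Theorem A for presented categories\<close>

definition mk_func where
  "mk_func C D \<phi> \<kappa> = \<lparr> Src = C, Trg = D, FO = (\<lambda>x\<in>Ob C. \<phi> x),
     FA = (\<lambda>t\<in>Ar C. utriple (\<phi> (p1 t)) (\<kappa> (p2 t)) (\<phi> (p3 t))) \<rparr>"

lemma (in functordata) ftor_mk_func:
  "ftor (mk_cat X H i m) (mk_cat Y K j n) (mk_func (mk_cat X H i m) (mk_cat Y K j n) \<phi> \<kappa>)"
proof (rule X.ftor_mk_cat[OF Y.small_cat_mk_cat, where \<phi> = \<phi> and \<psi> = "\<lambda>t. utriple (\<phi> (p1 t)) (\<kappa> (p2 t)) (\<phi> (p3 t))"])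
  fix x y z f g assume "x \<in> X" "y \<in> X" "z \<in> X" "f \<in> H x y" "g \<in> H y z"
  then show "utriple (\<phi> (p1 (utriple x (m g f) z))) (\<kappa> (p2 (utriple x (m g f) z))) (\<phi> (p3 (utriple x (m g f) z))) =
      Cmp (mk_cat Y K j n) (utriple (\<phi> (p1 (utriple y g z))) (\<kappa> (p2 (utriple y g z))) (\<phi> (p3 (utriple y g z))))
       (utriple (\<phi> (p1 (utriple x f y))) (\<kappa> (p2 (utriple x f y))) (\<phi> (p3 (utriple x f y))))"
    by (simp add: \<phi>_in \<kappa>_in \<kappa>_m[of x y z])
qed (simp_all add: mk_func_def in_hom_mk_cat \<phi>_in \<kappa>_in \<kappa>_i)

lemma mk_func_simps [simp]:
  "x \<in> X \<Longrightarrow> FO (mk_func (mk_cat X H i m) D \<phi> \<kappa>) x = \<phi> x"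
  "x \<in> X \<Longrightarrow> y \<in> X \<Longrightarrow> f \<in> H x y \<Longrightarrow>
    FA (mk_func (mk_cat X H i m) D \<phi> \<kappa>) (utriple x f y) = utriple (\<phi> x) (\<kappa> f) (\<phi> y)"
  by (simp_all add: mk_func_def)

context localizer
begin

lemma aspherical_mk_iff_of_surj_ff:
  assumes "functordata X H i m Y K j n \<phi> \<kappa>"
    and surj: "\<And>y. y \<in> Y \<Longrightarrow> \<exists>x\<in>X. \<phi> x = y"
    and ff: "\<And>x x' g. x \<in> X \<Longrightarrow> x' \<in> X \<Longrightarrow> g \<in> K (\<phi> x) (\<phi> x') \<Longrightarrow> \<exists>!f. f \<in> H x x' \<and> \<kappa> f = g"
  shows "aspherical W (mk_cat X H i m) \<longleftrightarrow> aspherical W (mk_cat Y K j n)"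
proof -
  interpret functordata X H i m Y K j n \<phi> \<kappa> by fact
  show ?thesis
  proof (rule aspherical_iff_of_surj_ff[OF ftor_mk_func])
    let ?F = "mk_func (mk_cat X H i m) (mk_cat Y K j n) \<phi> \<kappa>"
    show "\<exists>a\<in>Ob (mk_cat X H i m). FO ?F a = b" if "b \<in> Ob (mk_cat Y K j n)" for b
      using surj that by fastforce
    fix a a' g
    assume *: "a \<in> Ob (mk_cat X H i m)" "a' \<in> Ob (mk_cat X H i m)" "g \<in> hom (mk_cat Y K j n) (FO ?F a) (FO ?F a')"
    then obtain g' where g: "g = utriple (\<phi> a) g' (\<phi> a')" "g' \<in> K (\<phi> a) (\<phi> a')"
      by (auto simp: in_hom_mk_cat)
    from *(1,2) have a: "a \<in> X" "a' \<in> X" by simp_all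
    obtain f where f: "f \<in> H a a'" "\<kappa> f = g'" "\<And>f'. f' \<in> H a a' \<Longrightarrow> \<kappa> f' = g' \<Longrightarrow> f' = f"
      using ff[OF a g(2)] by blast
    show "\<exists>!f. f \<in> hom (mk_cat X H i m) a a' \<and> FA ?F f = g"
    proof (rule ex1I[of _ "utriple a f a'"])
      show "utriple a f a' \<in> hom (mk_cat X H i m) a a' \<and> FA ?F (utriple a f a') = g"
        using * g f(1,2) by (simp add: in_hom_mk_cat)
      show "t = utriple a f a'" if "t \<in> hom (mk_cat X H i m) a a' \<and> FA ?F t = g" for t
        using that * g by (auto simp: in_hom_mk_cat intro!: f(3))
    qed
  qed
qed

text \<open>In the slices of \<open>mk_func\<close> the arrows, and the second components of the
  objects, are triples carrying endpoints. Stripping these endpoints is surjective on objects and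
  fully faithful onto \<open>over_cat\<close>, so later applications can work with bare
  hom-sets.\<close>

lemma aspherical_mk_iff_of_over:
  assumes "functordata X H i m Y K j n \<phi> \<kappa>"
    and asph: "\<And>y. y \<in> Y \<Longrightarrow> aspherical W (over_cat X H i m K n \<phi> \<kappa> y)"
  shows "aspherical W (mk_cat X H i m) \<longleftrightarrow> aspherical W (mk_cat Y K j n)"
proof -
  interpret functordata X H i m Y K j n \<phi> \<kappa> by fact
  let ?F = "mk_func (mk_cat X H i m) (mk_cat Y K j n) \<phi> \<kappa>"
  interpret F: ftor "mk_cat X H i m" "mk_cat Y K j n" ?F by (rule ftor_mk_func)
  show ?thesis
  proof (rule aspherical_iff_of_slices[OF ftor_mk_func])
    fix y assume y: "y \<in> Ob (mk_cat Y K j n)"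
    then have yY: "y \<in> Y" by simp
    interpret S: catdata "over_obj (Ob (mk_cat X H i m)) (hom (mk_cat Y K j n)) (FO ?F) y"
      "over_hom (hom (mk_cat X H i m)) (Cmp (mk_cat Y K j n)) (FA ?F)"
      "\<lambda>s. Idn (mk_cat X H i m) (ufst s)" "Cmp (mk_cat X H i m)"
      using y by (rule F.catdata_slice)
    interpret O: catdata "over_obj X K \<phi> y" "over_hom H n \<kappa>" "\<lambda>s. i (ufst s)" m
      using yY by (rule catdata_over)
    have "aspherical W (slice ?F y) \<longleftrightarrow> aspherical W (over_cat X H i m K n \<phi> \<kappa> y)"
      unfolding F.slice_eq
    proof (rule aspherical_mk_iff_of_surj_ff[where \<phi> = "\<lambda>s. upair (ufst s) (p2 (usnd s))" and \<kappa> = p2])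
      show "functordata (over_obj (Ob (mk_cat X H i m)) (hom (mk_cat Y K j n)) (FO ?F) y)
         (over_hom (hom (mk_cat X H i m)) (Cmp (mk_cat Y K j n)) (FA ?F))
         (\<lambda>s. Idn (mk_cat X H i m) (ufst s)) (Cmp (mk_cat X H i m))
         (over_obj X K \<phi> y) (over_hom H n \<kappa>) (\<lambda>s. i (ufst s)) m (\<lambda>s. upair (ufst s) (p2 (usnd s))) p2"
        by unfold_locales
          (auto simp: over_obj_def over_hom_def in_hom_mk_cat \<phi>_in \<kappa>_in)
    next
      fix x assume "x \<in> over_obj X K \<phi> y"
      then obtain a g where x: "x = upair a g" "a \<in> X" "g \<in> K (\<phi> a) y" by (auto simp: over_obj_def)
      then show "\<exists>s\<in>over_obj (Ob (mk_cat X H i m)) (hom (mk_cat Y K j n)) (FO ?F) y. upair (ufst s) (p2 (usnd s)) = x"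
        using yY by (intro bexI[of _ "upair a (utriple (\<phi> a) g y)"])
          (auto simp: over_obj_def in_hom_mk_cat \<phi>_in)
    next
      fix s s' f assume "s \<in> over_obj (Ob (mk_cat X H i m)) (hom (mk_cat Y K j n)) (FO ?F) y"
        "s' \<in> over_obj (Ob (mk_cat X H i m)) (hom (mk_cat Y K j n)) (FO ?F) y"
        and f: "f \<in> over_hom H n \<kappa> (upair (ufst s) (p2 (usnd s))) (upair (ufst s') (p2 (usnd s')))"
      then obtain a a' g g' where s: "s = upair a (utriple (\<phi> a) g y)" "s' = upair a' (utriple (\<phi> a') g' y)"
        "a \<in> X" "a' \<in> X" "g \<in> K (\<phi> a) y" "g' \<in> K (\<phi> a') y"
        by (auto simp: over_obj_def in_hom_mk_cat)
      show "\<exists>!t. t \<in> over_hom (hom (mk_cat X H i m)) (Cmp (mk_cat Y K j n)) (FA ?F) s s' \<and> p2 t = f"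
      proof (rule ex1I[of _ "utriple a f a'"])
        show "utriple a f a' \<in> over_hom (hom (mk_cat X H i m)) (Cmp (mk_cat Y K j n)) (FA ?F) s s' \<and>
            p2 (utriple a f a') = f"
          using s f yY by (auto simp: over_hom_def in_hom_mk_cat \<phi>_in \<kappa>_in)
        show "t = utriple a f a'" if "t \<in> over_hom (hom (mk_cat X H i m)) (Cmp (mk_cat Y K j n)) (FA ?F) s s' \<and> p2 t = f" for t
          using that s by (auto simp: over_hom_def in_hom_mk_cat)
      qed
    qed
    then show "aspherical W (slice ?F y)" using asph[OF yY] by simp
  qed
qed

lemma aspherical_one: "aspherical W one_cat"
  by (rule aspherical_terminal[OF small_cat_one]) (auto simp: has_terminal_def)

text \<open>Theorem A for the functor from \<open>e\<close> that picks out \<open>t\<close>: its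
  slice over \<open>b\<close> has a single object, since \<open>t\<close> has a single arrow to
  \<open>b\<close>. No passage to opposites is involved, so the result is available for proving
  invariance under them.\<close>

lemma aspherical_initial:
  assumes C: "small_cat C" and t: "t \<in> Ob C" "\<And>x. x \<in> Ob C \<Longrightarrow> \<exists>!f. f \<in> hom C t x"
  shows "aspherical W C"
proof -
  interpret scat C using C by unfold_locales
  interpret F: ftor one_cat C "ob_func C t" using t(1) by (rule ftor_ob)
  have "aspherical W (slice (ob_func C t) b)" if b: "b \<in> Ob C" for b
  proof -
    obtain f where f: "f \<in> hom C t b" "\<And>f'. f' \<in> hom C t b \<Longrightarrow> f' = f" using t(2)[OF b] by blast
    show ?thesis
      unfolding F.slice_eq
    proof (rule aspherical_mk_terminal[OF F.catdata_slice[OF b]])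
      show "upair pt f \<in> over_obj (Ob one_cat) (hom C) (FO (ob_func C t)) b"
        using f(1) by (auto simp: over_obj_def)
      fix x assume "x \<in> over_obj (Ob one_cat) (hom C) (FO (ob_func C t)) b"
      then have "x = upair pt f" by (auto simp: over_obj_def intro: f(2))
      then show "\<exists>!g. g \<in> over_hom (hom one_cat) (Cmp C) (FA (ob_func C t)) x (upair pt f)"
        using f(1) t(1) by (auto simp: over_hom_def hom_def)
    qed
  qed
  then show ?thesis
    using aspherical_iff_of_slices[OF ftor_ob[OF t(1)]] aspherical_one by simp
qed

lemma aspherical_mk_initial:
  assumes "catdata X H i m" "t \<in> X" "\<And>x. x \<in> X \<Longrightarrow> \<exists>!f. f \<in> H t x"
  shows "aspherical W (mk_cat X H i m)"
proof (rule aspherical_initial[OF catdata.small_cat_mk_cat[OF assms(1)], of t])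
  fix x assume "x \<in> Ob (mk_cat X H i m)"
  then have x: "x \<in> X" by simp
  then obtain f where f: "f \<in> H t x" "\<And>f'. f' \<in> H t x \<Longrightarrow> f' = f" using assms(3)[OF x] by blast
  show "\<exists>!f. f \<in> hom (mk_cat X H i m) t x"
    by (rule ex1I[of _ "utriple t f x"]) (use f(1) x assms(2) in \<open>auto simp: in_hom_mk_cat intro: f(2)\<close>)
qed (use assms(2) in simp)

end

section \<open>Opposite categories\<close>

definition tw_obj :: "'u::universe cat \<Rightarrow> 'u set" where
  "tw_obj C = {utriple a f b | a f b. a \<in> Ob C \<and> b \<in> Ob C \<and> f \<in> hom C a b}"

text \<open>Sources vary contravariantly and targets covariantly: an arrow from \<open>f\<close> to
  \<open>f'\<close> writes \<open>f'\<close> as \<open>q f p\<close>. Hence \<open>p3\<close> is a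
  functor to \<open>C\<close>, and exchanging the two ends is a functor to the twisted arrow
  category of the opposite.\<close>

definition tw_hom :: "'u::universe cat \<Rightarrow> 'u \<Rightarrow> 'u \<Rightarrow> 'u set" where
  "tw_hom C s t = {upair p q | p q. p \<in> hom C (p1 t) (p1 s) \<and> q \<in> hom C (p3 s) (p3 t) \<and>
     Cmp C q (Cmp C (p2 s) p) = p2 t}"

definition tw_idn :: "'u::universe cat \<Rightarrow> 'u \<Rightarrow> 'u" where
  "tw_idn C s = upair (Idn C (p1 s)) (Idn C (p3 s))"

definition tw_cmp :: "'u::universe cat \<Rightarrow> 'u \<Rightarrow> 'u \<Rightarrow> 'u" where
  "tw_cmp C v u = upair (Cmp C (ufst u) (ufst v)) (Cmp C (usnd v) (usnd u))"

abbreviation twisted :: "'u::universe cat \<Rightarrow> 'u cat" where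
  "twisted C \<equiv> mk_cat (tw_obj C) (tw_hom C) (tw_idn C) (tw_cmp C)"

lemma tw_homE:
  assumes "u \<in> tw_hom C s t"
  obtains p q where "u = upair p q" "p \<in> hom C (p1 t) (p1 s)" "q \<in> hom C (p3 s) (p3 t)"
    "Cmp C q (Cmp C (p2 s) p) = p2 t"
  using assms by (auto simp: tw_hom_def)

lemma tw_objE:
  assumes "s \<in> tw_obj C"
  obtains a f b where "s = utriple a f b" "a \<in> Ob C" "b \<in> Ob C" "f \<in> Ar C" "Dom C f = a" "Cod C f = b"
  using assms by (auto simp: tw_obj_def hom_def)

context scat
begin

lemma catdata_tw: "catdata (tw_obj C) (tw_hom C) (tw_idn C) (tw_cmp C)"
proof
  show "small_set (tw_obj C)"
    by (rule small_utriples[OF small_Ob small_Ar small_Ob]) (auto simp: tw_obj_def hom_def)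
  fix s t r z u v w
  show "small_set (tw_hom C s t)"
    by (rule small_upairs[OF small_Ar small_Ar]) (auto simp: tw_hom_def hom_def)
  assume s: "s \<in> tw_obj C"
  then show "tw_idn C s \<in> tw_hom C s s"
    by (elim tw_objE) (simp add: tw_hom_def tw_idn_def hom_def)
  assume t: "t \<in> tw_obj C" and u: "u \<in> tw_hom C s t"
  show "tw_cmp C u (tw_idn C s) = u" "tw_cmp C (tw_idn C t) u = u"
    using s t u by (elim tw_objE tw_homE, simp add: tw_cmp_def tw_idn_def hom_def)+
  assume r: "r \<in> tw_obj C" and v: "v \<in> tw_hom C t r"
  obtain p q where u': "u = upair p q" "p \<in> Ar C" "Dom C p = p1 t" "Cod C p = p1 s"
      "q \<in> Ar C" "Dom C q = p3 s" "Cod C q = p3 t" "p2 t = Cmp C q (Cmp C (p2 s) p)"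
    using u by (auto simp: tw_hom_def hom_def)
  obtain p' q' where v': "v = upair p' q'" "p' \<in> Ar C" "Dom C p' = p1 r" "Cod C p' = p1 t"
      "q' \<in> Ar C" "Dom C q' = p3 t" "Cod C q' = p3 r" "p2 r = Cmp C q' (Cmp C (p2 t) p')"
    using v by (auto simp: tw_hom_def hom_def)
  show "tw_cmp C v u \<in> tw_hom C s r"
    using s u' v' by (elim tw_objE) (simp add: tw_cmp_def tw_hom_def hom_def)
  assume "z \<in> tw_obj C" "w \<in> tw_hom C r z"
  then show "tw_cmp C (tw_cmp C w v) u = tw_cmp C w (tw_cmp C v u)"
    using u' v' by (auto simp: tw_cmp_def tw_hom_def hom_def)
qed

lemma functordata_tw_target:
  "functordata (tw_obj C) (tw_hom C) (tw_idn C) (tw_cmp C) (Ob C) (hom C) (Idn C) (Cmp C) p3 usnd"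
proof -
  interpret T: catdata "tw_obj C" "tw_hom C" "tw_idn C" "tw_cmp C" by (rule catdata_tw)
  interpret D: catdata "Ob C" "hom C" "Idn C" "Cmp C" by (rule catdata)
  show ?thesis
    by unfold_locales (auto simp: tw_obj_def tw_hom_def tw_idn_def tw_cmp_def)
qed

text \<open>Read in \<open>op_cat C\<close>, the equation \<open>f' = q f p\<close> is the same
  equation with \<open>p\<close> and \<open>q\<close> exchanged, so arrows keep their
  direction.\<close>

lemma functordata_tw_swap:
  "functordata (tw_obj C) (tw_hom C) (tw_idn C) (tw_cmp C)
     (tw_obj (op_cat C)) (tw_hom (op_cat C)) (tw_idn (op_cat C)) (tw_cmp (op_cat C))
     (\<lambda>s. utriple (p3 s) (p2 s) (p1 s)) (\<lambda>u. upair (usnd u) (ufst u))"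
proof -
  interpret T: catdata "tw_obj C" "tw_hom C" "tw_idn C" "tw_cmp C" by (rule catdata_tw)
  interpret op: scat "op_cat C" by unfold_locales (rule small_cat_op)
  interpret D: catdata "tw_obj (op_cat C)" "tw_hom (op_cat C)" "tw_idn (op_cat C)" "tw_cmp (op_cat C)"
    by (rule op.catdata_tw)
  show ?thesis
  proof
    fix s t u assume "s \<in> tw_obj C" "t \<in> tw_obj C" "u \<in> tw_hom C s t"
    then show "upair (usnd u) (ufst u) \<in>
        tw_hom (op_cat C) (utriple (p3 s) (p2 s) (p1 s)) (utriple (p3 t) (p2 t) (p1 t))"
      by (elim tw_objE tw_homE) (simp add: tw_hom_def hom_def)
  qed (auto simp: tw_obj_def tw_hom_def tw_idn_def tw_cmp_def)
qed

end

context localizer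
begin

text \<open>The target functor is aspherical: the category of pairs of arrows \<open>f : a \<rightarrow> b0\<close>, \<open>g : b0 \<rightarrow> b\<close> maps by
  composition to the opposite of the slice over \<open>b\<close>, which has an initial object, and the slices of this
  functor have the terminal objects \<open>(f1, 1)\<close>.\<close>

lemma aspherical_twisted_iff:
  assumes "scat C"
  shows "aspherical W (twisted C) \<longleftrightarrow> aspherical W (mk_cat (Ob C) (hom C) (Idn C) (Cmp C))"
proof -
  interpret scat C by fact
  interpret D: catdata "Ob C" "hom C" "Idn C" "Cmp C" by (rule catdata)
  interpret I: functordata "Ob C" "hom C" "Idn C" "Cmp C" "Ob C" "hom C" "Idn C" "Cmp C" "\<lambda>x. x" "\<lambda>f. f"
    by (rule functordata_id[OF catdata])
  interpret T: functordata "tw_obj C" "tw_hom C" "tw_idn C" "tw_cmp C" "Ob C" "hom C" "Idn C" "Cmp C" p3 usnd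
    by (rule functordata_tw_target)
  show ?thesis
  proof (rule aspherical_mk_iff_of_over[OF functordata_tw_target])
    fix b assume b: "b \<in> Ob C"
    let ?X = "over_obj (tw_obj C) (hom C) p3 b" and ?H = "over_hom (tw_hom C) (Cmp C) usnd"
    let ?i = "\<lambda>s. tw_idn C (ufst s)" and ?m = "tw_cmp C"
    \<comment> \<open>The component \<open>p\<close> of a twisted arrow runs backwards, so composing
      the two arrows of an object is contravariant into the slice. \<open>?K\<close> and
      \<open>?n\<close> present its opposite for this reason.\<close>
    let ?Y = "over_obj (Ob C) (hom C) (\<lambda>x. x) b" and ?K = "\<lambda>s t. over_hom (hom C) (Cmp C) (\<lambda>f. f) t s"
    let ?j = "\<lambda>s. Idn C (ufst s)" and ?n = "\<lambda>g f. Cmp C f g"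
    let ?L = "\<lambda>s. upair (p1 (ufst s)) (Cmp C (usnd s) (p2 (ufst s)))"
    interpret X: catdata ?X ?H ?i ?m using b by (rule T.catdata_over)
    interpret Y: catdata ?Y ?K ?j ?n
      using b by (intro catdata.opposite[OF I.catdata_over])
    have XE: "\<exists>a f b0 g. s = upair (utriple a f b0) g \<and> f \<in> Ar C \<and> a \<in> Ob C \<and> b0 \<in> Ob C \<and> Dom C f = a \<and> Cod C f = b0 \<and>
        g \<in> Ar C \<and> Dom C g = b0 \<and> Cod C g = b" if "s \<in> ?X" for s
      using that by (auto simp: over_obj_def tw_obj_def hom_def)
    have HE: "\<exists>p q. u = upair p q \<and> p \<in> Ar C \<and> q \<in> Ar C \<and> Dom C p = a' \<and> Cod C p = a \<and>
        Dom C q = b0 \<and> Cod C q = b0' \<and> f' = Cmp C q (Cmp C f p) \<and> g = Cmp C g' q"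
      if "u \<in> ?H (upair (utriple a f b0) g) (upair (utriple a' f' b0') g')" for u a f b0 g a' f' b0' g'
      using that by (auto simp: over_hom_def tw_hom_def hom_def)
    have L: "functordata ?X ?H ?i ?m ?Y ?K ?j ?n ?L ufst"
    proof
      fix s assume s: "s \<in> ?X"
      from XE[OF s] show "?L s \<in> ?Y" "ufst (tw_idn C (ufst s)) = Idn C (ufst (?L s))"
        by (auto simp: over_obj_def hom_def tw_idn_def)
      fix t u assume t: "t \<in> ?X" and u: "u \<in> ?H s t"
      from XE[OF s] obtain a f b0 g where s': "s = upair (utriple a f b0) g" "f \<in> Ar C" "Dom C f = a"
          "Cod C f = b0" "g \<in> Ar C" "Dom C g = b0" "Cod C g = b" by blast
      from XE[OF t] obtain a' f' b0' g' where t': "t = upair (utriple a' f' b0') g'" "f' \<in> Ar C" "Dom C f' = a'"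
          "Cod C f' = b0'" "g' \<in> Ar C" "Dom C g' = b0'" "Cod C g' = b" by blast
      from HE[OF u[unfolded s'(1) t'(1)]] obtain p q where "u = upair p q" "p \<in> Ar C" "q \<in> Ar C"
          "Dom C p = a'" "Cod C p = a" "Dom C q = b0" "Cod C q = b0'" "f' = Cmp C q (Cmp C f p)" "g = Cmp C g' q"
        by blast
      then show "ufst u \<in> ?K (?L s) (?L t)"
        using s' t' by (simp add: over_hom_def hom_def)
    qed (simp add: tw_cmp_def)
    have "aspherical W (mk_cat ?X ?H ?i ?m) \<longleftrightarrow> aspherical W (mk_cat ?Y ?K ?j ?n)"
    proof (rule aspherical_mk_iff_of_over[OF L])
      fix y assume y: "y \<in> ?Y"
      then obtain a1 f1 where y': "y = upair a1 f1" "a1 \<in> Ob C" "f1 \<in> Ar C" "Dom C f1 = a1" "Cod C f1 = b"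
        by (auto simp: over_obj_def hom_def)
      let ?t = "upair (upair (utriple a1 f1 b) (Idn C b)) (Idn C a1)"
      show "aspherical W (over_cat ?X ?H ?i ?m ?K ?n ?L ufst y)"
      proof (rule aspherical_mk_terminal[OF functordata.catdata_over[OF L y]])
        show "?t \<in> over_obj ?X ?K ?L y"
          using y' b by (simp add: over_obj_def over_hom_def tw_obj_def hom_def)
        fix z assume "z \<in> over_obj ?X ?K ?L y"
        then obtain a f b0 g p where z: "z = upair (upair (utriple a f b0) g) p"
          and fg: "f \<in> Ar C" "a \<in> Ob C" "b0 \<in> Ob C" "Dom C f = a" "Cod C f = b0" "g \<in> Ar C" "Dom C g = b0" "Cod C g = b"
          and p: "p \<in> Ar C" "Dom C p = a1" "Cod C p = a" "f1 = Cmp C (Cmp C g f) p"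
        proof -
          obtain s p where s: "z = upair s p" "s \<in> ?X" "p \<in> ?K (?L s) y"
            using \<open>z \<in> over_obj ?X ?K ?L y\<close> by (auto simp: over_obj_def[of ?X])
          from XE[OF s(2)] obtain a f b0 g where s': "s = upair (utriple a f b0) g" "f \<in> Ar C" "a \<in> Ob C"
            "b0 \<in> Ob C" "Dom C f = a" "Cod C f = b0" "g \<in> Ar C" "Dom C g = b0" "Cod C g = b" by blast
          have "p \<in> Ar C" "Dom C p = a1" "Cod C p = a" "f1 = Cmp C (Cmp C g f) p"
            using s(3) unfolding s'(1) y'(1) by (simp_all add: over_hom_def hom_def)
          then show ?thesis
            using s(1) s' by (intro that[of a f b0 g p]) simp_all
        qed
        \<comment> \<open>Compatibility with the identity of \<open>a1\<close> forces the first
          component to be \<open>p\<close>, and compatibility with the identity of \<open>b\<close>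
          forces the second to be \<open>g\<close>.\<close>
        show "\<exists>!u. u \<in> over_hom ?H ?n ufst z ?t"
        proof (rule ex1I[of _ "upair p g"])
          show "upair p g \<in> over_hom ?H ?n ufst z ?t"
            using z fg p y' b by (simp add: over_hom_def tw_hom_def hom_def)
          show "u = upair p g" if "u \<in> over_hom ?H ?n ufst z ?t" for u
            using that z y' b by (auto simp: over_hom_def tw_hom_def hom_def)
        qed
      qed
    qed
    moreover have "aspherical W (mk_cat ?Y ?K ?j ?n)"
    proof (rule aspherical_mk_initial[OF Y.catdata_axioms])
      show "upair b (Idn C b) \<in> ?Y" using b by (simp add: over_obj_def hom_def)
    qed (use b in \<open>auto simp: over_obj_def over_hom_def hom_def\<close>)
    ultimately show "aspherical W (over_cat (tw_obj C) (tw_hom C) (tw_idn C) (tw_cmp C) (hom C) (Cmp C) p3 usnd b)"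
      by simp
  qed
qed

lemma aspherical_twisted_op:
  assumes "scat C"
  shows "aspherical W (twisted C) \<longleftrightarrow> aspherical W (twisted (op_cat C))"
proof -
  interpret scat C by fact
  show ?thesis
  proof (rule aspherical_mk_iff_of_surj_ff[OF functordata_tw_swap])
    fix t assume "t \<in> tw_obj (op_cat C)"
    then show "\<exists>s\<in>tw_obj C. utriple (p3 s) (p2 s) (p1 s) = t"
      by (intro bexI[of _ "utriple (p3 t) (p2 t) (p1 t)"]) (auto simp: tw_obj_def hom_def)
  next
    fix s t u assume "s \<in> tw_obj C" "t \<in> tw_obj C"
      "u \<in> tw_hom (op_cat C) (utriple (p3 s) (p2 s) (p1 s)) (utriple (p3 t) (p2 t) (p1 t))"
    then show "\<exists>!v. v \<in> tw_hom C s t \<and> upair (usnd v) (ufst v) = u"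
      by (intro ex1I[of _ "upair (usnd u) (ufst u)"]) (auto simp: tw_hom_def hom_def tw_obj_def)
  qed
qed

text \<open>The two categories differ only in the endpoints attached to arrows. This is the bridge
  from an arbitrary small category to the lemmas on presented ones.\<close>

lemma aspherical_mk_hom_iff:
  assumes "scat C"
  shows "aspherical W (mk_cat (Ob C) (hom C) (Idn C) (Cmp C)) \<longleftrightarrow> aspherical W C"
proof -
  interpret scat C by fact
  interpret D: catdata "Ob C" "hom C" "Idn C" "Cmp C" by (rule catdata)
  let ?D = "mk_cat (Ob C) (hom C) (Idn C) (Cmp C)"
  let ?F = "\<lparr>Src = ?D, Trg = C, FO = (\<lambda>x\<in>Ob C. x), FA = (\<lambda>t\<in>Ar ?D. p2 t)\<rparr>"
  show ?thesis
  proof (rule aspherical_iff_of_surj_ff)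
    show "ftor ?D C ?F"
      by (rule D.ftor_mk_cat[OF small_cat, where \<phi> = "\<lambda>x. x" and \<psi> = p2]) simp_all
    fix a a' g assume "a \<in> Ob ?D" "a' \<in> Ob ?D" "g \<in> hom C (FO ?F a) (FO ?F a')"
    then show "\<exists>!f. f \<in> hom ?D a a' \<and> FA ?F f = g"
      by (intro ex1I[of _ "utriple a g a'"]) (auto simp: in_hom_mk_cat)
  qed simp
qed

lemma aspherical_op_iff:
  assumes "scat C"
  shows "aspherical W (op_cat C) \<longleftrightarrow> aspherical W C"
proof -
  interpret scat C by fact
  have op: "scat (op_cat C)" by unfold_locales (rule small_cat_op)
  show ?thesis
    using aspherical_twisted_iff[OF assms] aspherical_twisted_iff[OF op] aspherical_twisted_op[OF assms]
      aspherical_mk_hom_iff[OF assms] aspherical_mk_hom_iff[OF op] by blast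
qed

text \<open>Reversing the data writes the triples in the other order, whereas \<open>op_cat\<close>
  keeps the triples and exchanges the reading of their ends. The two categories are distinct terms,
  and a surjective fully faithful functor links them.\<close>

lemma aspherical_mk_op_iff:
  assumes "catdata X H i m"
  shows "aspherical W (mk_cat X (\<lambda>x y. H y x) i (\<lambda>g f. m f g)) \<longleftrightarrow> aspherical W (mk_cat X H i m)"
proof -
  interpret catdata X H i m by fact
  let ?C = "mk_cat X H i m"
  have op: "scat (op_cat ?C)" by unfold_locales (rule mk.small_cat_op)
  interpret O: catdata "Ob (op_cat ?C)" "hom (op_cat ?C)" "Idn (op_cat ?C)" "Cmp (op_cat ?C)"
    by (rule scat.catdata[OF op])
  interpret F: catdata X "\<lambda>x y. H y x" i "\<lambda>g f. m f g" by (rule opposite)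
  have "aspherical W (mk_cat (Ob (op_cat ?C)) (hom (op_cat ?C)) (Idn (op_cat ?C)) (Cmp (op_cat ?C))) \<longleftrightarrow>
      aspherical W (mk_cat X (\<lambda>x y. H y x) i (\<lambda>g f. m f g))"
  proof (rule aspherical_mk_iff_of_surj_ff[where \<phi> = "\<lambda>x. x" and \<kappa> = p2])
    show "functordata (Ob (op_cat ?C)) (hom (op_cat ?C)) (Idn (op_cat ?C)) (Cmp (op_cat ?C))
       X (\<lambda>x y. H y x) i (\<lambda>g f. m f g) (\<lambda>x. x) p2"
      by unfold_locales (auto simp: in_hom_mk_cat)
  next
    fix x x' g assume "x \<in> Ob (op_cat ?C)" "x' \<in> Ob (op_cat ?C)" "g \<in> H x' x"
    then show "\<exists>!f. f \<in> hom (op_cat ?C) x x' \<and> p2 f = g"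
      by (intro ex1I[of _ "utriple x' g x"]) (auto simp: in_hom_mk_cat)
  qed simp
  then show ?thesis
    using aspherical_mk_hom_iff[OF op] aspherical_op_iff[OF mk.scat_axioms] by simp
qed

text \<open>This is the slice version for the reversed data. Invariance under opposites is invoked
  for source and target, and for each category under \<open>y\<close>.\<close>

lemma aspherical_mk_iff_of_under:
  assumes F: "functordata X H i m Y K j n \<phi> \<kappa>"
    and asph: "\<And>y. y \<in> Y \<Longrightarrow> aspherical W (under_cat X H i m K n \<phi> \<kappa> y)"
  shows "aspherical W (mk_cat X H i m) \<longleftrightarrow> aspherical W (mk_cat Y K j n)"
proof -
  interpret functordata X H i m Y K j n \<phi> \<kappa> by fact
  have "aspherical W (mk_cat X (\<lambda>x y. H y x) i (\<lambda>g f. m f g)) \<longleftrightarrow>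
      aspherical W (mk_cat Y (\<lambda>x y. K y x) j (\<lambda>g f. n f g))"
  proof (rule aspherical_mk_iff_of_over[OF opposite])
    fix y assume y: "y \<in> Y"
    show "aspherical W (over_cat X (\<lambda>x y. H y x) i (\<lambda>g f. m f g) (\<lambda>x y. K y x) (\<lambda>g f. n f g) \<phi> \<kappa> y)"
      using aspherical_mk_op_iff[OF catdata_under[OF y]] asph[OF y]
      by (simp add: over_hom_def[abs_def] under_hom_def)
  qed
  then show ?thesis
    using aspherical_mk_op_iff[OF X.catdata_axioms] aspherical_mk_op_iff[OF Y.catdata_axioms] by simp
qed

end

section \<open>Squares\<close>

text \<open>An unpacked form of \<open>is_square\<close>. The corners are parameters, so two squares
  to be pasted mention the same side and the same two categories.\<close>

locale sq = v: ftor A' A v + w: ftor B' B w + u': ftor A' B' u' + u: ftor A B u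
  for A B A' B' :: "'u::universe cat" and v w u' u :: "'u func" +
  fixes \<alpha> :: "'u \<Rightarrow> 'u"
  assumes ext_\<alpha>: "\<alpha> \<in> extensional (Ob A')"
    and \<alpha>_in [simp]: "x \<in> Ob A' \<Longrightarrow> \<alpha> x \<in> Ar B"
    and dom_\<alpha> [simp]: "x \<in> Ob A' \<Longrightarrow> Dom B (\<alpha> x) = FO u (FO v x)"
    and cod_\<alpha> [simp]: "x \<in> Ob A' \<Longrightarrow> Cod B (\<alpha> x) = FO w (FO u' x)"
    and natural: "f \<in> Ar A' \<Longrightarrow> Cmp B (\<alpha> (Cod A' f)) (FA u (FA v f)) = Cmp B (FA w (FA u' f)) (\<alpha> (Dom A' f))"
begin

abbreviation "the_sq \<equiv> \<lparr>Top = v, Bot = w, Lft = u', Rgt = u, Cell = \<alpha>\<rparr>"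

lemma is_square: "is_square the_sq"
  using v.is_functor w.is_functor u'.is_functor u.is_functor ext_\<alpha> natural
  by (auto simp: is_square_def is_nat_def hom_def)

text \<open>Composites are normalized to the right, which hides the redex of \<open>natural\<close>
  as soon as a further arrow \<open>k\<close> precedes it; this is naturality in that normal
  form.\<close>

lemma natural': "f \<in> Ar A' \<Longrightarrow> k \<in> Ar B \<Longrightarrow> Cod B k = FO u (FO v (Dom A' f)) \<Longrightarrow>
  Cmp B (\<alpha> (Cod A' f)) (Cmp B (FA u (FA v f)) k) = Cmp B (FA w (FA u' f)) (Cmp B (\<alpha> (Dom A' f)) k)"
  using w.B.cmp_assoc[of k "FA u (FA v f)" "\<alpha> (Cod A' f)"] w.B.cmp_assoc[of k "\<alpha> (Dom A' f)" "FA w (FA u' f)"]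
  by (simp add: natural)

lemma opposite: "sq (op_cat B') (op_cat B) (op_cat A') (op_cat A) (op_func u') (op_func u) (op_func v) (op_func w) \<alpha>"
  using ftor_op[OF v.ftor_axioms] ftor_op[OF w.ftor_axioms] ftor_op[OF u'.ftor_axioms] ftor_op[OF u.ftor_axioms]
  by (intro sq.intro sq_axioms.intro) (auto simp: ext_\<alpha> natural)

end

lemma is_squareE:
  assumes "is_square D"
  obtains A B A' B' v w u' u \<alpha> where "D = \<lparr>Top = v, Bot = w, Lft = u', Rgt = u, Cell = \<alpha>\<rparr>"
    "sq A B A' B' v w u' u \<alpha>"
proof -
  obtain v w u' u \<alpha> where D: "D = \<lparr>Top = v, Bot = w, Lft = u', Rgt = u, Cell = \<alpha>\<rparr>"
    by (cases D) auto
  let ?A = "Src u" and ?B = "Trg u" and ?A' = "Src u'" and ?B' = "Trg u'"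
  have f: "ftor ?A' ?A v" "ftor ?B' ?B w" "ftor ?A' ?B' u'" "ftor ?A ?B u"
    using assms by (auto simp: D is_square_def ftor_iff)
  have st: "Src v = ?A'" "Trg w = ?B" "Src w = ?B'" using f by (simp_all add: ftor_iff)
  have nat: "is_nat (cmp_func u v) (cmp_func w u') \<alpha>"
    using assms by (simp add: D is_square_def)
  have "sq ?A ?B ?A' ?B' v w u' u \<alpha>"
  proof (intro sq.intro sq_axioms.intro f)
    show "\<alpha> \<in> extensional (Ob ?A')" using nat by (simp add: is_nat_def st)
    show "\<alpha> x \<in> Ar ?B" "Dom ?B (\<alpha> x) = FO u (FO v x)" "Cod ?B (\<alpha> x) = FO w (FO u' x)"
      if "x \<in> Ob ?A'" for x
      using nat that by (simp_all add: is_nat_def st hom_def)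
    show "Cmp ?B (\<alpha> (Cod ?A' h)) (FA u (FA v h)) = Cmp ?B (FA w (FA u' h)) (\<alpha> (Dom ?A' h))"
      if "h \<in> Ar ?A'" for h
      using nat that by (simp add: is_nat_def st)
  qed
  then show ?thesis using that D by blast
qed

lemma op_square_simps [simp]:
  "op_square \<lparr>Top = v, Bot = w, Lft = u', Rgt = u, Cell = \<alpha>\<rparr> =
     \<lparr>Top = op_func u', Bot = op_func u, Lft = op_func v, Rgt = op_func w, Cell = \<alpha>\<rparr>"
  by (simp add: op_square_def)

lemma op_op_square: "op_square (op_square D) = D"
  by (simp add: op_square_def)

lemma (in ftor) sq_slice:
  assumes b: "b \<in> Ob B"
  shows "sq A B (slice F b) one_cat (slice_forget F b) (ob_func B b) (to_one (slice F b)) F (\<lambda>x\<in>Ob (slice F b). usnd x)"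
proof (intro sq.intro sq_axioms.intro)
  interpret S: scat "slice F b" using b by (rule scat_slice)
  show "ftor (slice F b) A (slice_forget F b)" using b by (rule ftor_slice_forget)
  show "ftor one_cat B (ob_func B b)" using b by (rule B.ftor_ob)
  show "ftor (slice F b) one_cat (to_one (slice F b))" by (rule S.ftor_to_one)
  show "ftor A B F" by (rule ftor_axioms)
  fix x assume "x \<in> Ob (slice F b)"
  then show "(\<lambda>x\<in>Ob (slice F b). usnd x) x \<in> Ar B"
    "Dom B ((\<lambda>x\<in>Ob (slice F b). usnd x) x) = FO F (FO (slice_forget F b) x)"
    "Cod B ((\<lambda>x\<in>Ob (slice F b). usnd x) x) = FO (ob_func B b) (FO (to_one (slice F b)) x)"
    unfolding Ob_slice by (auto simp: slice_forget_def slice_eq over_obj_def hom_def)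
next
  interpret S: scat "slice F b" using b by (rule scat_slice)
  fix t assume t: "t \<in> Ar (slice F b)"
  then have "Dom (slice F b) t \<in> Ob (slice F b)" "Cod (slice F b) t \<in> Ob (slice F b)" by simp_all
  moreover obtain a g f a' g' where t': "t = utriple (upair a g) f (upair a' g')"
    "a \<in> Ob A" "a' \<in> Ob A" "f \<in> Ar A" "Dom A f = a" "Cod A f = a'"
    "g' \<in> Ar B" "Dom B g' = FO F a'" "Cod B g' = b" "g = Cmp B g' (FA F f)"
    using t by (rule slice_arrowE)
  moreover have "Dom (slice F b) t = upair a g" "Cod (slice F b) t = upair a' g'"
    using t t' by (simp_all add: slice_eq)
  ultimately show "Cmp B ((\<lambda>x\<in>Ob (slice F b). usnd x) (Cod (slice F b) t)) (FA F (FA (slice_forget F b) t)) =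
      Cmp B (FA (ob_func B b) (FA (to_one (slice F b)) t)) ((\<lambda>x\<in>Ob (slice F b). usnd x) (Dom (slice F b) t))"
    using t b by (simp add: slice_forget_def)
qed simp

lemma slice_square_eq:
  "slice_square F b = \<lparr>Top = slice_forget F b, Bot = ob_func (Trg F) b, Lft = to_one (slice F b), Rgt = F,
     Cell = (\<lambda>x\<in>Ob (slice F b). usnd x)\<rparr>"
  by (simp add: slice_square_def)

lemma sq_hcomp:
  assumes "sq A B A' B' v w u' u \<alpha>" "sq A' B' A'' B'' v' w' u'' u' \<alpha>'"
  shows "sq A B A'' B'' (cmp_func v v') (cmp_func w w') u'' u
    (\<lambda>x\<in>Ob A''. Cmp B (FA w (\<alpha>' x)) (\<alpha> (FO v' x)))"
proof -
  interpret D: sq A B A' B' v w u' u \<alpha> by fact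
  interpret E: sq A' B' A'' B'' v' w' u'' u' \<alpha>' by fact
  show ?thesis
  proof (intro sq.intro sq_axioms.intro)
    show "ftor A'' A (cmp_func v v')" by (rule ftor_cmp[OF E.v.ftor_axioms D.v.ftor_axioms])
    show "ftor B'' B (cmp_func w w')" by (rule ftor_cmp[OF E.w.ftor_axioms D.w.ftor_axioms])
    show "ftor A'' B'' u''" "ftor A B u" by unfold_locales
    fix f assume f: "f \<in> Ar A''"
    \<comment> \<open>Naturality of \<alpha> is used at the image of \<open>f\<close> under
      \<open>v'\<close>, and afterwards naturality of \<alpha>' inside \<open>w\<close>.\<close>
    have "Cmp B (FA w (\<alpha>' (Cod A'' f))) (Cmp B (\<alpha> (FO v' (Cod A'' f))) (FA u (FA v (FA v' f)))) =
        Cmp B (FA w (\<alpha>' (Cod A'' f))) (Cmp B (FA w (FA u' (FA v' f))) (\<alpha> (FO v' (Dom A'' f))))"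
      using D.natural[of "FA v' f"] f by simp
    also have "\<dots> = Cmp B (FA w (Cmp B' (\<alpha>' (Cod A'' f)) (FA u' (FA v' f)))) (\<alpha> (FO v' (Dom A'' f)))"
      using f by simp
    also have "\<dots> = Cmp B (FA w (FA w' (FA u'' f))) (Cmp B (FA w (\<alpha>' (Dom A'' f))) (\<alpha> (FO v' (Dom A'' f))))"
      unfolding E.natural[OF f] using f by simp
    finally show "Cmp B ((\<lambda>x\<in>Ob A''. Cmp B (FA w (\<alpha>' x)) (\<alpha> (FO v' x))) (Cod A'' f)) (FA u (FA (cmp_func v v') f)) =
        Cmp B (FA (cmp_func w w') (FA u'' f)) ((\<lambda>x\<in>Ob A''. Cmp B (FA w (\<alpha>' x)) (\<alpha> (FO v' x))) (Dom A'' f))"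
      using f by simp
  qed simp_all
qed

section \<open>Factorization categories of a square\<close>

definition fact_obj :: "'u::universe square \<Rightarrow> 'u \<Rightarrow> 'u \<Rightarrow> 'u \<Rightarrow> 'u set" where
  "fact_obj D a b' g = {utriple a' f g' | a' f g'. a' \<in> Ob (Src (Lft D)) \<and>
     f \<in> hom (Src (Rgt D)) a (FO (Top D) a') \<and> g' \<in> hom (Trg (Lft D)) (FO (Lft D) a') b' \<and>
     Cmp (Trg (Rgt D)) (FA (Bot D) g') (Cmp (Trg (Rgt D)) (Cell D a') (FA (Rgt D) f)) = g}"

definition fact_hom :: "'u::universe square \<Rightarrow> 'u \<Rightarrow> 'u \<Rightarrow> 'u set" where
  "fact_hom D x y = {h \<in> hom (Src (Lft D)) (p1 x) (p1 y).
     Cmp (Src (Rgt D)) (FA (Top D) h) (p2 x) = p2 y \<and> Cmp (Trg (Lft D)) (p3 y) (FA (Lft D) h) = p3 x}"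

lemma factorization_cat_eq:
  "factorization_cat D a b' g = mk_cat (fact_obj D a b' g) (fact_hom D) (\<lambda>x. Idn (Src (Lft D)) (p1 x)) (Cmp (Src (Lft D)))"
  by (simp add: factorization_cat_def Let_def fact_obj_def fact_hom_def[abs_def])

context sq
begin

lemma in_fact_obj:
  "utriple x f g' \<in> fact_obj the_sq a b' g \<longleftrightarrow> x \<in> Ob A' \<and> f \<in> Ar A \<and> Dom A f = a \<and> Cod A f = FO v x \<and>
     g' \<in> Ar B' \<and> Dom B' g' = FO u' x \<and> Cod B' g' = b' \<and> Cmp B (FA w g') (Cmp B (\<alpha> x) (FA u f)) = g"
  by (auto simp: fact_obj_def hom_def)

lemma in_fact_hom:
  "h \<in> fact_hom the_sq (utriple x f g) (utriple y f' g') \<longleftrightarrow> h \<in> Ar A' \<and> Dom A' h = x \<and> Cod A' h = y \<and>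
     Cmp A (FA v h) f = f' \<and> Cmp B' g' (FA u' h) = g"
  by (auto simp: fact_hom_def hom_def)

lemma fact_objE:
  assumes "s \<in> fact_obj the_sq a b' g"
  obtains x f g' where "s = utriple x f g'" "x \<in> Ob A'" "f \<in> Ar A" "Dom A f = a" "Cod A f = FO v x"
    "g' \<in> Ar B'" "Dom B' g' = FO u' x" "Cod B' g' = b'" "Cmp B (FA w g') (Cmp B (\<alpha> x) (FA u f)) = g"
  using assms by (auto simp: fact_obj_def hom_def)

lemma catdata_fact:
  "catdata (fact_obj the_sq a b' g) (fact_hom the_sq) (\<lambda>x. Idn A' (p1 x)) (Cmp A')"
proof
  show "small_set (fact_obj the_sq a b' g)"
    by (rule small_utriples[OF v.A.small_Ob v.B.small_Ar w.A.small_Ar]) (auto simp: fact_obj_def hom_def)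
  fix s t r z h k l
  show "small_set (fact_hom the_sq s t)"
    by (rule small_subset[OF v.A.small_Ar]) (auto simp: fact_hom_def hom_def)
  assume s: "s \<in> fact_obj the_sq a b' g"
  then show "Idn A' (p1 s) \<in> fact_hom the_sq s s"
    by (elim fact_objE) (simp add: in_fact_hom)
  assume t: "t \<in> fact_obj the_sq a b' g" and h: "h \<in> fact_hom the_sq s t"
  show "Cmp A' h (Idn A' (p1 s)) = h" "Cmp A' (Idn A' (p1 t)) h = h"
    using h by (simp_all add: fact_hom_def hom_def)
  assume r: "r \<in> fact_obj the_sq a b' g" and k: "k \<in> fact_hom the_sq t r"
  show "Cmp A' k h \<in> fact_hom the_sq s r"
    using s t r h k by (elim fact_objE) (auto simp: in_fact_hom)
  assume "z \<in> fact_obj the_sq a b' g" and "l \<in> fact_hom the_sq r z"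
  then show "Cmp A' (Cmp A' l k) h = Cmp A' l (Cmp A' k h)"
    using h k by (simp add: fact_hom_def hom_def)
qed

lemma fact_cat_eq: "factorization_cat the_sq a b' g = mk_cat (fact_obj the_sq a b' g) (fact_hom the_sq) (\<lambda>x. Idn A' (p1 x)) (Cmp A')"
  by (simp add: factorization_cat_eq)

lemma exact_iff: "exact_square W the_sq \<longleftrightarrow>
  (\<forall>a b' g. a \<in> Ob A \<and> b' \<in> Ob B' \<and> g \<in> Ar B \<and> Dom B g = FO u a \<and> Cod B g = FO w b' \<longrightarrow>
     aspherical W (factorization_cat the_sq a b' g))"
  using is_square by (auto simp: exact_square_def hom_def)

end

section \<open>Closure properties of exact squares\<close>

context localizer
begin

lemma exact_op:
  assumes "exact_square W D"
  shows "exact_square W (op_square D)"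
proof -
  have "is_square D" using assms by (simp add: exact_square_def)
  then obtain A B A' B' v w u' u \<alpha> where D: "D = \<lparr>Top = v, Bot = w, Lft = u', Rgt = u, Cell = \<alpha>\<rparr>"
    and sq: "sq A B A' B' v w u' u \<alpha>" by (rule is_squareE)
  interpret sq A B A' B' v w u' u \<alpha> by fact
  interpret O: sq "op_cat B'" "op_cat B" "op_cat A'" "op_cat A" "op_func u'" "op_func u" "op_func v" "op_func w" \<alpha>
    by (rule opposite)
  show ?thesis
    unfolding D op_square_simps O.exact_iff
  proof (intro allI impI)
    fix b' a g
    assume *: "b' \<in> Ob (op_cat B') \<and> a \<in> Ob (op_cat A) \<and> g \<in> Ar (op_cat B) \<and>
      Dom (op_cat B) g = FO (op_func w) b' \<and> Cod (op_cat B) g = FO (op_func u) a"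
    interpret F: catdata "fact_obj the_sq a b' g" "fact_hom the_sq" "\<lambda>x. Idn A' (p1 x)" "Cmp A'"
      by (rule catdata_fact)
    interpret Fop: catdata "fact_obj the_sq a b' g" "\<lambda>x y. fact_hom the_sq y x" "\<lambda>x. Idn A' (p1 x)" "\<lambda>g f. Cmp A' f g"
      by (rule F.opposite)
    interpret G: catdata "fact_obj O.the_sq b' a g" "fact_hom O.the_sq" "\<lambda>x. Idn (op_cat A') (p1 x)" "Cmp (op_cat A')"
      by (rule O.catdata_fact)
    \<comment> \<open>Transposition exchanges \<open>A\<close> with \<open>B'\<close>, hence the
      arrow out of \<open>a\<close> with the arrow into \<open>b'\<close>.\<close>
    let ?\<phi> = "\<lambda>s. utriple (p1 s) (p3 s) (p2 s)"
    have obj: "?\<phi> s \<in> fact_obj O.the_sq b' a g" if "s \<in> fact_obj the_sq a b' g" for s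
      using that by (elim fact_objE) (simp add: O.in_fact_obj)
    have hom: "h \<in> fact_hom O.the_sq (?\<phi> s) (?\<phi> t) \<longleftrightarrow> h \<in> fact_hom the_sq t s"
      if "s \<in> fact_obj the_sq a b' g" "t \<in> fact_obj the_sq a b' g" for s t h
      using that by (elim fact_objE) (auto simp: in_fact_hom O.in_fact_hom)
    have "aspherical W (mk_cat (fact_obj the_sq a b' g) (\<lambda>x y. fact_hom the_sq y x) (\<lambda>x. Idn A' (p1 x)) (\<lambda>g f. Cmp A' f g)) \<longleftrightarrow>
      aspherical W (mk_cat (fact_obj O.the_sq b' a g) (fact_hom O.the_sq) (\<lambda>x. Idn (op_cat A') (p1 x)) (Cmp (op_cat A')))"
    proof (rule aspherical_mk_iff_of_surj_ff[where \<phi> = ?\<phi> and \<kappa> = "\<lambda>h. h"])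
      show "functordata (fact_obj the_sq a b' g) (\<lambda>x y. fact_hom the_sq y x) (\<lambda>x. Idn A' (p1 x)) (\<lambda>g f. Cmp A' f g)
         (fact_obj O.the_sq b' a g) (fact_hom O.the_sq) (\<lambda>x. Idn (op_cat A') (p1 x)) (Cmp (op_cat A')) ?\<phi> (\<lambda>h. h)"
        by unfold_locales (simp_all add: obj hom)
      show "\<exists>s\<in>fact_obj the_sq a b' g. ?\<phi> s = t" if "t \<in> fact_obj O.the_sq b' a g" for t
        using that by (intro bexI[of _ "?\<phi> t"]; elim O.fact_objE) (simp_all add: in_fact_obj)
    qed (auto simp: hom)
    moreover have "aspherical W (factorization_cat the_sq a b' g)"
      using assms * unfolding D exact_iff by simp
    ultimately show "aspherical W (factorization_cat O.the_sq b' a g)"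
      using aspherical_mk_op_iff[OF F.catdata_axioms] by (simp add: fact_cat_eq O.fact_cat_eq)
  qed
qed

text \<open>An object on the left consists of a slice object \<open>(x, k)\<close>, an arrow
  \<open>f\<close> and the only arrow of \<open>e\<close>. Moving \<open>k\<close> into the third
  slot gives a factorization for \<open>b\<close>; the condition on slice arrows becomes the
  condition on that slot.\<close>

lemma aspherical_factorization_hcomp_slice:
  assumes "sq A B A' B' v w u' u \<alpha>" and b: "b \<in> Ob B'"
  shows "aspherical W (factorization_cat (hcomp \<lparr>Top = v, Bot = w, Lft = u', Rgt = u, Cell = \<alpha>\<rparr> (slice_square u' b)) a pt g) \<longleftrightarrow>
    aspherical W (factorization_cat \<lparr>Top = v, Bot = w, Lft = u', Rgt = u, Cell = \<alpha>\<rparr> a b g)"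
proof -
  interpret sq A B A' B' v w u' u \<alpha> by fact
  interpret S: sq A' B' "slice u' b" one_cat "slice_forget u' b" "ob_func B' b" "to_one (slice u' b)" u' "\<lambda>x\<in>Ob (slice u' b). usnd x"
    using b by (rule u'.sq_slice)
  let ?\<beta> = "\<lambda>x\<in>Ob (slice u' b). Cmp B (FA w (usnd x)) (\<alpha> (FO (slice_forget u' b) x))"
  \<comment> \<open>Pasting inserts the restricted cell of the slice square; under the outer
    restriction it reduces to \<open>usnd x\<close>.\<close>
  have \<beta>: "(\<lambda>x\<in>Ob (slice u' b). Cmp B (FA w ((\<lambda>x\<in>Ob (slice u' b). usnd x) x)) (\<alpha> (FO (slice_forget u' b) x))) = ?\<beta>"
    by (intro restrict_ext) simp
  interpret H: sq A B "slice u' b" one_cat "cmp_func v (slice_forget u' b)" "cmp_func w (ob_func B' b)" "to_one (slice u' b)" u ?\<beta>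
    using sq_hcomp[OF sq_axioms S.sq_axioms] unfolding \<beta> .
  have eq: "hcomp the_sq (slice_square u' b) = H.the_sq"
    unfolding \<beta>[symmetric] by (simp add: hcomp_def slice_square_eq)
  interpret F: catdata "fact_obj the_sq a b g" "fact_hom the_sq" "\<lambda>x. Idn A' (p1 x)" "Cmp A'"
    by (rule catdata_fact)
  interpret G: catdata "fact_obj H.the_sq a pt g" "fact_hom H.the_sq" "\<lambda>x. Idn (slice u' b) (p1 x)" "Cmp (slice u' b)"
    by (rule H.catdata_fact)
  let ?\<phi> = "\<lambda>s. utriple (ufst (p1 s)) (p2 s) (usnd (p1 s))"
  have HE: "\<exists>x k f. s = utriple (upair x k) f pt \<and> upair x k \<in> Ob (slice u' b) \<and> x \<in> Ob A' \<and> k \<in> Ar B' \<and> Dom B' k = FO u' x \<and> Cod B' k = b \<and>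
      f \<in> Ar A \<and> Dom A f = a \<and> Cod A f = FO v x \<and> Cmp B (FA w k) (Cmp B (\<alpha> x) (FA u f)) = g"
    if s: "s \<in> fact_obj H.the_sq a pt g" for s
  proof -
    obtain z f q where z: "s = utriple z f q" "z \<in> Ob (slice u' b)" "f \<in> Ar A" "Dom A f = a"
        "Cod A f = FO (cmp_func v (slice_forget u' b)) z" "q \<in> Ar one_cat"
        "Cmp B (FA (cmp_func w (ob_func B' b)) q) (Cmp B (?\<beta> z) (FA u f)) = g"
      using s by (rule H.fact_objE) blast
    obtain x k where x: "z = upair x k" "x \<in> Ob A'" "k \<in> Ar B'" "Dom B' k = FO u' x" "Cod B' k = b"
      using z(2) unfolding u'.Ob_slice hom_def by blast
    have "FO (slice_forget u' b) z = x" using z(2) x by (simp add: slice_forget_def)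
    then show ?thesis using z x b by simp
  qed
  have "aspherical W (mk_cat (fact_obj H.the_sq a pt g) (fact_hom H.the_sq) (\<lambda>x. Idn (slice u' b) (p1 x)) (Cmp (slice u' b)))
    \<longleftrightarrow> aspherical W (mk_cat (fact_obj the_sq a b g) (fact_hom the_sq) (\<lambda>x. Idn A' (p1 x)) (Cmp A'))"
  proof (rule aspherical_mk_iff_of_surj_ff[where \<phi> = ?\<phi> and \<kappa> = p2])
    have homE: "\<exists>h'. h = utriple (upair x k) h' (upair y l) \<and> h' \<in> Ar A' \<and> Dom A' h' = x \<and> Cod A' h' = y \<and> Cmp B' l (FA u' h') = k \<and> Cmp A (FA v h') f = f'"
      if xy: "upair x k \<in> Ob (slice u' b)" "upair y l \<in> Ob (slice u' b)" and h: "h \<in> fact_hom H.the_sq (utriple (upair x k) f pt) (utriple (upair y l) f' pt)"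
      for h x k y l f f'
    proof -
      have h': "h \<in> Ar (slice u' b)" "Dom (slice u' b) h = upair x k" "Cod (slice u' b) h = upair y l"
          "Cmp A (FA v (FA (slice_forget u' b) h)) f = f'"
        using h unfolding H.in_fact_hom by (elim conjE, simp)+
      then have "h \<in> hom (slice u' b) (upair x k) (upair y l)" by (simp add: hom_def)
      then obtain h'' where h'': "h = utriple (upair x k) h'' (upair y l)" "h'' \<in> over_hom (hom A') (Cmp B') (FA u') (upair x k) (upair y l)"
        unfolding u'.slice_eq in_hom_mk_cat by blast
      then have "FA (slice_forget u' b) h = h''" using h'(1) by (simp add: slice_forget_def)
      then show ?thesis using h' h'' by (simp add: over_hom_def hom_def)
    qed
    show "functordata (fact_obj H.the_sq a pt g) (fact_hom H.the_sq) (\<lambda>x. Idn (slice u' b) (p1 x)) (Cmp (slice u' b))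
       (fact_obj the_sq a b g) (fact_hom the_sq) (\<lambda>x. Idn A' (p1 x)) (Cmp A') ?\<phi> p2"
    proof
      fix s assume s: "s \<in> fact_obj H.the_sq a pt g"
      obtain x k f where s': "s = utriple (upair x k) f pt" "upair x k \<in> Ob (slice u' b)"
        and k: "x \<in> Ob A'" "k \<in> Ar B'" "Dom B' k = FO u' x" "Cod B' k = b"
        "f \<in> Ar A" "Dom A f = a" "Cod A f = FO v x" "Cmp B (FA w k) (Cmp B (\<alpha> x) (FA u f)) = g"
        using HE[OF s] by blast
      show "?\<phi> s \<in> fact_obj the_sq a b g" using s' k by (simp add: in_fact_obj)
      show "p2 (Idn (slice u' b) (p1 s)) = Idn A' (p1 (?\<phi> s))"
        using s' by (simp add: u'.slice_eq)
      fix t h assume t: "t \<in> fact_obj H.the_sq a pt g" and h: "h \<in> fact_hom H.the_sq s t"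
      obtain y l f' where t': "t = utriple (upair y l) f' pt" "upair y l \<in> Ob (slice u' b)"
        using HE[OF t] by blast
      obtain h' where h': "h = utriple (upair x k) h' (upair y l)" "h' \<in> Ar A'" "Dom A' h' = x" "Cod A' h' = y"
         "Cmp B' l (FA u' h') = k" "Cmp A (FA v h') f = f'"
        using homE[OF s'(2) t'(2)] h s' t' by blast
      then show "p2 h \<in> fact_hom the_sq (?\<phi> s) (?\<phi> t)"
        using s' t' by (simp add: in_fact_hom)
      fix r h2 assume r: "r \<in> fact_obj H.the_sq a pt g" and h2: "h2 \<in> fact_hom H.the_sq t r"
      obtain z m f'' where r': "r = utriple (upair z m) f'' pt" "upair z m \<in> Ob (slice u' b)"
        using HE[OF r] by blast
      have "h2 \<in> Ar (slice u' b)" "h \<in> Ar (slice u' b)"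
        using h h2 s' t' r' by (simp_all add: H.in_fact_hom)
      moreover obtain h2' where "h2 = utriple (upair y l) h2' (upair z m)"
        using homE[OF t'(2) r'(2)] h2 t' r' by blast
      ultimately show "p2 (Cmp (slice u' b) h2 h) = Cmp A' (p2 h2) (p2 h)"
        using h'(1) by (simp add: u'.slice_eq)
    qed
    fix y assume "y \<in> fact_obj the_sq a b g"
    then obtain x f k where y: "y = utriple x f k" "x \<in> Ob A'" "f \<in> Ar A" "Dom A f = a" "Cod A f = FO v x"
      "k \<in> Ar B'" "Dom B' k = FO u' x" "Cod B' k = b" "Cmp B (FA w k) (Cmp B (\<alpha> x) (FA u f)) = g"
      by (rule fact_objE)
    then have "upair x k \<in> Ob (slice u' b)" by (simp add: u'.Ob_slice hom_def)
    moreover from this have "FO (slice_forget u' b) (upair x k) = x" by (simp add: slice_forget_def)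
    ultimately have "utriple (upair x k) f pt \<in> fact_obj H.the_sq a pt g"
      using y(1-8) b by (simp add: H.in_fact_obj flip: y(9))
    then show "\<exists>s\<in>fact_obj H.the_sq a pt g. ?\<phi> s = y"
      using y by force
  next
    fix s t h' assume s: "s \<in> fact_obj H.the_sq a pt g" and t: "t \<in> fact_obj H.the_sq a pt g"
      and h: "h' \<in> fact_hom the_sq (?\<phi> s) (?\<phi> t)"
    obtain x k f where s': "s = utriple (upair x k) f pt" "upair x k \<in> Ob (slice u' b)"
      using HE[OF s] by blast
    obtain y l f' where t': "t = utriple (upair y l) f' pt" "upair y l \<in> Ob (slice u' b)"
      using HE[OF t] by blast
    have h': "h' \<in> Ar A'" "Dom A' h' = x" "Cod A' h' = y" "Cmp B' l (FA u' h') = k" "Cmp A (FA v h') f = f'"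
      using h s' t' by (simp_all add: in_fact_hom)
    let ?h = "utriple (upair x k) h' (upair y l)"
    have h'': "?h \<in> hom (slice u' b) (upair x k) (upair y l)"
      using s'(2) t'(2) h' by (auto simp: u'.slice_eq in_hom_mk_cat over_hom_def hom_def)
    moreover from this have "FA (slice_forget u' b) ?h = h'" by (simp add: slice_forget_def hom_def)
    ultimately have in_hom: "?h \<in> fact_hom H.the_sq s t"
      using s' t' h' by (simp add: H.in_fact_hom hom_def)
    show "\<exists>!h. h \<in> fact_hom H.the_sq s t \<and> p2 h = h'"
    proof (rule ex1I[of _ ?h])
      show "?h \<in> fact_hom H.the_sq s t \<and> p2 ?h = h'" using in_hom by simp
      fix h assume h: "h \<in> fact_hom H.the_sq s t \<and> p2 h = h'"
      then have "h \<in> hom (slice u' b) (upair x k) (upair y l)" using s' t' by (simp add: H.in_fact_hom hom_def)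
      then show "h = ?h" using h unfolding u'.slice_eq in_hom_mk_cat by auto
    qed
  qed
  then show ?thesis unfolding eq fact_cat_eq H.fact_cat_eq .
qed

text \<open>The factorization category of the composite maps to that of \<^term>\<open>D\<close>, and the categories of objects
  under a given object of the latter are the factorization categories of \<^term>\<open>E\<close>.\<close>

lemma exact_hcomp:
  assumes "exact_square W D" "exact_square W E" "Rgt E = Lft D"
  shows "exact_square W (hcomp D E)"
proof -
  obtain A B A' B' v w u' u \<alpha> where D: "D = \<lparr>Top = v, Bot = w, Lft = u', Rgt = u, Cell = \<alpha>\<rparr>"
    and sqD: "sq A B A' B' v w u' u \<alpha>"
    using assms(1)[unfolded exact_square_def, THEN conjunct1] by (rule is_squareE)
  obtain A1 B1 A'' B'' v' w' u'' u1 \<alpha>' where E: "E = \<lparr>Top = v', Bot = w', Lft = u'', Rgt = u1, Cell = \<alpha>'\<rparr>"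
    and sqE: "sq A1 B1 A'' B'' v' w' u'' u1 \<alpha>'"
    using assms(2)[unfolded exact_square_def, THEN conjunct1] by (rule is_squareE)
  have u1: "u1 = u'" using assms(3) D E by simp
  interpret D: sq A B A' B' v w u' u \<alpha> by fact
  have "ftor A1 B1 u'" using sqE u1 by (simp add: sq_def)
  then have "A1 = A'" "B1 = B'" by (simp_all add: ftor_iff)
  with sqE u1 have sqE: "sq A' B' A'' B'' v' w' u'' u' \<alpha>'" by simp
  interpret E: sq A' B' A'' B'' v' w' u'' u' \<alpha>' by fact
  let ?\<beta> = "\<lambda>x\<in>Ob A''. Cmp B (FA w (\<alpha>' x)) (\<alpha> (FO v' x))"
  interpret H: sq A B A'' B'' "cmp_func v v'" "cmp_func w w'" u'' u ?\<beta>
    by (rule sq_hcomp[OF sqD sqE])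
  have eq: "hcomp D E = H.the_sq"
    by (simp add: hcomp_def D E)
  show ?thesis
    unfolding eq H.exact_iff
  proof (intro allI impI)
    fix a b g assume *: "a \<in> Ob A \<and> b \<in> Ob B'' \<and> g \<in> Ar B \<and> Dom B g = FO u a \<and> Cod B g = FO (cmp_func w w') b"
    let ?X = "fact_obj H.the_sq a b g" and ?H = "fact_hom H.the_sq" and ?i = "\<lambda>x. Idn A'' (p1 x)"
    let ?Y = "fact_obj D.the_sq a (FO w' b) g" and ?K = "fact_hom D.the_sq" and ?j = "\<lambda>x. Idn A' (p1 x)"
    \<comment> \<open>For \<open>x\<close> in \<open>A''\<close> the new third slot goes from
      \<open>u'(v'(x))\<close> by \<alpha>' to \<open>w'(u''(x))\<close>, and on by the image of the
      old slot to \<open>w'(b)\<close>.\<close>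
    let ?\<phi> = "\<lambda>s. utriple (FO v' (p1 s)) (p2 s) (Cmp B' (FA w' (p3 s)) (\<alpha>' (p1 s)))"
    interpret X: catdata ?X ?H ?i "Cmp A''" by (rule H.catdata_fact)
    interpret Y: catdata ?Y ?K ?j "Cmp A'" by (rule D.catdata_fact)
    have F: "functordata ?X ?H ?i (Cmp A'') ?Y ?K ?j (Cmp A') ?\<phi> (FA v')"
    proof
      fix s assume s: "s \<in> ?X"
      then obtain x f k where s': "s = utriple x f k" "x \<in> Ob A''" "k \<in> Ar B''" "Dom B'' k = FO u'' x" "Cod B'' k = b"
        and f: "f \<in> Ar A" "Dom A f = a" "Cod A f = FO v (FO v' x)"
        and g: "Cmp B (FA (cmp_func w w') k) (Cmp B (?\<beta> x) (FA u f)) = g"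
        by (rule H.fact_objE) simp
      have "Cmp B (FA w (Cmp B' (FA w' k) (\<alpha>' x))) (Cmp B (\<alpha> (FO v' x)) (FA u f)) = g"
        unfolding g[symmetric] using s' f by simp
      then show "?\<phi> s \<in> ?Y"
        using s' f by (simp add: D.in_fact_obj)
      show "FA v' (?i s) = ?j (?\<phi> s)"
        using s' by simp
      fix t h assume t: "t \<in> ?X" and h: "h \<in> ?H s t"
      from t obtain y f' l where t': "t = utriple y f' l" "y \<in> Ob A''" "l \<in> Ar B''" "Dom B'' l = FO u'' y" "Cod B'' l = b" by (rule H.fact_objE)
      from h have h': "h \<in> Ar A''" "Dom A'' h = x" "Cod A'' h = y" "Cmp A (FA v (FA v' h)) f = f'" "Cmp B'' l (FA u'' h) = k"
        unfolding s'(1) t'(1) H.in_fact_hom by (elim conjE, simp)+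
      have "Cmp B' (FA w' k) (\<alpha>' x) = Cmp B' (FA w' l) (Cmp B' (FA w' (FA u'' h)) (\<alpha>' x))"
        using h' s' t' by (simp flip: h'(5))
      also have "\<dots> = Cmp B' (FA w' l) (Cmp B' (\<alpha>' y) (FA u' (FA v' h)))"
        using E.natural[OF h'(1)] h' by simp
      finally show "FA v' h \<in> ?K (?\<phi> s) (?\<phi> t)"
        using s' t' h' by (simp add: D.in_fact_hom)
    qed (simp add: fact_hom_def hom_def)
    have "aspherical W (mk_cat ?X ?H ?i (Cmp A'')) \<longleftrightarrow> aspherical W (mk_cat ?Y ?K ?j (Cmp A'))"
    proof (rule aspherical_mk_iff_of_under[OF F])
      fix y assume y: "y \<in> ?Y"
      then obtain a' f1 g1 where y': "y = utriple a' f1 g1" "a' \<in> Ob A'" "f1 \<in> Ar A" "Dom A f1 = a" "Cod A f1 = FO v a'"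
        "g1 \<in> Ar B'" "Dom B' g1 = FO u' a'" "Cod B' g1 = FO w' b" "Cmp B (FA w g1) (Cmp B (\<alpha> a') (FA u f1)) = g"
        by (rule D.fact_objE)
      let ?Z = "over_obj ?X (\<lambda>x y. ?K y x) ?\<phi> y" and ?L = "under_hom ?H (Cmp A') (FA v')"
      interpret Z: catdata ?Z ?L "\<lambda>s. ?i (ufst s)" "Cmp A''"
        by (rule functordata.catdata_under[OF F y])
      interpret G: catdata "fact_obj E.the_sq a' b g1" "fact_hom E.the_sq" ?i "Cmp A''"
        by (rule E.catdata_fact)
      let ?\<psi> = "\<lambda>z. utriple (p1 (ufst z)) (usnd z) (p3 (ufst z))"
      have ZE: "\<exists>x h k. z = upair (utriple x (Cmp A (FA v h) f1) k) h \<and> x \<in> Ob A'' \<and> h \<in> Ar A' \<and> Dom A' h = a' \<and>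
         Cod A' h = FO v' x \<and> k \<in> Ar B'' \<and> Dom B'' k = FO u'' x \<and> Cod B'' k = b \<and>
         Cmp B' (FA w' k) (Cmp B' (\<alpha>' x) (FA u' h)) = g1" if "z \<in> ?Z" for z
      proof -
        obtain s h where z: "z = upair s h" "s \<in> ?X" "h \<in> ?K y (?\<phi> s)"
          using \<open>z \<in> ?Z\<close> by (auto simp: over_obj_def)
        from z(2) obtain x f k where s: "s = utriple x f k" "x \<in> Ob A''" "k \<in> Ar B''" "Dom B'' k = FO u'' x" "Cod B'' k = b"
          by (rule H.fact_objE)
        show ?thesis
          using z(1,3) s unfolding y'(1) D.in_fact_hom by auto
      qed
      have mem: "upair (utriple x (Cmp A (FA v h) f1) k) h \<in> ?Z" if "utriple x h k \<in> fact_obj E.the_sq a' b g1" for x h k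
      proof -
        have xh: "x \<in> Ob A''" "h \<in> Ar A'" "Dom A' h = a'" "Cod A' h = FO v' x" "k \<in> Ar B''" "Dom B'' k = FO u'' x" "Cod B'' k = b"
         and g1: "g1 = Cmp B' (FA w' k) (Cmp B' (\<alpha>' x) (FA u' h))"
          using that by (auto simp: E.in_fact_obj)
        \<comment> \<open>Naturality of \<alpha> at \<open>h\<close> exposes the image of
          \<open>g1\<close> under \<open>w\<close>, so that a factorization of \<open>g1\<close>
          yields one of \<open>g\<close>.\<close>
        have "Cmp B (\<alpha> (FO v' x)) (Cmp B (FA u (FA v h)) (FA u f1)) = Cmp B (FA w (FA u' h)) (Cmp B (\<alpha> a') (FA u f1))"
          using D.natural'[of h "FA u f1"] xh y' by simp
        then have "Cmp B (FA w (FA w' k)) (Cmp B (FA w (\<alpha>' x)) (Cmp B (\<alpha> (FO v' x)) (Cmp B (FA u (FA v h)) (FA u f1)))) = g"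
          unfolding y'(9)[symmetric] g1 using xh y'(2-5) by simp
        then have "utriple x (Cmp A (FA v h) f1) k \<in> ?X"
          using xh y'(2-5) by (simp add: H.in_fact_obj)
        moreover have "h \<in> ?K y (?\<phi> (utriple x (Cmp A (FA v h) f1) k))"
          unfolding y'(1) by (simp add: D.in_fact_hom xh g1)
        ultimately show ?thesis by (simp add: over_obj_def)
      qed
      have hom: "h \<in> ?L z z' \<longleftrightarrow> h \<in> fact_hom E.the_sq (?\<psi> z) (?\<psi> z')" if zz: "z \<in> ?Z" "z' \<in> ?Z" for z z' h
      proof -
        obtain x k l where z: "z = upair (utriple x (Cmp A (FA v k) f1) l) k" "k \<in> Ar A'" "Dom A' k = a'" "Cod A' k = FO v' x"
          using ZE[OF zz(1)] by blast
        obtain x' k' l' where z': "z' = upair (utriple x' (Cmp A (FA v k') f1) l') k'" "k' \<in> Ar A'" "Dom A' k' = a'" "Cod A' k' = FO v' x'"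
          using ZE[OF zz(2)] by blast
        have "Cmp A (FA v (FA v' h)) (Cmp A (FA v k) f1) = Cmp A (FA v (Cmp A' (FA v' h) k)) f1"
          if "h \<in> Ar A''" "Dom A'' h = x"
          using that z y' by simp
        then show ?thesis
          unfolding z(1) z'(1) by (auto simp: under_hom_def H.in_fact_hom E.in_fact_hom)
      qed
      have "aspherical W (mk_cat ?Z ?L (\<lambda>s. ?i (ufst s)) (Cmp A'')) \<longleftrightarrow>
          aspherical W (mk_cat (fact_obj E.the_sq a' b g1) (fact_hom E.the_sq) ?i (Cmp A''))"
      proof (rule aspherical_mk_iff_of_surj_ff[where \<phi> = ?\<psi> and \<kappa> = "\<lambda>h. h"])
        show "functordata ?Z ?L (\<lambda>s. ?i (ufst s)) (Cmp A'') (fact_obj E.the_sq a' b g1) (fact_hom E.the_sq) ?i (Cmp A'') ?\<psi> (\<lambda>h. h)"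
        proof
          fix z assume "z \<in> ?Z"
          from ZE[OF this] show "?\<psi> z \<in> fact_obj E.the_sq a' b g1"
            by (elim exE conjE) (simp add: E.in_fact_obj)
        qed (simp_all add: hom)
        fix t assume t: "t \<in> fact_obj E.the_sq a' b g1"
        then obtain x h k where "t = utriple x h k" by (rule E.fact_objE)
        with mem[of x h k] t show "\<exists>z\<in>?Z. ?\<psi> z = t" by force
      qed (auto simp: hom)
      moreover have "aspherical W (factorization_cat E.the_sq a' b g1)"
        using assms(2) y' * unfolding E u1 E.exact_iff by simp
      ultimately show "aspherical W (mk_cat ?Z ?L (\<lambda>s. ?i (ufst s)) (Cmp A''))"
        unfolding E.fact_cat_eq by simp
    qed
    moreover have "aspherical W (factorization_cat D.the_sq a (FO w' b) g)"
      using assms(1) * unfolding D D.exact_iff by simp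
    ultimately show "aspherical W (factorization_cat H.the_sq a b g)"
      unfolding H.fact_cat_eq D.fact_cat_eq by simp
  qed
qed

end

section \<open>Invariance under isomorphism of squares\<close>

lemma iso_func_bij:
  assumes "is_iso_func F" "ftor C D F"
  shows "inj_on (FO F) (Ob C)" "y \<in> Ob D \<Longrightarrow> \<exists>x\<in>Ob C. FO F x = y"
    "inj_on (FA F) (Ar C)" "k \<in> Ar D \<Longrightarrow> \<exists>f\<in>Ar C. FA F f = k"
proof -
  interpret ftor C D F by fact
  obtain G where G: "is_functor G" "Src G = D" "Trg G = C" "cmp_func G F = id_func C" "cmp_func F G = id_func D"
    using assms(1) unfolding is_iso_func_def Src Trg by blast
  interpret G: ftor D C G using G by (simp add: ftor_iff)
  have GF: "FO G (FO F x) = x" if "x \<in> Ob C" for x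
    using arg_cong[OF G(4), of "\<lambda>H. FO H x"] that by simp
  have FG: "FO F (FO G x) = x" if "x \<in> Ob D" for x
    using arg_cong[OF G(5), of "\<lambda>H. FO H x"] that by simp
  have GFA: "FA G (FA F x) = x" if "x \<in> Ar C" for x
    using arg_cong[OF G(4), of "\<lambda>H. FA H x"] that by simp
  have FGA: "FA F (FA G x) = x" if "x \<in> Ar D" for x
    using arg_cong[OF G(5), of "\<lambda>H. FA H x"] that by simp
  show "inj_on (FO F) (Ob C)" using GF by (rule inj_on_inverseI)
  show "inj_on (FA F) (Ar C)" using GFA by (rule inj_on_inverseI)
  show "\<exists>x\<in>Ob C. FO F x = y" if "y \<in> Ob D"
    using FG[OF that] G.FO_in[OF that] by blast
  show "\<exists>f\<in>Ar C. FA F f = k" if "k \<in> Ar D"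
    using FGA[OF that] G.FA_in[OF that] by blast
qed

lemma cmp_func_eqD:
  assumes "cmp_func G F = cmp_func G' F'" "ftor A B F" "ftor A B' F'"
  shows "x \<in> Ob A \<Longrightarrow> FO G (FO F x) = FO G' (FO F' x)" "f \<in> Ar A \<Longrightarrow> FA G (FA F f) = FA G' (FA F' f)"
  using arg_cong[OF assms(1), of "\<lambda>H. FO H x"] arg_cong[OF assms(1), of "\<lambda>H. FA H f"] assms(2,3)
  by (simp_all add: ftor_iff)

context localizer
begin

text \<open>Applying \<open>p'\<close>, \<open>p\<close> and \<open>q'\<close> slotwise sends
  factorizations of \<open>g0\<close> to factorizations of its image under \<open>q\<close>.
  Bijectivity of the four isomorphisms makes this surjective on objects and fully faithful.\<close>

lemma exact_iso:
  assumes D: "exact_square W D" and E: "is_square E" and iso: "square_iso D E"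
  shows "exact_square W E"
proof -
  obtain A B A' B' v w u' u \<alpha> where D_eq: "D = \<lparr>Top = v, Bot = w, Lft = u', Rgt = u, Cell = \<alpha>\<rparr>"
    and sqD: "sq A B A' B' v w u' u \<alpha>"
    using D[unfolded exact_square_def, THEN conjunct1] by (rule is_squareE)
  obtain C X C' X' s t s' r \<beta> where E_eq: "E = \<lparr>Top = s, Bot = t, Lft = s', Rgt = r, Cell = \<beta>\<rparr>"
    and sqE: "sq C X C' X' s t s' r \<beta>"
    using E by (rule is_squareE)
  interpret D: sq A B A' B' v w u' u \<alpha> by fact
  interpret E: sq C X C' X' s t s' r \<beta> by fact
  obtain p q p' q' where iso': "is_iso_func p" "is_iso_func q" "is_iso_func p'" "is_iso_func q'"
    and st: "Src p = A" "Trg p = C" "Src q = B" "Trg q = X" "Src p' = A'" "Trg p' = C'" "Src q' = B'" "Trg q' = X'"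
    and cmp: "cmp_func p v = cmp_func s p'" "cmp_func q w = cmp_func t q'"
       "cmp_func q' u' = cmp_func s' p'" "cmp_func q u = cmp_func r p"
    and cell: "\<And>x. x \<in> Ob A' \<Longrightarrow> FA q (\<alpha> x) = \<beta> (FO p' x)"
    using iso unfolding square_iso_def D_eq E_eq by auto
  have ft: "ftor A C p" "ftor B X q" "ftor A' C' p'" "ftor B' X' q'"
    using iso' st by (simp_all add: ftor_iff is_iso_func_def)
  interpret p: ftor A C p by fact
  interpret q: ftor B X q by fact
  interpret p': ftor A' C' p' by fact
  interpret q': ftor B' X' q' by fact
  note bp = iso_func_bij[OF iso'(1) ft(1)] and bq = iso_func_bij[OF iso'(2) ft(2)]
    and bp' = iso_func_bij[OF iso'(3) ft(3)] and bq' = iso_func_bij[OF iso'(4) ft(4)]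
  \<comment> \<open>The equations are oriented so that data of \<open>E\<close> at transported
    elements become transported data of \<open>D\<close>; the isomorphism is then outermost and can
    be cancelled by injectivity.\<close>
  note push = cmp_func_eqD[OF cmp(1) D.v.ftor_axioms ft(3), symmetric]
    cmp_func_eqD[OF cmp(2) D.w.ftor_axioms ft(4), symmetric]
    cmp_func_eqD[OF cmp(3) D.u'.ftor_axioms ft(3), symmetric]
    cmp_func_eqD[OF cmp(4) D.u.ftor_axioms ft(1), symmetric] cell[symmetric]
  show ?thesis
    unfolding E_eq E.exact_iff
  proof (intro allI impI)
    fix a b g assume *: "a \<in> Ob C \<and> b \<in> Ob X' \<and> g \<in> Ar X \<and> Dom X g = FO r a \<and> Cod X g = FO t b"
    obtain a0 where a0: "a0 \<in> Ob A" "a = FO p a0" using * bp(2)[of a] by blast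
    obtain b0 where b0: "b0 \<in> Ob B'" "b = FO q' b0" using * bq'(2)[of b] by blast
    obtain g0 where g0: "g0 \<in> Ar B" "g = FA q g0" using * bq(4)[of g] by blast
    have "FO q (Dom B g0) = FO q (FO u a0)" "FO q (Cod B g0) = FO q (FO w b0)"
      using * a0 b0 g0 by (simp_all add: push)
    then have g0': "Dom B g0 = FO u a0" "Cod B g0 = FO w b0"
      using bq(1) g0 a0 b0 by (simp_all add: inj_on_eq_iff)
    let ?X = "fact_obj D.the_sq a0 b0 g0" and ?H = "fact_hom D.the_sq" and ?i = "\<lambda>x. Idn A' (p1 x)"
    let ?Y = "fact_obj E.the_sq a b g" and ?K = "fact_hom E.the_sq" and ?j = "\<lambda>x. Idn C' (p1 x)"
    let ?\<phi> = "\<lambda>z. utriple (FO p' (p1 z)) (FA p (p2 z)) (FA q' (p3 z))"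
    interpret X: catdata ?X ?H ?i "Cmp A'" by (rule D.catdata_fact)
    interpret Y: catdata ?Y ?K ?j "Cmp C'" by (rule E.catdata_fact)
    have "aspherical W (mk_cat ?X ?H ?i (Cmp A')) \<longleftrightarrow> aspherical W (mk_cat ?Y ?K ?j (Cmp C'))"
    proof (rule aspherical_mk_iff_of_surj_ff[where \<phi> = ?\<phi> and \<kappa> = "FA p'"])
      show "functordata ?X ?H ?i (Cmp A') ?Y ?K ?j (Cmp C') ?\<phi> (FA p')"
      proof
        fix z assume z: "z \<in> ?X"
        then obtain x f m where z': "z = utriple x f m" "x \<in> Ob A'" "f \<in> Ar A" "Dom A f = a0" "Cod A f = FO v x"
          "m \<in> Ar B'" "Dom B' m = FO u' x" "Cod B' m = b0" "Cmp B (FA w m) (Cmp B (\<alpha> x) (FA u f)) = g0"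
          by (rule D.fact_objE)
        have "Cmp X (FA q (FA w m)) (Cmp X (FA q (\<alpha> x)) (FA q (FA u f))) = g"
          unfolding g0(2) z'(9)[symmetric] using z'(1-8) by simp
        then show "?\<phi> z \<in> ?Y"
          using z'(1-8) a0 b0 by (simp add: E.in_fact_obj push)
        show "FA p' (?i z) = ?j (?\<phi> z)"
          using z' by simp
        fix y h assume y: "y \<in> ?X" and h: "h \<in> ?H z y"
        from y obtain x' f' m' where y': "y = utriple x' f' m'" "x' \<in> Ob A'" "m' \<in> Ar B'" "Dom B' m' = FO u' x'"
          by (rule D.fact_objE)
        from h have h': "h \<in> Ar A'" "Dom A' h = x" "Cod A' h = x'" "f' = Cmp A (FA v h) f" "m = Cmp B' m' (FA u' h)"
          unfolding z'(1) y'(1) D.in_fact_hom by auto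
        show "FA p' h \<in> ?K (?\<phi> z) (?\<phi> y)"
          using z'(1-5) y' h' by (simp add: E.in_fact_hom push)
      qed (simp add: fact_hom_def hom_def)
    next
      fix y assume "y \<in> ?Y"
      then obtain y0 k l where y: "y = utriple y0 k l" "y0 \<in> Ob C'" "k \<in> Ar C" "Dom C k = a" "Cod C k = FO s y0"
        "l \<in> Ar X'" "Dom X' l = FO s' y0" "Cod X' l = b" "Cmp X (FA t l) (Cmp X (\<beta> y0) (FA r k)) = g"
        by (rule E.fact_objE)
      obtain x where x: "x \<in> Ob A'" "y0 = FO p' x" using y(2) bp'(2)[of y0] by blast
      obtain f where f: "f \<in> Ar A" "k = FA p f" using y(3) bp(4)[of k] by blast
      obtain m where m: "m \<in> Ar B'" "l = FA q' m" using y(6) bq'(4)[of l] by blast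
      have "FO p (Dom A f) = FO p a0" "FO p (Cod A f) = FO p (FO v x)"
        using x f a0 y(4,5) by (simp_all add: push)
      then have f': "Dom A f = a0" "Cod A f = FO v x"
        using bp(1) f x a0 by (simp_all add: inj_on_eq_iff)
      have "FO q' (Dom B' m) = FO q' (FO u' x)" "FO q' (Cod B' m) = FO q' b0"
        using x m b0 y(7,8) by (simp_all add: push)
      then have m': "Dom B' m = FO u' x" "Cod B' m = b0"
        using bq'(1) m x b0 by (simp_all add: inj_on_eq_iff)
      have "FA q (Cmp B (FA w m) (Cmp B (\<alpha> x) (FA u f))) = FA q g0"
        unfolding g0(2)[symmetric] y(9)[symmetric] x(2) f(2) m(2)
        using x(1) f(1) m(1) f' m' by (simp add: push)
      then have "Cmp B (FA w m) (Cmp B (\<alpha> x) (FA u f)) = g0"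
        by (rule inj_onD[OF bq(3)]) (use x(1) f(1) m(1) f' m' g0(1) in simp_all)
      then have "utriple x f m \<in> ?X"
        using x(1) f(1) m(1) f' m' by (simp add: D.in_fact_obj)
      then show "\<exists>z\<in>?X. ?\<phi> z = y"
        using x(2) f(2) m(2) y(1) by (intro bexI[of _ "utriple x f m"]) simp_all
    next
      fix z y k assume z: "z \<in> ?X" and y: "y \<in> ?X" and k: "k \<in> ?K (?\<phi> z) (?\<phi> y)"
      from z obtain x f m where z': "z = utriple x f m" "x \<in> Ob A'" "f \<in> Ar A" "Cod A f = FO v x"
        "m \<in> Ar B'" by (rule D.fact_objE)
      from y obtain x' f' m' where y': "y = utriple x' f' m'" "x' \<in> Ob A'" "f' \<in> Ar A" "m' \<in> Ar B'"
        "Dom B' m' = FO u' x'" by (rule D.fact_objE)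
      from k have k': "k \<in> Ar C'" "Dom C' k = FO p' x" "Cod C' k = FO p' x'"
        "Cmp C (FA s k) (FA p f) = FA p f'" "Cmp X' (FA q' m') (FA s' k) = FA q' m"
        unfolding z'(1) y'(1) E.in_fact_hom by simp_all
      obtain h where h: "h \<in> Ar A'" "k = FA p' h" using k'(1) bp'(4)[of k] by blast
      have "FO p' (Dom A' h) = FO p' x" "FO p' (Cod A' h) = FO p' x'"
        using k' h by simp_all
      then have h': "Dom A' h = x" "Cod A' h = x'"
        using bp'(1) h z' y' by (simp_all add: inj_on_eq_iff)
      have eqs: "FA p (Cmp A (FA v h) f) = FA p f'" "FA q' (Cmp B' m' (FA u' h)) = FA q' m"
        using k'(4,5)[unfolded h(2)] h(1) h' z' y' by (simp_all add: push)
      have "Cmp A (FA v h) f = f'"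
        by (rule inj_onD[OF bp(3) eqs(1)]) (use h(1) h' z' y' in simp_all)
      moreover have "Cmp B' m' (FA u' h) = m"
        by (rule inj_onD[OF bq'(3) eqs(2)]) (use h(1) h' z' y' in simp_all)
      ultimately have "h \<in> ?H z y" using h(1) h' z'(1) y'(1) by (simp add: D.in_fact_hom)
      moreover have "h1 = h" if "h1 \<in> ?H z y \<and> FA p' h1 = k" for h1
      proof -
        have "h1 \<in> Ar A'" using that by (simp add: fact_hom_def hom_def)
        then show ?thesis using that h bp'(3) by (metis inj_on_eq_iff)
      qed
      ultimately show "\<exists>!h. h \<in> ?H z y \<and> FA p' h = k" using h(2) by blast
    qed
    moreover have "aspherical W (factorization_cat D.the_sq a0 b0 g0)"
      using D a0 b0 g0 g0' unfolding D_eq D.exact_iff by simp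
    ultimately show "aspherical W (factorization_cat E.the_sq a b g)"
      unfolding D.fact_cat_eq E.fact_cat_eq by simp
  qed
qed

section \<open>Local descent for exact squares and its converse\<close>

lemma exact_local:
  assumes "is_square D" "\<And>b. b \<in> Ob (Trg (Lft D)) \<Longrightarrow> exact_square W (hcomp D (slice_square (Lft D) b))"
  shows "exact_square W D"
proof -
  obtain A B A' B' v w u' u \<alpha> where D: "D = \<lparr>Top = v, Bot = w, Lft = u', Rgt = u, Cell = \<alpha>\<rparr>"
    and sq: "sq A B A' B' v w u' u \<alpha>"
    using assms(1) by (rule is_squareE)
  interpret sq A B A' B' v w u' u \<alpha> by fact
  show ?thesis
    unfolding D exact_iff
  proof (intro allI impI)
    fix a b g assume *: "a \<in> Ob A \<and> b \<in> Ob B' \<and> g \<in> Ar B \<and> Dom B g = FO u a \<and> Cod B g = FO w b"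
    then have "exact_square W (hcomp the_sq (slice_square u' b))"
      using assms(2)[of b] by (simp add: D)
    then have "aspherical W (factorization_cat (hcomp the_sq (slice_square u' b)) a pt g)"
      using * by (simp add: exact_square_def hcomp_def slice_square_eq hom_def)
    then show "aspherical W (factorization_cat the_sq a b g)"
      using aspherical_factorization_hcomp_slice[OF sq] * by blast
  qed
qed

text \<open>The converse of descent, on which the reduction to generators rests. The lower left
  corner of the composite has the single object \<open>pt\<close>, so only the factorization
  categories of \<open>D\<close> at \<open>b\<close> enter.\<close>

lemma exact_hcomp_slice:
  assumes "exact_square W D" "b \<in> Ob (Trg (Lft D))"
  shows "exact_square W (hcomp D (slice_square (Lft D) b))"
proof -
  obtain A B A' B' v w u' u \<alpha> where D: "D = \<lparr>Top = v, Bot = w, Lft = u', Rgt = u, Cell = \<alpha>\<rparr>"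
    and sq: "sq A B A' B' v w u' u \<alpha>"
    using assms(1)[unfolded exact_square_def, THEN conjunct1] by (rule is_squareE)
  interpret sq A B A' B' v w u' u \<alpha> by fact
  have b: "b \<in> Ob B'" using assms(2) by (simp add: D)
  interpret S: sq A' B' "slice u' b" one_cat "slice_forget u' b" "ob_func B' b" "to_one (slice u' b)" u' "\<lambda>x\<in>Ob (slice u' b). usnd x"
    using b by (rule u'.sq_slice)
  have "is_square (hcomp the_sq (slice_square u' b))"
    using sq.is_square[OF sq_hcomp[OF sq S.sq_axioms]] by (simp add: hcomp_def slice_square_eq)
  then show ?thesis
    using assms(1) b aspherical_factorization_hcomp_slice[OF sq b] unfolding D
    by (simp add: exact_square_def hcomp_def slice_square_eq)
qed

end

section \<open>Comma squares and the generating squares\<close>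

lemma (in sq)
  shows Ob_comma: "utriple a b' g \<in> Ob (comma u w) \<longleftrightarrow> a \<in> Ob A \<and> b' \<in> Ob B' \<and> g \<in> Ar B \<and> Dom B g = FO u a \<and> Cod B g = FO w b'"
    and Ar_comma: "utriple (utriple a b g) (upair f h) (utriple a' b' g') \<in> Ar (comma u w) \<longleftrightarrow>
      utriple a b g \<in> Ob (comma u w) \<and> utriple a' b' g' \<in> Ob (comma u w) \<and> f \<in> hom A a a' \<and> h \<in> hom B' b b' \<and>
      Cmp B g' (FA u f) = Cmp B (FA w h) g"
  by (auto simp: comma_def Let_def hom_def)

text \<open>These are the one- and two-dimensional lifting properties of a comma object, read off
  from bijectivity of the canonical functor. Since arrows of \<open>comma\<close> carry their
  endpoints, bijectivity on arrows gives unique lifts with prescribed source and target.\<close>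

lemma (in sq) comma_squareD:
  assumes "comma_square the_sq"
  shows "a \<in> Ob A \<Longrightarrow> b' \<in> Ob B' \<Longrightarrow> g \<in> Ar B \<Longrightarrow> Dom B g = FO u a \<Longrightarrow> Cod B g = FO w b' \<Longrightarrow>
      \<exists>x\<in>Ob A'. FO v x = a \<and> FO u' x = b' \<and> \<alpha> x = g"
    and "x \<in> Ob A' \<Longrightarrow> y \<in> Ob A' \<Longrightarrow> f \<in> Ar A \<Longrightarrow> Dom A f = FO v x \<Longrightarrow> Cod A f = FO v y \<Longrightarrow>
      h \<in> Ar B' \<Longrightarrow> Dom B' h = FO u' x \<Longrightarrow> Cod B' h = FO u' y \<Longrightarrow>
      Cmp B (\<alpha> y) (FA u f) = Cmp B (FA w h) (\<alpha> x) \<Longrightarrow>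
      \<exists>!k. k \<in> Ar A' \<and> Dom A' k = x \<and> Cod A' k = y \<and> FA v k = f \<and> FA u' k = h"
proof -
  let ?K = "comma_canonical the_sq"
  have iso: "is_iso_func ?K" using assms by (simp add: comma_square_def)
  then have ft: "ftor A' (comma u w) ?K"
    by (simp add: ftor_iff is_iso_func_def comma_canonical_def Let_def)
  interpret K: ftor A' "comma u w" ?K by fact
  note bij = iso_func_bij[OF iso ft]
  have FO: "FO ?K x = utriple (FO v x) (FO u' x) (\<alpha> x)" if "x \<in> Ob A'" for x
    using that by (simp add: comma_canonical_def Let_def)
  have FA: "FA ?K k = utriple (FO ?K (Dom A' k)) (upair (FA v k) (FA u' k)) (FO ?K (Cod A' k))" if "k \<in> Ar A'" for k
    using that by (simp add: comma_canonical_def Let_def)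
  show "\<exists>x\<in>Ob A'. FO v x = a \<and> FO u' x = b' \<and> \<alpha> x = g"
    if "a \<in> Ob A" "b' \<in> Ob B'" "g \<in> Ar B" "Dom B g = FO u a" "Cod B g = FO w b'"
  proof -
    have "utriple a b' g \<in> Ob (comma u w)" using that by (simp add: Ob_comma)
    from bij(2)[OF this] show ?thesis using FO by auto
  qed
  show "\<exists>!k. k \<in> Ar A' \<and> Dom A' k = x \<and> Cod A' k = y \<and> FA v k = f \<and> FA u' k = h"
    if xy: "x \<in> Ob A'" "y \<in> Ob A'" "f \<in> Ar A" "Dom A f = FO v x" "Cod A f = FO v y"
      "h \<in> Ar B'" "Dom B' h = FO u' x" "Cod B' h = FO u' y" "Cmp B (\<alpha> y) (FA u f) = Cmp B (FA w h) (\<alpha> x)"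
  proof -
    let ?t = "utriple (FO ?K x) (upair f h) (FO ?K y)"
    have "?t \<in> Ar (comma u w)"
      using xy by (simp add: FO Ar_comma Ob_comma hom_def)
    from bij(4)[OF this] obtain k where k: "k \<in> Ar A'" "FA ?K k = ?t" by blast
    then have "FO ?K (Dom A' k) = FO ?K x" "FO ?K (Cod A' k) = FO ?K y" "FA v k = f" "FA u' k = h"
      unfolding FA[OF k(1)] by simp_all
    moreover from this(1,2) have "Dom A' k = x" "Cod A' k = y"
      using inj_onD[OF bij(1)] k(1) xy(1,2) v.A.dom_in v.A.cod_in by blast+
    moreover have "k' = k" if "k' \<in> Ar A' \<and> Dom A' k' = x \<and> Cod A' k' = y \<and> FA v k' = f \<and> FA u' k' = h" for k'
    proof (rule inj_onD[OF bij(3)])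
      show "FA ?K k' = FA ?K k" using that k(2) FA[of k'] by simp
    qed (use that k in simp_all)
    ultimately show ?thesis using k(1) by blast
  qed
qed

context localizer
begin

text \<open>The factorization category maps to the category \<open>?Y\<close> of factorizations of \<open>g\<close> through the image of \<open>w\<close>,
  which has a terminal object; in a comma square the categories under its objects have initial objects.\<close>

lemma exact_comma:
  assumes "comma_square D"
  shows "exact_square W D"
proof -
  obtain A B A' B' v w u' u \<alpha> where D: "D = \<lparr>Top = v, Bot = w, Lft = u', Rgt = u, Cell = \<alpha>\<rparr>"
    and sq: "sq A B A' B' v w u' u \<alpha>"
    using assms[unfolded comma_square_def, THEN conjunct1] by (rule is_squareE)
  interpret sq A B A' B' v w u' u \<alpha> by fact
  note comma = comma_squareD[OF assms[unfolded D]]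
  show ?thesis
    unfolding D exact_iff
  proof (intro allI impI)
    fix a b g assume *: "a \<in> Ob A \<and> b \<in> Ob B' \<and> g \<in> Ar B \<and> Dom B g = FO u a \<and> Cod B g = FO w b"
    let ?X = "fact_obj the_sq a b g" and ?H = "fact_hom the_sq" and ?i = "\<lambda>x. Idn A' (p1 x)"
    let ?Y = "{utriple b1 q h | b1 q h. b1 \<in> Ob B' \<and> q \<in> hom B' b1 b \<and> h \<in> hom B (FO u a) (FO w b1) \<and> Cmp B (FA w q) h = g}"
    let ?K = "\<lambda>y z. {r \<in> hom B' (p1 y) (p1 z). Cmp B' (p2 z) r = p2 y \<and> Cmp B (FA w r) (p3 y) = p3 z}"
    let ?j = "\<lambda>y. Idn B' (p1 y)"
    let ?\<phi> = "\<lambda>s. utriple (FO u' (p1 s)) (p3 s) (Cmp B (\<alpha> (p1 s)) (FA u (p2 s)))"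
    interpret X: catdata ?X ?H ?i "Cmp A'" by (rule catdata_fact)
    have YE: "\<exists>b1 q h. y = utriple b1 q h \<and> b1 \<in> Ob B' \<and> q \<in> Ar B' \<and> Dom B' q = b1 \<and> Cod B' q = b \<and>
        h \<in> Ar B \<and> Dom B h = FO u a \<and> Cod B h = FO w b1 \<and> g = Cmp B (FA w q) h" if "y \<in> ?Y" for y
      using that by (auto simp: hom_def)
    have Y: "catdata ?Y ?K ?j (Cmp B')"
    proof
      show "small_set ?Y"
        by (rule small_utriples[OF w.A.small_Ob w.A.small_Ar w.B.small_Ar]) (auto simp: hom_def)
      fix x y z t e f k
      show "small_set (?K x y)"
        by (rule small_subset[OF w.A.small_Ar]) (auto simp: hom_def)
      assume x: "x \<in> ?Y"
      from YE[OF x] show "?j x \<in> ?K x x" by (auto simp: hom_def)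
      assume y: "y \<in> ?Y" and e: "e \<in> ?K x y"
      show "Cmp B' e (?j x) = e" "Cmp B' (?j y) e = e" using e by (simp_all add: hom_def)
      assume z: "z \<in> ?Y" and f: "f \<in> ?K y z"
      from YE[OF x] obtain b1 q1 h1 where x': "x = utriple b1 q1 h1" "h1 \<in> Ar B" "Cod B h1 = FO w b1" by blast
      from YE[OF z] obtain b2 q2 h2 where z': "z = utriple b2 q2 h2" "q2 \<in> Ar B'" "Dom B' q2 = b2" by blast
      have e': "e \<in> Ar B'" "Dom B' e = b1" "Cod B' e = p1 y" "q1 = Cmp B' (p2 y) e" "p3 y = Cmp B (FA w e) h1"
        using e x'(1) by (simp_all add: hom_def)
      have f': "f \<in> Ar B'" "Dom B' f = p1 y" "Cod B' f = b2" "p2 y = Cmp B' q2 f" "h2 = Cmp B (FA w f) (p3 y)"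
        using f z'(1) by (simp_all add: hom_def)
      show "Cmp B' f e \<in> ?K x z"
        using e' f' x' z' by (simp add: hom_def)
      assume "t \<in> ?Y" "k \<in> ?K z t"
      then show "Cmp B' (Cmp B' k f) e = Cmp B' k (Cmp B' f e)"
        using e f by (simp add: hom_def)
    qed
    interpret Y: catdata ?Y ?K ?j "Cmp B'" by (rule Y)
    have F: "functordata ?X ?H ?i (Cmp A') ?Y ?K ?j (Cmp B') ?\<phi> (FA u')"
    proof
      fix s assume s: "s \<in> ?X"
      then obtain x f q where s': "s = utriple x f q" "x \<in> Ob A'" "f \<in> Ar A" "Dom A f = a" "Cod A f = FO v x"
        "q \<in> Ar B'" "Dom B' q = FO u' x" "Cod B' q = b" "Cmp B (FA w q) (Cmp B (\<alpha> x) (FA u f)) = g"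
        by (rule fact_objE)
      then show "?\<phi> s \<in> ?Y" by (simp add: hom_def)
      show "FA u' (?i s) = ?j (?\<phi> s)" using s' by simp
      fix t h assume t: "t \<in> ?X" and h: "h \<in> ?H s t"
      obtain y f' q' where t': "t = utriple y f' q'" using t by (rule fact_objE)
      have h': "h \<in> Ar A'" "Dom A' h = x" "Cod A' h = y" "f' = Cmp A (FA v h) f" "q = Cmp B' q' (FA u' h)"
        using h unfolding s'(1) t' in_fact_hom by auto
      have "Cmp B (\<alpha> y) (Cmp B (FA u (FA v h)) (FA u f)) = Cmp B (FA w (FA u' h)) (Cmp B (\<alpha> x) (FA u f))"
        using natural'[of h "FA u f"] h' s' by simp
      then show "FA u' h \<in> ?K (?\<phi> s) (?\<phi> t)"
        using s'(1-5) t' h' by (simp add: hom_def)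
    qed (simp add: fact_hom_def hom_def)
    have "aspherical W (mk_cat ?X ?H ?i (Cmp A')) \<longleftrightarrow> aspherical W (mk_cat ?Y ?K ?j (Cmp B'))"
    proof (rule aspherical_mk_iff_of_under[OF F])
      fix y assume y: "y \<in> ?Y"
      from YE[OF y] obtain b1 q1 h1 where y': "y = utriple b1 q1 h1" "b1 \<in> Ob B'" "q1 \<in> Ar B'" "Dom B' q1 = b1" "Cod B' q1 = b"
        "h1 \<in> Ar B" "Dom B h1 = FO u a" "Cod B h1 = FO w b1" "g = Cmp B (FA w q1) h1" by blast
      obtain c where c: "c \<in> Ob A'" "FO v c = a" "FO u' c = b1" "\<alpha> c = h1"
        using comma(1)[of a b1 h1] * y' by blast
      \<comment> \<open>The object \<open>c\<close> represents the triple
        \<open>(a, b1, h1)\<close>, so identities fill the remaining places. An arrow from here to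
        \<open>z\<close> is a lift of the pair \<open>(f, r)\<close>, and \<open>comma(2)\<close>
        provides exactly one.\<close>
      let ?s = "upair (utriple c (Idn A a) q1) (Idn B' b1)"
      show "aspherical W (under_cat ?X ?H ?i (Cmp A') ?K (Cmp B') ?\<phi> (FA u') y)"
      proof (rule aspherical_mk_initial[OF functordata.catdata_under[OF F y]])
        have "utriple c (Idn A a) q1 \<in> ?X"
          using c y' * by (simp add: in_fact_obj)
        moreover have "Idn B' b1 \<in> ?K y (?\<phi> (utriple c (Idn A a) q1))"
          using c y'(1-8) * by (simp add: hom_def)
        ultimately show "?s \<in> over_obj ?X (\<lambda>x y. ?K y x) ?\<phi> y"
          unfolding over_obj_def by blast
        fix z assume "z \<in> over_obj ?X (\<lambda>x y. ?K y x) ?\<phi> y"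
        then obtain s r where z: "z = upair s r" "s \<in> ?X" "r \<in> ?K y (?\<phi> s)"
          unfolding over_obj_def by blast
        from z(2) obtain x f q where s: "s = utriple x f q" "x \<in> Ob A'" "f \<in> Ar A" "Dom A f = a" "Cod A f = FO v x"
          "q \<in> Ar B'" "Dom B' q = FO u' x" "Cod B' q = b"
          by (rule fact_objE)
        have r: "r \<in> Ar B'" "Dom B' r = b1" "Cod B' r = FO u' x" "Cmp B' q r = q1"
            "Cmp B (FA w r) h1 = Cmp B (\<alpha> x) (FA u f)"
          using z(3) s(1) y'(1) by (simp_all add: hom_def)
        have "\<exists>!k. k \<in> Ar A' \<and> Dom A' k = c \<and> Cod A' k = x \<and> FA v k = f \<and> FA u' k = r"
          using c s r by (intro comma(2)) simp_all
        moreover have "k \<in> under_hom ?H (Cmp B') (FA u') ?s z \<longleftrightarrow>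
            k \<in> Ar A' \<and> Dom A' k = c \<and> Cod A' k = x \<and> FA v k = f \<and> FA u' k = r" for k
        proof -
          \<comment> \<open>The identities in \<open>?s\<close> reduce the conditions on
            \<open>k\<close> to its images being \<open>f\<close> and \<open>r\<close>; the
            remaining condition, on the slot \<open>q1\<close>, is then \<open>r(4)\<close>.\<close>
          have "Cmp A (FA v k) (Idn A a) = FA v k" "Cmp B' (FA u' k) (Idn B' b1) = FA u' k"
            if "k \<in> Ar A'" "Dom A' k = c"
            using that c by simp_all
          then show ?thesis
            unfolding z(1) s(1) under_hom_def mem_Collect_eq ufst_upair usnd_upair in_fact_hom
            using r(4) by metis
        qed
        ultimately show "\<exists>!k. k \<in> under_hom ?H (Cmp B') (FA u') ?s z" by simp
      qed
    qed
    moreover have "aspherical W (mk_cat ?Y ?K ?j (Cmp B'))"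
    proof (rule aspherical_mk_terminal[OF Y])
      \<comment> \<open>The trivial factorization is terminal, because an arrow to it has to be the
        slot \<open>q\<close>.\<close>
      show "utriple b (Idn B' b) g \<in> ?Y" using * by (simp add: hom_def)
      fix y assume "y \<in> ?Y"
      from YE[OF this] obtain b1 q h where y': "y = utriple b1 q h" "q \<in> Ar B'" "Dom B' q = b1" "Cod B' q = b"
        "g = Cmp B (FA w q) h" by blast
      show "\<exists>!r. r \<in> ?K y (utriple b (Idn B' b) g)"
      proof (rule ex1I[of _ q])
        show "q \<in> ?K y (utriple b (Idn B' b) g)" using y' by (simp add: hom_def)
        show "r = q" if "r \<in> ?K y (utriple b (Idn B' b) g)" for r
          using that y'(1) by (auto simp: hom_def)
      qed
    qed
    ultimately show "aspherical W (factorization_cat the_sq a b g)"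
      unfolding fact_cat_eq by simp
  qed
qed

text \<open>The outer slots of a factorization lie in \<open>e\<close>, so the only factorization
  category is \<open>C\<close> itself up to encoding.\<close>

lemma exact_aspherical:
  assumes "is_square D" "aspherical W C" "Top D = to_one C" "Lft D = to_one C"
    "Rgt D = id_func one_cat" "Bot D = id_func one_cat"
  shows "exact_square W D"
proof -
  obtain A B A' B' v w u' u \<alpha> where D: "D = \<lparr>Top = v, Bot = w, Lft = u', Rgt = u, Cell = \<alpha>\<rparr>"
    and sq: "sq A B A' B' v w u' u \<alpha>"
    using assms(1) by (rule is_squareE)
  have e: "v = to_one C" "u' = to_one C" "u = id_func one_cat" "w = id_func one_cat"
    using assms(3-6) by (simp_all add: D)
  have "ftor A' B' u'" "ftor A B u" using sq by (simp_all add: sq_def)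
  then have "A' = C" "B' = one_cat" "A = one_cat" "B = one_cat" by (simp_all add: ftor_iff e)
  with sq e have sq: "sq one_cat one_cat C one_cat (to_one C) (id_func one_cat) (to_one C) (id_func one_cat) \<alpha>" by simp
  interpret sq one_cat one_cat C one_cat "to_one C" "id_func one_cat" "to_one C" "id_func one_cat" \<alpha> by fact
  have C: "scat C" by unfold_locales
  have \<alpha>: "\<alpha> x = pt" if "x \<in> Ob C" for x using \<alpha>_in[OF that] by simp
  have D: "D = the_sq" by (simp add: D e)
  show ?thesis
    unfolding D exact_iff
  proof (intro allI impI)
    fix a b g :: 'u assume "a \<in> Ob one_cat \<and> b \<in> Ob one_cat \<and> g \<in> Ar one_cat \<and>
      Dom one_cat g = FO (id_func one_cat) a \<and> Cod one_cat g = FO (id_func one_cat) b"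
    then have pt: "a = pt" "b = pt" "g = pt" by simp_all
    let ?X = "fact_obj the_sq pt pt pt" and ?H = "fact_hom the_sq" and ?i = "\<lambda>x. Idn C (p1 x)"
    interpret X: catdata ?X ?H ?i "Cmp C" by (rule catdata_fact)
    interpret Y: catdata "Ob C" "hom C" "Idn C" "Cmp C" by (rule scat.catdata[OF C])
    have XE: "x = utriple (p1 x) pt pt" "p1 x \<in> Ob C" if "x \<in> ?X" for x
      using that by (auto elim: fact_objE)
    have X: "utriple x pt pt \<in> ?X" if "x \<in> Ob C" for x
      using that by (simp add: in_fact_obj \<alpha>)
    have H: "h \<in> ?H x y \<longleftrightarrow> h \<in> hom C (p1 x) (p1 y)" if "x \<in> ?X" "y \<in> ?X" for x y h
      by (subst XE(1)[OF that(1)], subst XE(1)[OF that(2)]) (auto simp: in_fact_hom hom_def)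
    have "aspherical W (mk_cat ?X ?H ?i (Cmp C)) \<longleftrightarrow> aspherical W (mk_cat (Ob C) (hom C) (Idn C) (Cmp C))"
    proof (rule aspherical_mk_iff_of_surj_ff[where \<phi> = p1 and \<kappa> = "\<lambda>h. h"])
      show "functordata ?X ?H ?i (Cmp C) (Ob C) (hom C) (Idn C) (Cmp C) p1 (\<lambda>h. h)"
        by unfold_locales (simp_all add: XE H)
      show "\<exists>x\<in>?X. p1 x = c" if "c \<in> Ob C" for c
        using X[OF that] by (intro bexI[of _ "utriple c pt pt"]) simp_all
    qed (auto simp: H)
    then show "aspherical W (factorization_cat the_sq a b g)"
      using assms(2) aspherical_mk_hom_iff[OF C] unfolding fact_cat_eq pt by simp
  qed
qed

end

section \<open>Generation of the exact squares\<close>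

context sq
begin

lemma in_comma_hom: "t \<in> Ar (comma u w) \<Longrightarrow> \<exists>x f h y. t = utriple x (upair f h) y \<and> x \<in> Ob (comma u w) \<and> y \<in> Ob (comma u w) \<and>
    f \<in> hom A (p1 x) (p1 y) \<and> h \<in> hom B' (p2 x) (p2 y) \<and> Cmp B (p3 y) (FA u f) = Cmp B (FA w h) (p3 x)"
  by (auto simp: comma_def Let_def hom_def elim!: Ar_mk_catE)

lemma scat_comma: "scat (comma u w)"
proof -
  let ?X = "{utriple a b' g | a b' g. a \<in> Ob A \<and> b' \<in> Ob B' \<and> g \<in> hom B (FO u a) (FO w b')}"
  let ?H = "\<lambda>x y. {upair f g' | f g'. f \<in> hom A (p1 x) (p1 y) \<and> g' \<in> hom B' (p2 x) (p2 y) \<and>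
                 Cmp B (p3 y) (FA u f) = Cmp B (FA w g') (p3 x)}"
  let ?i = "\<lambda>x. upair (Idn A (p1 x)) (Idn B' (p2 x))"
  let ?m = "\<lambda>s t. upair (Cmp A (ufst s) (ufst t)) (Cmp B' (usnd s) (usnd t))"
  have XE: "\<exists>a b g. x = utriple a b g \<and> a \<in> Ob A \<and> b \<in> Ob B' \<and> g \<in> Ar B \<and> Dom B g = FO u a \<and> Cod B g = FO w b"
    if "x \<in> ?X" for x
    using that by (auto simp: hom_def)
  have HE: "\<exists>f h. k = upair f h \<and> f \<in> Ar A \<and> Dom A f = p1 x \<and> Cod A f = p1 y \<and> h \<in> Ar B' \<and> Dom B' h = p2 x \<and> Cod B' h = p2 y \<and>
      Cmp B (p3 y) (FA u f) = Cmp B (FA w h) (p3 x)" if "k \<in> ?H x y" for k x y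
    using that by (auto simp: hom_def)
  have "catdata ?X ?H ?i ?m"
  proof
    show "small_set ?X"
      by (rule small_utriples[OF v.B.small_Ob w.A.small_Ob w.B.small_Ar]) (auto simp: hom_def)
    fix x y z t k l n
    show "small_set (?H x y)"
      by (rule small_upairs[OF v.B.small_Ar w.A.small_Ar]) (auto simp: hom_def)
    assume x: "x \<in> ?X"
    from XE[OF x] show "?i x \<in> ?H x x" by (auto simp: hom_def)
    assume y: "y \<in> ?X" and k: "k \<in> ?H x y"
    obtain f h where k': "k = upair f h" "f \<in> Ar A" "Dom A f = p1 x" "Cod A f = p1 y" "h \<in> Ar B'" "Dom B' h = p2 x"
        "Cod B' h = p2 y" "Cmp B (p3 y) (FA u f) = Cmp B (FA w h) (p3 x)"
      using HE[OF k] by blast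
    show "?m k (?i x) = k" "?m (?i y) k = k" using k' by simp_all
    assume z: "z \<in> ?X" and l: "l \<in> ?H y z"
    obtain f' h' where l': "l = upair f' h'" "f' \<in> Ar A" "Dom A f' = p1 y" "Cod A f' = p1 z" "h' \<in> Ar B'" "Dom B' h' = p2 y"
        "Cod B' h' = p2 z" "Cmp B (p3 z) (FA u f') = Cmp B (FA w h') (p3 y)"
      using HE[OF l] by blast
    have p: "p3 x \<in> Ar B" "Dom B (p3 x) = FO u (p1 x)" "Cod B (p3 x) = FO w (p2 x)"
        "p3 y \<in> Ar B" "Dom B (p3 y) = FO u (p1 y)" "Cod B (p3 y) = FO w (p2 y)"
        "p3 z \<in> Ar B" "Dom B (p3 z) = FO u (p1 z)" "Cod B (p3 z) = FO w (p2 z)"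
      using XE[OF x] XE[OF y] XE[OF z] by auto
    have "Cmp B (p3 z) (Cmp B (FA u f') (FA u f)) = Cmp B (Cmp B (p3 z) (FA u f')) (FA u f)"
      using k'(2-7) l'(2-7) p by simp
    also have "\<dots> = Cmp B (FA w h') (Cmp B (p3 y) (FA u f))"
      unfolding l'(8) using k'(2-7) l'(2-7) p by simp
    also have "\<dots> = Cmp B (Cmp B (FA w h') (FA w h)) (p3 x)"
      unfolding k'(8) using k'(2-7) l'(2-7) p by simp
    finally show "?m l k \<in> ?H x z"
      using k'(1-7) l'(1-7) by (simp add: hom_def)
    assume "t \<in> ?X" "n \<in> ?H z t"
    then obtain f'' h'' where n': "n = upair f'' h''" "f'' \<in> Ar A" "Dom A f'' = p1 z" "Cod A f'' = p1 t" "h'' \<in> Ar B'" "Dom B' h'' = p2 z"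
        "Cod B' h'' = p2 t"
      using HE[of n z t] by blast
    show "?m (?m n l) k = ?m n (?m l k)"
      using k'(1-7) l'(1-7) n' by simp
  qed
  then show ?thesis
    unfolding comma_def Let_def v.Trg w.Src u.Src u.Trg
    by (simp add: scat_def catdata.small_cat_mk_cat)
qed

lemma FO_canonical: "x \<in> Ob A' \<Longrightarrow> FO (comma_canonical the_sq) x = utriple (FO v x) (FO u' x) (\<alpha> x)"
  and FA_canonical: "f \<in> Ar A' \<Longrightarrow> FA (comma_canonical the_sq) f =
     utriple (FO (comma_canonical the_sq) (Dom A' f)) (upair (FA v f) (FA u' f)) (FO (comma_canonical the_sq) (Cod A' f))"
  by (simp_all add: comma_canonical_def Let_def)

lemma Idn_comma: "x \<in> Ob (comma u w) \<Longrightarrow> Idn (comma u w) x = utriple x (upair (Idn A (p1 x)) (Idn B' (p2 x))) x"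
  by (simp add: comma_def Let_def)

lemma Dom_comma: "utriple x f y \<in> Ar (comma u w) \<Longrightarrow> Dom (comma u w) (utriple x f y) = x"
  and Cod_comma: "utriple x f y \<in> Ar (comma u w) \<Longrightarrow> Cod (comma u w) (utriple x f y) = y"
  by (simp_all add: comma_def Let_def)

lemma Cmp_comma: "utriple x f y \<in> Ar (comma u w) \<Longrightarrow> utriple y g z \<in> Ar (comma u w) \<Longrightarrow>
  Cmp (comma u w) (utriple y g z) (utriple x f y) = utriple x (upair (Cmp A (ufst g) (ufst f)) (Cmp B' (usnd g) (usnd f))) z"
  by (simp add: comma_def Let_def)

text \<open>Naturality of \<alpha> is the commutation required of arrows of
  \<open>comma u w\<close>. The functor is needed for arbitrary squares, as the comparison with
  their comma category.\<close>

lemma ftor_canonical: "ftor A' (comma u w) (comma_canonical the_sq)"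
proof -
  interpret C: scat "comma u w" by (rule scat_comma)
  have ar: "FA (comma_canonical the_sq) f \<in> Ar (comma u w)" if "f \<in> Ar A'" for f
    using that natural[OF that] by (simp add: FA_canonical FO_canonical Ar_comma Ob_comma hom_def)
  show ?thesis
  proof (rule ftorI[OF v.A.small_cat C.small_cat])
    fix f assume f: "f \<in> Ar A'"
    show "FA (comma_canonical the_sq) f \<in> Ar (comma u w)" using f by (rule ar)
    show "Dom (comma u w) (FA (comma_canonical the_sq) f) = FO (comma_canonical the_sq) (Dom A' f)"
      "Cod (comma u w) (FA (comma_canonical the_sq) f) = FO (comma_canonical the_sq) (Cod A' f)"
      using ar[OF f] unfolding FA_canonical[OF f] by (rule Dom_comma, rule Cod_comma)
    fix g assume g: "g \<in> Ar A'" "Cod A' f = Dom A' g"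
    show "FA (comma_canonical the_sq) (Cmp A' g f) = Cmp (comma u w) (FA (comma_canonical the_sq) g) (FA (comma_canonical the_sq) f)"
      using f g ar[OF f] ar[OF g(1)] by (simp add: FA_canonical Cmp_comma)
  next
    fix x assume x: "x \<in> Ob A'"
    then show "FO (comma_canonical the_sq) x \<in> Ob (comma u w)"
      by (simp add: FO_canonical Ob_comma)
    then show "FA (comma_canonical the_sq) (Idn A' x) = Idn (comma u w) (FO (comma_canonical the_sq) x)"
      using x by (simp add: Idn_comma FA_canonical FO_canonical)
  qed (simp_all add: comma_canonical_def Let_def)
qed

end

lemma (in scat) is_iso_id: "is_iso_func (id_func C)"
proof -
  interpret I: ftor C C "id_func C" by (rule ftor_id)
  have "cmp_func (id_func C) (id_func C) = id_func C"
    by (rule func_eqI[OF ftor_cmp[OF ftor_id ftor_id] ftor_id]) simp_all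
  then show ?thesis
    unfolding is_iso_func_def using I.is_functor by (intro conjI exI[of _ "id_func C"]) simp_all
qed

lemma id_one_cat: "id_func one_cat = to_one one_cat"
  by (rule to_one_unique[OF scat.ftor_id]) (unfold_locales, rule small_cat_one)

text \<open>As \<open>e\<close> is terminal, \<open>C\<close> determines the whole square. This
  recognizes generating squares among composites whose sides are written in other ways.\<close>

lemma sq_over_one:
  assumes "sq one_cat one_cat C one_cat v w u' u \<alpha>"
  shows "commutative_square \<lparr>Top = v, Bot = w, Lft = u', Rgt = u, Cell = \<alpha>\<rparr>"
    and "v = to_one C" "u' = to_one C" "u = id_func one_cat" "w = id_func one_cat"
proof -
  interpret sq one_cat one_cat C one_cat v w u' u \<alpha> by fact
  have vw: "ftor C one_cat (cmp_func u v)" "ftor C one_cat (cmp_func w u')"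
    by (rule ftor_cmp[OF v.ftor_axioms u.ftor_axioms] ftor_cmp[OF u'.ftor_axioms w.ftor_axioms])+
  have "\<alpha> = id_nat (cmp_func u v)"
  proof (rule extensionalityI[OF ext_\<alpha>])
    show "id_nat (cmp_func u v) \<in> extensional (Ob C)" by (simp add: id_nat_def)
    fix x assume x: "x \<in> Ob C"
    have "FO u (FO v x) = pt" using u.FO_in[OF v.FO_in[OF x]] by simp
    then show "\<alpha> x = id_nat (cmp_func u v) x"
      using \<alpha>_in[OF x] x by (simp add: id_nat_def)
  qed
  then show "commutative_square the_sq"
    using is_square to_one_unique[OF vw(1)] to_one_unique[OF vw(2)] by (simp add: commutative_square_def)
  show "v = to_one C" "u' = to_one C" "u = id_func one_cat" "w = id_func one_cat"
    unfolding id_one_cat by (intro to_one_unique, unfold_locales)+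
qed

section \<open>Reduction of exact squares to the generators\<close>

lemma exactness_classD:
  assumes "exactness_class W Q"
  shows "D \<in> Q \<Longrightarrow> op_square D \<in> Q"
    and "D \<in> Q \<Longrightarrow> E \<in> Q \<Longrightarrow> Rgt E = Lft D \<Longrightarrow> hcomp D E \<in> Q"
    and "is_square D \<Longrightarrow> (\<And>b. b \<in> Ob (Trg (Lft D)) \<Longrightarrow> hcomp D (slice_square (Lft D) b) \<in> Q) \<Longrightarrow> D \<in> Q"
    and "comma_square D \<Longrightarrow> D \<in> Q"
    and "commutative_square D \<Longrightarrow> aspherical W C \<Longrightarrow> Top D = to_one C \<Longrightarrow> Lft D = to_one C \<Longrightarrow>
      Rgt D = id_func one_cat \<Longrightarrow> Bot D = id_func one_cat \<Longrightarrow> D \<in> Q"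
proof -
  note c = assms[unfolded exactness_class_def, THEN conjunct2, THEN conjunct2]
  note * = c[THEN conjunct1] c[THEN conjunct2, THEN conjunct1] c[THEN conjunct2, THEN conjunct2, THEN conjunct1]
    c[THEN conjunct2, THEN conjunct2, THEN conjunct2, THEN conjunct1]
    c[THEN conjunct2, THEN conjunct2, THEN conjunct2, THEN conjunct2]
  show "D \<in> Q \<Longrightarrow> op_square D \<in> Q" using *(1) unfolding op_stable_def by blast
  show "D \<in> Q \<Longrightarrow> E \<in> Q \<Longrightarrow> Rgt E = Lft D \<Longrightarrow> hcomp D E \<in> Q" using *(2) unfolding hcomp_stable_def by blast
  show "is_square D \<Longrightarrow> (\<And>b. b \<in> Ob (Trg (Lft D)) \<Longrightarrow> hcomp D (slice_square (Lft D) b) \<in> Q) \<Longrightarrow> D \<in> Q"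
    using *(3) unfolding local_descent_def by blast
  show "comma_square D \<Longrightarrow> D \<in> Q" using *(4) by blast
  show "commutative_square D \<Longrightarrow> aspherical W C \<Longrightarrow> Top D = to_one C \<Longrightarrow> Lft D = to_one C \<Longrightarrow>
      Rgt D = id_func one_cat \<Longrightarrow> Bot D = id_func one_cat \<Longrightarrow> D \<in> Q"
    using *(5) by blast
qed

context localizer
begin

text \<open>The square is the composite of the comma square of its two objects of \<^term>\<open>B\<close>, whose upper left corner is
  the discrete category of arrows between them, with a square whose opposite is locally of the generating form.\<close>

lemma exact_in_class_one:
  assumes Q: "exactness_class W Q" and sq: "sq one_cat B X one_cat v w u' u \<alpha>"
    and exact: "exact_square W \<lparr>Top = v, Bot = w, Lft = u', Rgt = u, Cell = \<alpha>\<rparr>"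
  shows "\<lparr>Top = v, Bot = w, Lft = u', Rgt = u, Cell = \<alpha>\<rparr> \<in> Q"
proof -
  interpret sq one_cat B X one_cat v w u' u \<alpha> by fact
  let ?I = "comma u w" and ?F = "comma_canonical the_sq"
  interpret I: scat ?I by (rule scat_comma)
  interpret F: ftor X ?I ?F by (rule ftor_canonical)
  have v: "v = to_one X" "u' = to_one X" by (rule to_one_unique, unfold_locales)+
  have FO_pt: "FO v x = pt" "FO u' x = pt" if "x \<in> Ob X" for x using that by (simp_all add: v)
  have FA_pt: "FA v f = pt" "FA u' f = pt" if "f \<in> Ar X" for f using that by (simp_all add: v)
  have u_pt: "FA u pt = Idn B (FO u pt)" "FA w pt = Idn B (FO w pt)"
    using u.FA_idn[of pt] w.FA_idn[of pt] by simp_all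
  have IE: "\<exists>g. x = utriple pt pt g \<and> g \<in> Ar B \<and> Dom B g = FO u pt \<and> Cod B g = FO w pt" if "x \<in> Ob ?I" for x
    using that by (auto simp: comma_def Let_def hom_def)
  \<comment> \<open>\<open>?I\<close> is discrete: both components of an arrow are the arrow of
    \<open>e\<close>, which \<open>u\<close> and \<open>w\<close> send to identities, and
    commutation then gives \<open>g' = g\<close>.\<close>
  have IA: "\<exists>x y. t = utriple x (upair pt pt) y \<and> x \<in> Ob ?I \<and> y \<in> Ob ?I \<and> y = x" if "t \<in> Ar ?I" for t
  proof -
    obtain x f h y where t: "t = utriple x (upair f h) y" "x \<in> Ob ?I" "y \<in> Ob ?I"
      "f \<in> hom one_cat (p1 x) (p1 y)" "h \<in> hom one_cat (p2 x) (p2 y)" "Cmp B (p3 y) (FA u f) = Cmp B (FA w h) (p3 x)"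
      using in_comma_hom[OF \<open>t \<in> Ar ?I\<close>] by blast
    obtain g where g: "x = utriple pt pt g" "g \<in> Ar B" "Dom B g = FO u pt" "Cod B g = FO w pt" using IE[OF t(2)] by blast
    obtain g' where g': "y = utriple pt pt g'" "g' \<in> Ar B" "Dom B g' = FO u pt" "Cod B g' = FO w pt" using IE[OF t(3)] by blast
    have fh: "f = pt" "h = pt" using t(4,5) g(1) g'(1) by simp_all
    have "g' = g" using t(6) g g' unfolding fh u_pt by simp
    then show ?thesis using t(1-3) fh g g' by blast
  qed
  \<comment> \<open>The tautological cell: an object of \<open>?I\<close> amounts to an arrow of
    \<open>B\<close> between the two chosen objects.\<close>
  let ?\<gamma> = "\<lambda>x\<in>Ob ?I. p3 x"
  interpret K: sq one_cat B ?I one_cat "to_one ?I" w "to_one ?I" u ?\<gamma>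
  proof (intro sq.intro sq_axioms.intro I.ftor_to_one)
    fix x assume x: "x \<in> Ob ?I"
    from IE[OF x] obtain g where "x = utriple pt pt g" "g \<in> Ar B" "Dom B g = FO u pt" "Cod B g = FO w pt" by blast
    then show "?\<gamma> x \<in> Ar B" "Dom B (?\<gamma> x) = FO u (FO (to_one ?I) x)" "Cod B (?\<gamma> x) = FO w (FO (to_one ?I) x)"
      using x by simp_all
  next
    fix t assume t: "t \<in> Ar ?I"
    from IA[OF t] obtain x where x: "t = utriple x (upair pt pt) x" "x \<in> Ob ?I" by blast
    from IE[OF x(2)] obtain g where g: "x = utriple pt pt g" "g \<in> Ar B" "Dom B g = FO u pt" "Cod B g = FO w pt" by blast
    have "Dom ?I t = x" "Cod ?I t = x" using t x(1) Dom_comma Cod_comma by blast+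
    then show "Cmp B (?\<gamma> (Cod ?I t)) (FA u (FA (to_one ?I) t)) = Cmp B (FA w (FA (to_one ?I) t)) (?\<gamma> (Dom ?I t))"
      using t x(2) g u_pt by simp
  qed (use w.ftor_axioms u.ftor_axioms in simp_all)
  \<comment> \<open>The corner of \<open>K\<close> is the comma category itself, so its canonical
    functor is an identity rather than merely invertible.\<close>
  have "comma_canonical K.the_sq = id_func ?I"
  proof (rule func_eqI[OF K.ftor_canonical I.ftor_id])
    show FOK: "FO (comma_canonical K.the_sq) x = FO (id_func ?I) x" if "x \<in> Ob ?I" for x
      using IE[OF that] that by (auto simp: K.FO_canonical)
    fix t assume t: "t \<in> Ar ?I"
    from IA[OF t] obtain x where x: "t = utriple x (upair pt pt) x" "x \<in> Ob ?I" by blast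
    have "Dom ?I t = x" "Cod ?I t = x" using t x(1) Dom_comma Cod_comma by blast+
    then show "FA (comma_canonical K.the_sq) t = FA (id_func ?I) t"
      using t FOK[OF x(2)] x by (simp add: K.FA_canonical)
  qed
  then have "comma_square K.the_sq"
    using K.is_square I.is_iso_id by (simp add: comma_square_def)
  with Q have KQ: "K.the_sq \<in> Q" by (rule exactness_classD)
  have one: "ftor one_cat one_cat (id_func one_cat)"
    by (rule one_cat.ftor_id)
  let ?\<delta> = "\<lambda>x\<in>Ob X. pt"
  interpret E: sq ?I one_cat X one_cat ?F "id_func one_cat" "to_one X" "to_one ?I" ?\<delta>
    by (intro sq.intro sq_axioms.intro F.ftor_axioms one I.ftor_to_one v.A.ftor_to_one) simp_all
  \<comment> \<open>The third slot of the canonical image of \<open>x\<close> is the component of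
    \<alpha> at \<open>x\<close>, so pasting restores the given cell.\<close>
  have hcomp: "hcomp K.the_sq E.the_sq = the_sq"
  proof -
    have "cmp_func w (id_func one_cat) = w"
      by (rule func_eqI[OF ftor_cmp[OF one w.ftor_axioms] w.ftor_axioms]) simp_all
    moreover have "(\<lambda>x\<in>Ob X. Cmp B (FA w (?\<delta> x)) (?\<gamma> (FO ?F x))) = \<alpha>"
    proof (rule extensionalityI[OF _ ext_\<alpha>])
      fix x assume x: "x \<in> Ob X"
      then show "(\<lambda>x\<in>Ob X. Cmp B (FA w (?\<delta> x)) (?\<gamma> (FO ?F x))) x = \<alpha> x"
        using F.FO_in[OF x] by (simp add: FO_canonical u_pt FO_pt)
    qed simp
    ultimately show ?thesis
      using comp_to_one[OF F.ftor_axioms] by (simp add: hcomp_def v)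
  qed
  \<comment> \<open>Descent must run over \<open>?I\<close>, the target of the top side of
    \<open>E\<close>; in the opposite square this side is the left one.\<close>
  have "op_square E.the_sq \<in> Q"
  proof (rule exactness_classD(3)[OF Q])
    interpret O: sq "op_cat one_cat" "op_cat one_cat" "op_cat X" "op_cat ?I" "op_func (to_one X)" "op_func (to_one ?I)"
      "op_func ?F" "op_func (id_func one_cat)" ?\<delta>
      by (rule E.opposite)
    show "is_square (op_square E.the_sq)" using O.is_square by simp
    fix g assume "g \<in> Ob (Trg (Lft (op_square E.the_sq)))"
    then have g: "g \<in> Ob ?I" by simp
    then obtain \<gamma> where g': "g = utriple pt pt \<gamma>" "\<gamma> \<in> Ar B" "Dom B \<gamma> = FO u pt" "Cod B \<gamma> = FO w pt" using IE by blast
    let ?S = "slice (op_func ?F) g"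
    have S: "sq (op_cat X) (op_cat ?I) ?S one_cat (slice_forget (op_func ?F) g) (ob_func (op_cat ?I) g)
        (to_one ?S) (op_func ?F) (\<lambda>x\<in>Ob ?S. usnd x)"
      using g by (intro O.u'.sq_slice) simp
    note H = sq_hcomp[OF O.sq_axioms S, unfolded op_one_cat]
    have eq: "hcomp (op_square E.the_sq) (slice_square (Lft (op_square E.the_sq)) g) =
       \<lparr>Top = cmp_func (op_func (to_one X)) (slice_forget (op_func ?F) g),
        Bot = cmp_func (op_func (to_one ?I)) (ob_func (op_cat ?I) g), Lft = to_one ?S, Rgt = op_func (id_func one_cat),
        Cell = (\<lambda>x\<in>Ob ?S. Cmp one_cat (FA (op_func (to_one ?I)) ((\<lambda>x\<in>Ob ?S. usnd x) x)) (?\<delta> (FO (slice_forget (op_func ?F) g) x)))\<rparr>"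
      by (simp add: hcomp_def slice_square_eq)
    \<comment> \<open>Since \<open>?I\<close> is discrete, \<open>?S\<close> is the opposite of the
      fibre of \<open>?F\<close> over \<open>g\<close>. Its objects are the \<open>x\<close> at
      which \<alpha> takes the value \<open>\<gamma>\<close>, and these are the factorizations of
      \<open>\<gamma>\<close>, whose other two slots are \<open>pt\<close>.\<close>
    have "aspherical W ?S"
    proof -
      let ?X = "fact_obj the_sq pt pt \<gamma>" and ?H = "\<lambda>x y. fact_hom the_sq y x" and ?i = "\<lambda>x. Idn X (p1 x)" and ?m = "\<lambda>g f. Cmp X f g"
      let ?Y = "over_obj (Ob X) (hom (op_cat ?I)) (FO ?F) g" and ?K = "over_hom (hom (op_cat X)) (Cmp (op_cat ?I)) (FA ?F)"
        and ?j = "\<lambda>s. Idn X (ufst s)"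
      have "aspherical W (factorization_cat the_sq pt pt \<gamma>)"
        using exact g' unfolding exact_iff by simp
      then have "aspherical W (mk_cat ?X ?H ?i ?m)"
        using aspherical_mk_op_iff[OF catdata_fact] by (simp add: fact_cat_eq)
      interpret X: catdata ?X ?H ?i ?m by (rule catdata.opposite[OF catdata_fact])
      have Y: "catdata ?Y ?K ?j (Cmp (op_cat X))" using O.u'.catdata_slice[of g] g by simp
      interpret Y: catdata ?Y ?K ?j "Cmp (op_cat X)" by (rule Y)
      have XE: "s = utriple (p1 s) pt pt \<and> p1 s \<in> Ob X \<and> \<alpha> (p1 s) = \<gamma>" if "s \<in> ?X" for s
      proof -
        obtain x f h where s: "s = utriple x f h" "x \<in> Ob X" "f \<in> Ar one_cat" "h \<in> Ar one_cat"
          "Cmp B (FA w h) (Cmp B (\<alpha> x) (FA u f)) = \<gamma>"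
          using \<open>s \<in> ?X\<close> by (rule fact_objE)
        have "f = pt" "h = pt" using s(3,4) by simp_all
        then show ?thesis using s(1,2,5) u_pt by (simp add: FO_pt)
      qed
      have X: "utriple x pt pt \<in> ?X" if "x \<in> Ob X" "\<alpha> x = \<gamma>" for x
        using that g' u_pt by (simp add: in_fact_obj FO_pt)
      have Fx: "FO ?F x = g \<longleftrightarrow> \<alpha> x = \<gamma>" if "x \<in> Ob X" for x
        using that g'(1) by (simp add: FO_canonical FO_pt)
      have Ig: "Idn ?I g = utriple g (upair pt pt) g"
        using g g'(1) by (simp add: Idn_comma)
      have YE: "y = upair (ufst y) (Idn ?I g) \<and> ufst y \<in> Ob X \<and> \<alpha> (ufst y) = \<gamma>" if "y \<in> ?Y" for y
      proof -
        obtain x k where y: "y = upair x k" "x \<in> Ob X" "k \<in> Ar ?I" "Dom ?I k = g" "Cod ?I k = FO ?F x"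
          using \<open>y \<in> ?Y\<close> by (auto simp: over_obj_def hom_def)
        from IA[OF y(3)] obtain z where z: "k = utriple z (upair pt pt) z" by blast
        then have "z = g" "z = FO ?F x" using y(3-5) Dom_comma Cod_comma by metis+
        then show ?thesis using y z Ig Fx[OF y(2)] by simp
      qed
      have Y: "upair x (Idn ?I g) \<in> ?Y" if "x \<in> Ob X" "\<alpha> x = \<gamma>" for x
        using that g Fx[OF that(1)] by (simp add: over_obj_def hom_def)
      have hom: "h \<in> ?K (upair (p1 s) (Idn ?I g)) (upair (p1 t) (Idn ?I g)) \<longleftrightarrow> h \<in> ?H s t"
        if s: "s \<in> ?X" and t: "t \<in> ?X" for s t h
      proof -
        have s': "s = utriple (p1 s) pt pt" "p1 s \<in> Ob X" "FO ?F (p1 s) = g" using XE[OF s] Fx by simp_all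
        have t': "t = utriple (p1 t) pt pt" "p1 t \<in> Ob X" "FO ?F (p1 t) = g" using XE[OF t] Fx by simp_all
        have "FA ?F h = Idn ?I g" if "h \<in> Ar X" "Dom X h = p1 t" "Cod X h = p1 s"
          using that s'(3) t'(3) by (simp add: FA_canonical FA_pt Ig)
        moreover have "Cmp ?I (Idn ?I g) (Idn ?I g) = Idn ?I g" using g by simp
        ultimately have "h \<in> ?K (upair (p1 s) (Idn ?I g)) (upair (p1 t) (Idn ?I g)) \<longleftrightarrow> h \<in> hom X (p1 t) (p1 s)"
          by (auto simp: over_hom_def hom_def)
        also have "\<dots> \<longleftrightarrow> h \<in> ?H s t"
          by (subst (2) s'(1), subst (2) t'(1)) (auto simp: in_fact_hom hom_def FA_pt)
        finally show ?thesis .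
      qed
      have "aspherical W (mk_cat ?X ?H ?i ?m) \<longleftrightarrow> aspherical W (mk_cat ?Y ?K ?j (Cmp (op_cat X)))"
      proof (rule aspherical_mk_iff_of_surj_ff[where \<phi> = "\<lambda>s. upair (p1 s) (Idn ?I g)" and \<kappa> = "\<lambda>h. h"])
        show "functordata ?X ?H ?i ?m ?Y ?K ?j (Cmp (op_cat X)) (\<lambda>s. upair (p1 s) (Idn ?I g)) (\<lambda>h. h)"
          by unfold_locales (simp_all add: hom Y XE)
        fix y assume "y \<in> ?Y"
        with YE[OF this] X[of "ufst y"] show "\<exists>s\<in>?X. upair (p1 s) (Idn ?I g) = y"
          by (intro bexI[of _ "utriple (ufst y) pt pt"]) simp_all
      qed (auto simp: hom)
      then show ?thesis
        using \<open>aspherical W (mk_cat ?X ?H ?i ?m)\<close> unfolding O.u'.slice_eq by simp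
    qed
    then show "hcomp (op_square E.the_sq) (slice_square (Lft (op_square E.the_sq)) g) \<in> Q"
      unfolding eq by (rule exactness_classD(5)[OF Q sq_over_one(1)[OF H]]) (use sq_over_one(2-5)[OF H] in simp_all)
  qed
  then have "op_square (op_square E.the_sq) \<in> Q" by (rule exactness_classD(1)[OF Q])
  then have "E.the_sq \<in> Q" unfolding op_op_square .
  then have "hcomp K.the_sq E.the_sq \<in> Q" using KQ by (intro exactness_classD(2)[OF Q]) simp_all
  then show ?thesis unfolding hcomp .
qed

text \<open>The corner \<open>e\<close> at the lower left becomes the upper right corner of the
  opposite square, which descent does not touch. Cutting that square along \<open>op_func v\<close>
  puts a second \<open>e\<close> in place of \<open>A\<close>, and \<open>exact_in_class_one\<close>
  applies.\<close>

lemma exact_in_class_left_one: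
  assumes Q: "exactness_class W Q" and sq: "sq A B X one_cat v w u' u \<alpha>"
    and exact: "exact_square W \<lparr>Top = v, Bot = w, Lft = u', Rgt = u, Cell = \<alpha>\<rparr>"
  shows "\<lparr>Top = v, Bot = w, Lft = u', Rgt = u, Cell = \<alpha>\<rparr> \<in> Q"
proof -
  interpret sq A B X one_cat v w u' u \<alpha> by fact
  interpret O: sq one_cat "op_cat B" "op_cat X" "op_cat A" "op_func u'" "op_func u" "op_func v" "op_func w" \<alpha>
    using opposite by simp
  have op: "exact_square W O.the_sq" using exact_op[OF exact] by simp
  have "O.the_sq \<in> Q"
  proof (rule exactness_classD(3)[OF Q O.is_square])
    fix a assume a: "a \<in> Ob (Trg (Lft O.the_sq))"
    have eq: "hcomp O.the_sq (slice_square (op_func v) a) =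
       \<lparr>Top = cmp_func (op_func u') (slice_forget (op_func v) a),
        Bot = cmp_func (op_func u) (ob_func (op_cat A) a), Lft = to_one (slice (op_func v) a), Rgt = op_func w,
        Cell = (\<lambda>x\<in>Ob (slice (op_func v) a). Cmp (op_cat B)
          (FA (op_func u) ((\<lambda>x\<in>Ob (slice (op_func v) a). usnd x) x)) (\<alpha> (FO (slice_forget (op_func v) a) x)))\<rparr>"
      by (simp add: hcomp_def slice_square_eq)
    have "exact_square W (hcomp O.the_sq (slice_square (op_func v) a))"
      using exact_hcomp_slice[OF op a] by simp
    moreover have "sq (op_cat X) (op_cat A) (slice (op_func v) a) one_cat (slice_forget (op_func v) a)
        (ob_func (op_cat A) a) (to_one (slice (op_func v) a)) (op_func v) (\<lambda>x\<in>Ob (slice (op_func v) a). usnd x)"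
      using a by (intro O.u'.sq_slice) simp
    from exact_in_class_one[OF Q sq_hcomp[OF O.sq_axioms this]] calculation
    have "hcomp O.the_sq (slice_square (op_func v) a) \<in> Q" unfolding eq by blast
    then show "hcomp O.the_sq (slice_square (Lft O.the_sq) a) \<in> Q" by simp
  qed
  from exactness_classD(1)[OF Q this] show ?thesis by simp
qed

lemma exact_in_class:
  assumes Q: "exactness_class W Q" and exact: "exact_square W D"
  shows "D \<in> Q"
proof -
  have "is_square D" using exact by (simp add: exact_square_def)
  then obtain A B A' B' v w u' u \<alpha> where D: "D = \<lparr>Top = v, Bot = w, Lft = u', Rgt = u, Cell = \<alpha>\<rparr>"
    and sq: "sq A B A' B' v w u' u \<alpha>"
    by (rule is_squareE)
  interpret sq A B A' B' v w u' u \<alpha> by fact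
  have "the_sq \<in> Q"
  proof (rule exactness_classD(3)[OF Q is_square])
    fix b assume b: "b \<in> Ob (Trg (Lft the_sq))"
    have eq: "hcomp the_sq (slice_square u' b) =
       \<lparr>Top = cmp_func v (slice_forget u' b), Bot = cmp_func w (ob_func B' b), Lft = to_one (slice u' b), Rgt = u,
        Cell = (\<lambda>x\<in>Ob (slice u' b). Cmp B (FA w ((\<lambda>x\<in>Ob (slice u' b). usnd x) x)) (\<alpha> (FO (slice_forget u' b) x)))\<rparr>"
      by (simp add: hcomp_def slice_square_eq)
    have "exact_square W (hcomp the_sq (slice_square u' b))"
      using exact_hcomp_slice[OF exact[unfolded D] b] by simp
    moreover have "sq A' B' (slice u' b) one_cat (slice_forget u' b) (ob_func B' b) (to_one (slice u' b)) u' (\<lambda>x\<in>Ob (slice u' b). usnd x)"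
      using b by (intro u'.sq_slice) simp
    from exact_in_class_left_one[OF Q sq_hcomp[OF sq this]] calculation
    have "hcomp the_sq (slice_square u' b) \<in> Q" unfolding eq by blast
    then show "hcomp the_sq (slice_square (Lft the_sq) b) \<in> Q" by simp
  qed
  then show ?thesis by (simp add: D)
qed

end

theorem mainTheorem1:
  fixes W :: "'u::universe func set"
  assumes "weak_fundamental_localizer W"
  shows "exactness_class W {D. exact_square W D} \<and>
         (\<forall>Q. exactness_class W Q \<longrightarrow> {D. exact_square W D} \<subseteq> Q)"
proof (intro conjI allI impI subsetI)
  interpret localizer W using assms by unfold_locales
  show "exactness_class W {D. exact_square W D}"
    unfolding exactness_class_def
  proof (intro conjI)
    show "\<forall>D\<in>{D. exact_square W D}. is_square D" by (simp add: exact_square_def)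
    show "iso_closed {D. exact_square W D}" unfolding iso_closed_def using exact_iso by blast
    show "op_stable {D. exact_square W D}" unfolding op_stable_def using exact_op by blast
    show "hcomp_stable {D. exact_square W D}" unfolding hcomp_stable_def using exact_hcomp by blast
    show "local_descent {D. exact_square W D}" unfolding local_descent_def using exact_local by blast
    show "\<forall>D. comma_square D \<longrightarrow> D \<in> {D. exact_square W D}" using exact_comma by blast
    show "\<forall>D C. commutative_square D \<and> aspherical W C \<and> Top D = to_one C \<and> Lft D = to_one C \<and>
        Rgt D = id_func one_cat \<and> Bot D = id_func one_cat \<longrightarrow> D \<in> {D. exact_square W D}"
      using exact_aspherical unfolding commutative_square_def by blast
  qed
  show "D \<in> Q" if "exactness_class W Q" "D \<in> {D. exact_square W D}" for D Q
    using that exact_in_class by blast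
qed

end
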